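(* Let $A$ be an integral Poisson algebra over $\Bbbk$ with the abelian weight property and such that its Poisson semi-centre $A^{\mathrm{sc}}$ is a finitely generated $\Bbbk$-algebra. Then the Poisson Dixmier--Mœglin equivalence holds for the Poisson algebra $A^{\mathrm{sc}}$: for every Poisson prime ideal $I$ of $A^{\mathrm{sc}}$, the properties that $I$ is locally closed, that $I$ is Poisson primitive, and that $I$ is rational are equivalent.
   Context: $\Bbbk$ is a field of characteristic zero. A Poisson algebra over $\Bbbk$ is a commutative associative unital $\Bbbk$-algebra with a $\Bbbk$-bilinear Lie bracket $\{\cdot,\cdot\}$ that is a derivation in each argument. It is integral if it is an integral domain. A Poisson ideal is an ideal $I$ of $A$ with $\{A,I\}\subseteq I$. An element $a\in A$ is Poisson normal if $\{A,a\}\subseteq Aa$. The Poisson semi-centre $A^{\mathrm{sc}}$ is the $\Bbbk$-subalgebra of $A$ generated by the Poisson normal elements of $A$. A Poisson derivation of $A$ is a $\Bbbk$-linear map $\lambda:A\to A$ that is a derivation both of the associative product and of the bracket; $\operatorname{Der}_{\mathcal P}(A)$ is the Lie algebra (under commutator) of Poisson derivations. For $\lambda\in \operatorname{Der}_{\mathcal P}(A)$ put $A_\lambda=\{a\in A \mid \{b,a\}=\lambda(b)a \text{ for all } b\in A\}$, and let $\Lambda(A)=\{\lambda\in\operatorname{Der}_{\mathcal P}(A)\mid A_\lambda\neq 0\}$. $A$ has the abelian weight property if $[\lambda,\mu]=0$ for all $\lambda,\mu\in\Lambda(A)$; in that case $A^{\mathrm{sc}}$ is a Poisson subalgebra of $A$.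 For a Poisson algebra $B$, the Poisson spectrum $\mathcal{P}\text{-}\operatorname{Spec}(B)$ is the set of Poisson prime ideals of $B$ (prime ideals that are Poisson ideals), with the topology induced from the Zariski topology on $\operatorname{Spec}(B)$. A Poisson prime ideal $I$ of $B$ is: locally closed if $\{I\}$ is a locally closed subset of $\mathcal{P}\text{-}\operatorname{Spec}(B)$; Poisson primitive if it is the largest Poisson ideal contained in some maximal ideal of $B$; rational if the Poisson centre of the quotient field of $B/I$ (the set of elements having zero bracket with every element, for the unique extension of the Poisson bracket from $B/I$ to its quotient field) is algebraic over $\Bbbk$. *)

theory Defs
  imports "HOL-Analysis.Abstract_Topology" "HOL-Algebra.QuotRing" "HOL-Algebra.Finite_Extensions"
begin

section \<open>Poisson algebras\<close>

definition char_zero :: "('k, 'm) ring_scheme \<Rightarrow> bool"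
  where "char_zero K \<longleftrightarrow> (\<forall>n::nat. n > 0 \<longrightarrow> [n] \<cdot>\<^bsub>K\<^esub> \<one>\<^bsub>K\<^esub> \<noteq> \<zero>\<^bsub>K\<^esub>)"

record ('k, 'a) poisson = "('k, 'a) module" +
  pbracket :: "['a, 'a] \<Rightarrow> 'a"  (\<open>\<lbrace>_,/ _\<rbrace>\<index>\<close>)

locale poisson_algebra = K?: field K + A?: algebra K A
  for K :: "('k, 'm) ring_scheme" and A :: "('k, 'a, 'n) poisson_scheme" (structure) +
  assumes bracket_closed:
      "\<lbrakk>a \<in> carrier A; b \<in> carrier A\<rbrakk> \<Longrightarrow> \<lbrace>a, b\<rbrace> \<in> carrier A"
    and bracket_add_left:
      "\<lbrakk>a \<in> carrier A; b \<in> carrier A; c \<in> carrier A\<rbrakk> \<Longrightarrow> \<lbrace>a \<oplus> b, c\<rbrace> = \<lbrace>a, c\<rbrace> \<oplus> \<lbrace>b, c\<rbrace>"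
    and bracket_add_right:
      "\<lbrakk>a \<in> carrier A; b \<in> carrier A; c \<in> carrier A\<rbrakk> \<Longrightarrow> \<lbrace>a, b \<oplus> c\<rbrace> = \<lbrace>a, b\<rbrace> \<oplus> \<lbrace>a, c\<rbrace>"
    and bracket_smult_left:
      "\<lbrakk>r \<in> carrier K; a \<in> carrier A; b \<in> carrier A\<rbrakk> \<Longrightarrow> \<lbrace>r \<odot> a, b\<rbrace> = r \<odot> \<lbrace>a, b\<rbrace>"
    and bracket_smult_right:
      "\<lbrakk>r \<in> carrier K; a \<in> carrier A; b \<in> carrier A\<rbrakk> \<Longrightarrow> \<lbrace>a, r \<odot> b\<rbrace> = r \<odot> \<lbrace>a, b\<rbrace>"
    and bracket_alternating:
      "a \<in> carrier A \<Longrightarrow> \<lbrace>a, a\<rbrace> = \<zero>"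
    and bracket_jacobi:
      "\<lbrakk>a \<in> carrier A; b \<in> carrier A; c \<in> carrier A\<rbrakk> \<Longrightarrow>
        \<lbrace>a, \<lbrace>b, c\<rbrace>\<rbrace> \<oplus> \<lbrace>b, \<lbrace>c, a\<rbrace>\<rbrace> \<oplus> \<lbrace>c, \<lbrace>a, b\<rbrace>\<rbrace> = \<zero>"
    and bracket_leibniz_left:
      "\<lbrakk>a \<in> carrier A; b \<in> carrier A; c \<in> carrier A\<rbrakk> \<Longrightarrow>
        \<lbrace>a \<otimes> b, c\<rbrace> = a \<otimes> \<lbrace>b, c\<rbrace> \<oplus> \<lbrace>a, c\<rbrace> \<otimes> b"
    and bracket_leibniz_right:
      "\<lbrakk>a \<in> carrier A; b \<in> carrier A; c \<in> carrier A\<rbrakk> \<Longrightarrow>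
        \<lbrace>a, b \<otimes> c\<rbrace> = b \<otimes> \<lbrace>a, c\<rbrace> \<oplus> \<lbrace>a, b\<rbrace> \<otimes> c"

context poisson_algebra
begin

lemma bracket_antisym:
  assumes "a \<in> carrier A" "b \<in> carrier A"
  shows "\<lbrace>a, b\<rbrace> = \<ominus> \<lbrace>b, a\<rbrace>"
proof -
  have "\<zero> = \<lbrace>a \<oplus> b, a \<oplus> b\<rbrace>" using assms bracket_alternating by simp
  also have "\<dots> = \<lbrace>a, b\<rbrace> \<oplus> \<lbrace>b, a\<rbrace>"
    using assms bracket_closed[of a b] bracket_closed[of b a]
    by (simp add: bracket_add_left bracket_add_right)
      (simp add: bracket_alternating A.M.a_comm)
  finally show ?thesis
    using assms bracket_closed by (metis A.M.minus_equality)
qed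

end

definition poisson_ideal :: "'a set \<Rightarrow> ('k, 'a, 'n) poisson_scheme \<Rightarrow> bool"
  where "poisson_ideal I A \<longleftrightarrow>
    ideal I A \<and> (\<forall>a \<in> carrier A. \<forall>x \<in> I. \<lbrace>a, x\<rbrace>\<^bsub>A\<^esub> \<in> I)"

definition poisson_normal :: "('k, 'a, 'n) poisson_scheme \<Rightarrow> 'a \<Rightarrow> bool"
  where "poisson_normal A a \<longleftrightarrow>
    a \<in> carrier A \<and> (\<forall>b \<in> carrier A. \<lbrace>b, a\<rbrace>\<^bsub>A\<^esub> \<in> PIdl\<^bsub>A\<^esub> a)"

definition generated_subalgebra ::
    "('k, 'm) ring_scheme \<Rightarrow> ('k, 'a, 'n) module_scheme \<Rightarrow> 'a set \<Rightarrow> 'a set"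
  where "generated_subalgebra K A S = \<Inter>{B. subring B A \<and> submodule B K A \<and> S \<subseteq> B}"

definition finitely_generated_algebra ::
    "('k, 'm) ring_scheme \<Rightarrow> ('k, 'a, 'n) module_scheme \<Rightarrow> bool"
  where "finitely_generated_algebra K A \<longleftrightarrow>
    (\<exists>S. finite S \<and> S \<subseteq> carrier A \<and> generated_subalgebra K A S = carrier A)"

definition semicentre ::
    "('k, 'm) ring_scheme \<Rightarrow> ('k, 'a, 'n) poisson_scheme \<Rightarrow> ('k, 'a, 'n) poisson_scheme"
  where "semicentre K A = A\<lparr>carrier := generated_subalgebra K A {a. poisson_normal A a}\<rparr>"


section \<open>Poisson derivations and the abelian weight property\<close>

text \<open>Derivations are functions on the whole type; only their values on the carrier matter.\<close>

definition poisson_derivations ::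
    "('k, 'm) ring_scheme \<Rightarrow> ('k, 'a, 'n) poisson_scheme \<Rightarrow> ('a \<Rightarrow> 'a) set"
  where "poisson_derivations K A = {f \<in> carrier A \<rightarrow> carrier A.
    (\<forall>a \<in> carrier A. \<forall>b \<in> carrier A. f (a \<oplus>\<^bsub>A\<^esub> b) = f a \<oplus>\<^bsub>A\<^esub> f b) \<and>
    (\<forall>r \<in> carrier K. \<forall>a \<in> carrier A. f (r \<odot>\<^bsub>A\<^esub> a) = r \<odot>\<^bsub>A\<^esub> f a) \<and>
    (\<forall>a \<in> carrier A. \<forall>b \<in> carrier A. f (a \<otimes>\<^bsub>A\<^esub> b) = a \<otimes>\<^bsub>A\<^esub> f b \<oplus>\<^bsub>A\<^esub> f a \<otimes>\<^bsub>A\<^esub> b) \<and>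
    (\<forall>a \<in> carrier A. \<forall>b \<in> carrier A. f \<lbrace>a, b\<rbrace>\<^bsub>A\<^esub> = \<lbrace>f a, b\<rbrace>\<^bsub>A\<^esub> \<oplus>\<^bsub>A\<^esub> \<lbrace>a, f b\<rbrace>\<^bsub>A\<^esub>)}"

definition commutator :: "('a, 'n) ring_scheme \<Rightarrow> ('a \<Rightarrow> 'a) \<Rightarrow> ('a \<Rightarrow> 'a) \<Rightarrow> 'a \<Rightarrow> 'a"
  where "commutator A f g = (\<lambda>a. f (g a) \<ominus>\<^bsub>A\<^esub> g (f a))"

definition weight_space :: "('k, 'a, 'n) poisson_scheme \<Rightarrow> ('a \<Rightarrow> 'a) \<Rightarrow> 'a set"
  where "weight_space A f =
    {a \<in> carrier A. \<forall>b \<in> carrier A. \<lbrace>b, a\<rbrace>\<^bsub>A\<^esub> = f b \<otimes>\<^bsub>A\<^esub> a}"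

definition weights ::
    "('k, 'm) ring_scheme \<Rightarrow> ('k, 'a, 'n) poisson_scheme \<Rightarrow> ('a \<Rightarrow> 'a) set"
  where "weights K A = {f \<in> poisson_derivations K A. weight_space A f \<noteq> {\<zero>\<^bsub>A\<^esub>}}"

definition abelian_weight_property ::
    "('k, 'm) ring_scheme \<Rightarrow> ('k, 'a, 'n) poisson_scheme \<Rightarrow> bool"
  where "abelian_weight_property K A \<longleftrightarrow>
    (\<forall>f \<in> weights K A. \<forall>g \<in> weights K A. \<forall>a \<in> carrier A. commutator A f g a = \<zero>\<^bsub>A\<^esub>)"


section \<open>Quotients and quotient fields of Poisson algebras\<close>

text \<open>As in \<^const>\<open>rcoset_mult\<close>, operations on classes are unions over all representatives; when
  \<open>I\<close> is a Poisson ideal these unions are single cosets.\<close>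

definition poisson_quot :: "('k, 'a, 'n) poisson_scheme \<Rightarrow> 'a set \<Rightarrow> ('k, 'a set) poisson"
  where "poisson_quot A I =
    \<lparr>carrier = carrier (A Quot I), mult = (\<otimes>\<^bsub>A Quot I\<^esub>), one = \<one>\<^bsub>A Quot I\<^esub>,
     zero = \<zero>\<^bsub>A Quot I\<^esub>, add = (\<oplus>\<^bsub>A Quot I\<^esub>),
     smult = (\<lambda>r U. \<Union>x\<in>U. I +>\<^bsub>A\<^esub> (r \<odot>\<^bsub>A\<^esub> x)),
     pbracket = (\<lambda>U V. \<Union>x\<in>U. \<Union>y\<in>V. I +>\<^bsub>A\<^esub> \<lbrace>x, y\<rbrace>\<^bsub>A\<^esub>)\<rparr>"

lemma poisson_quot_bracket:
  assumes "poisson_algebra K A" "poisson_ideal I A" "a \<in> carrier A" "b \<in> carrier A"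
  shows "\<lbrace>I +>\<^bsub>A\<^esub> a, I +>\<^bsub>A\<^esub> b\<rbrace>\<^bsub>poisson_quot A I\<^esub> = I +>\<^bsub>A\<^esub> \<lbrace>a, b\<rbrace>\<^bsub>A\<^esub>"
proof -
  interpret poisson_algebra K A by fact
  interpret ideal I A using assms(2) by (simp add: poisson_ideal_def)
  have br: "\<lbrace>x, i\<rbrace>\<^bsub>A\<^esub> \<in> I" "\<lbrace>i, x\<rbrace>\<^bsub>A\<^esub> \<in> I" if "x \<in> carrier A" "i \<in> I" for x i
    using that assms(2) bracket_antisym[of i x] a_Hcarr by (auto simp: poisson_ideal_def)
  have "I +>\<^bsub>A\<^esub> \<lbrace>x, y\<rbrace>\<^bsub>A\<^esub> = I +>\<^bsub>A\<^esub> \<lbrace>a, b\<rbrace>\<^bsub>A\<^esub>"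
    if xy: "x \<in> I +>\<^bsub>A\<^esub> a" "y \<in> I +>\<^bsub>A\<^esub> b" for x y
  proof -
    obtain i j where i: "i \<in> I" "x = i \<oplus>\<^bsub>A\<^esub> a" and j: "j \<in> I" "y = j \<oplus>\<^bsub>A\<^esub> b"
      using xy by (auto simp: a_r_coset_def')
    have c: "i \<in> carrier A" "j \<in> carrier A" "y \<in> carrier A"
      using i j a_Hcarr assms by auto
    have "\<lbrace>x, y\<rbrace>\<^bsub>A\<^esub> = (\<lbrace>i, y\<rbrace>\<^bsub>A\<^esub> \<oplus>\<^bsub>A\<^esub> \<lbrace>a, j\<rbrace>\<^bsub>A\<^esub>) \<oplus>\<^bsub>A\<^esub> \<lbrace>a, b\<rbrace>\<^bsub>A\<^esub>"
      using c assms bracket_closed unfolding i j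
      by (simp add: bracket_add_left bracket_add_right A.M.a_ac)
    moreover have "\<lbrace>i, y\<rbrace>\<^bsub>A\<^esub> \<oplus>\<^bsub>A\<^esub> \<lbrace>a, j\<rbrace>\<^bsub>A\<^esub> \<in> I"
      using br(1)[OF assms(3) j(1)] br(2)[OF c(3) i(1)] by simp
    ultimately have "\<lbrace>x, y\<rbrace>\<^bsub>A\<^esub> \<in> I +>\<^bsub>A\<^esub> \<lbrace>a, b\<rbrace>\<^bsub>A\<^esub>"
      by (auto simp: a_r_coset_def')
    then show ?thesis
      using a_repr_independence bracket_closed assms a_subgroup by metis
  qed
  moreover have "a \<in> I +>\<^bsub>A\<^esub> a" "b \<in> I +>\<^bsub>A\<^esub> b"
    using assms a_rcos_self by auto
  ultimately have "(\<Union>x \<in> I +>\<^bsub>A\<^esub> a. \<Union>y \<in> I +>\<^bsub>A\<^esub> b. I +>\<^bsub>A\<^esub> \<lbrace>x, y\<rbrace>\<^bsub>A\<^esub>) =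
      I +>\<^bsub>A\<^esub> \<lbrace>a, b\<rbrace>\<^bsub>A\<^esub>"
    by blast
  then show ?thesis
    by (simp add: poisson_quot_def)
qed

definition frac_rel :: "('a, 'n) ring_scheme \<Rightarrow> (('a \<times> 'a) \<times> ('a \<times> 'a)) set"
  where "frac_rel D = {((a, b), (c, d)).
    a \<in> carrier D \<and> b \<in> carrier D - {\<zero>\<^bsub>D\<^esub>} \<and> c \<in> carrier D \<and> d \<in> carrier D - {\<zero>\<^bsub>D\<^esub>} \<and>
    a \<otimes>\<^bsub>D\<^esub> d = c \<otimes>\<^bsub>D\<^esub> b}"

definition fraction :: "('a, 'n) ring_scheme \<Rightarrow> 'a \<Rightarrow> 'a \<Rightarrow> ('a \<times> 'a) set"
  where "fraction D a b = frac_rel D `` {(a, b)}"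

text \<open>The bracket is the one forced by the quotient rule,
  \<open>{a/b, c/d} = (bd{a,c} - bc{a,d} - ad{b,c} + ac{b,d}) / (bd)^2\<close>.\<close>

definition frac_bracket_num :: "('k, 'a, 'n) poisson_scheme \<Rightarrow> 'a \<Rightarrow> 'a \<Rightarrow> 'a \<Rightarrow> 'a \<Rightarrow> 'a"
  where "frac_bracket_num D a b c d =
    (((b \<otimes>\<^bsub>D\<^esub> d) \<otimes>\<^bsub>D\<^esub> \<lbrace>a, c\<rbrace>\<^bsub>D\<^esub> \<ominus>\<^bsub>D\<^esub> (b \<otimes>\<^bsub>D\<^esub> c) \<otimes>\<^bsub>D\<^esub> \<lbrace>a, d\<rbrace>\<^bsub>D\<^esub>)
      \<ominus>\<^bsub>D\<^esub> (a \<otimes>\<^bsub>D\<^esub> d) \<otimes>\<^bsub>D\<^esub> \<lbrace>b, c\<rbrace>\<^bsub>D\<^esub>) \<oplus>\<^bsub>D\<^esub> (a \<otimes>\<^bsub>D\<^esub> c) \<otimes>\<^bsub>D\<^esub> \<lbrace>b, d\<rbrace>\<^bsub>D\<^esub>"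

definition poisson_frac :: "('k, 'a, 'n) poisson_scheme \<Rightarrow> ('k, ('a \<times> 'a) set) poisson"
  where "poisson_frac D =
    \<lparr>carrier = (carrier D \<times> (carrier D - {\<zero>\<^bsub>D\<^esub>})) // frac_rel D,
     mult = (\<lambda>U V. \<Union>(a, b)\<in>U. \<Union>(c, d)\<in>V. fraction D (a \<otimes>\<^bsub>D\<^esub> c) (b \<otimes>\<^bsub>D\<^esub> d)),
     one = fraction D \<one>\<^bsub>D\<^esub> \<one>\<^bsub>D\<^esub>,
     zero = fraction D \<zero>\<^bsub>D\<^esub> \<one>\<^bsub>D\<^esub>,
     add = (\<lambda>U V. \<Union>(a, b)\<in>U. \<Union>(c, d)\<in>V.
       fraction D (a \<otimes>\<^bsub>D\<^esub> d \<oplus>\<^bsub>D\<^esub> c \<otimes>\<^bsub>D\<^esub> b) (b \<otimes>\<^bsub>D\<^esub> d)),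
     smult = (\<lambda>r U. \<Union>(a, b)\<in>U. fraction D (r \<odot>\<^bsub>D\<^esub> a) b),
     pbracket = (\<lambda>U V. \<Union>(a, b)\<in>U. \<Union>(c, d)\<in>V.
       fraction D (frac_bracket_num D a b c d) ((b \<otimes>\<^bsub>D\<^esub> d) \<otimes>\<^bsub>D\<^esub> (b \<otimes>\<^bsub>D\<^esub> d)))\<rparr>"

lemma equiv_frac_rel:
  assumes "domain D"
  shows "equiv (carrier D \<times> (carrier D - {\<zero>\<^bsub>D\<^esub>})) (frac_rel D)"
proof -
  interpret domain D by fact
  show ?thesis
  proof (rule equivI)
    show "frac_rel D \<subseteq> (carrier D \<times> (carrier D - {\<zero>\<^bsub>D\<^esub>})) \<times> (carrier D \<times> (carrier D - {\<zero>\<^bsub>D\<^esub>}))"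
      by (auto simp: frac_rel_def)
    show "refl_on (carrier D \<times> (carrier D - {\<zero>\<^bsub>D\<^esub>})) (frac_rel D)"
      by (auto simp: refl_on_def frac_rel_def)
    show "sym (frac_rel D)"
      by (auto simp: sym_def frac_rel_def)
    show "trans (frac_rel D)"
    proof (clarsimp simp: trans_def frac_rel_def)
      fix a b c d e f
      assume *: "a \<in> carrier D" "b \<in> carrier D" "c \<in> carrier D" "d \<in> carrier D"
        "e \<in> carrier D" "f \<in> carrier D" "d \<noteq> \<zero>\<^bsub>D\<^esub>"
        and ad: "a \<otimes>\<^bsub>D\<^esub> d = c \<otimes>\<^bsub>D\<^esub> b" and cf: "c \<otimes>\<^bsub>D\<^esub> f = e \<otimes>\<^bsub>D\<^esub> d"
      have "d \<otimes>\<^bsub>D\<^esub> (a \<otimes>\<^bsub>D\<^esub> f) = (a \<otimes>\<^bsub>D\<^esub> d) \<otimes>\<^bsub>D\<^esub> f"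
        using * by algebra
      also have "\<dots> = (c \<otimes>\<^bsub>D\<^esub> f) \<otimes>\<^bsub>D\<^esub> b"
        unfolding ad using * by algebra
      also have "\<dots> = d \<otimes>\<^bsub>D\<^esub> (e \<otimes>\<^bsub>D\<^esub> b)"
        unfolding cf using * by algebra
      finally show "a \<otimes>\<^bsub>D\<^esub> f = e \<otimes>\<^bsub>D\<^esub> b"
        using m_lcancel * by simp
    qed
  qed
qed

lemma frac_eq_iff:
  assumes "domain D" "a \<in> carrier D" "b \<in> carrier D - {\<zero>\<^bsub>D\<^esub>}"
    "c \<in> carrier D" "d \<in> carrier D - {\<zero>\<^bsub>D\<^esub>}"
  shows "fraction D a b = fraction D c d \<longleftrightarrow> a \<otimes>\<^bsub>D\<^esub> d = c \<otimes>\<^bsub>D\<^esub> b"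
  unfolding fraction_def using assms
  by (subst eq_equiv_class_iff[OF equiv_frac_rel]) (auto simp: frac_rel_def)

context poisson_algebra
begin

lemma frac_bracket_num_left:
  assumes c: "a \<in> carrier A" "b \<in> carrier A" "a' \<in> carrier A" "b' \<in> carrier A"
    "c \<in> carrier A" "d \<in> carrier A" and e: "a \<otimes> b' = a' \<otimes> b"
  shows "frac_bracket_num A a b c d \<otimes> ((b' \<otimes> d) \<otimes> (b' \<otimes> d)) =
    frac_bracket_num A a' b' c d \<otimes> ((b \<otimes> d) \<otimes> (b \<otimes> d))"
proof -
  have L: "a \<otimes> \<lbrace>b', x\<rbrace> \<oplus> \<lbrace>a, x\<rbrace> \<otimes> b' = a' \<otimes> \<lbrace>b, x\<rbrace> \<oplus> \<lbrace>a', x\<rbrace> \<otimes> b"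
    if "x \<in> carrier A" for x
    using that c e bracket_leibniz_left[of a b' x] bracket_leibniz_left[of a' b x] by simp
  define ac ad bc bd ac' ad' bc' bd' where "ac = \<lbrace>a,c\<rbrace>" "ad = \<lbrace>a,d\<rbrace>" "bc = \<lbrace>b,c\<rbrace>" "bd = \<lbrace>b,d\<rbrace>"
     "ac' = \<lbrace>a',c\<rbrace>" "ad' = \<lbrace>a',d\<rbrace>" "bc' = \<lbrace>b',c\<rbrace>" "bd' = \<lbrace>b',d\<rbrace>"
  note D = this
  have cl: "ac \<in> carrier A" "ad \<in> carrier A" "bc \<in> carrier A" "bd \<in> carrier A"
    "ac' \<in> carrier A" "ad' \<in> carrier A" "bc' \<in> carrier A" "bd' \<in> carrier A"
    using c bracket_closed by (auto simp: D)
  have key: "(b \<otimes> x \<ominus> a \<otimes> y) \<otimes> (b' \<otimes> b') = (b' \<otimes> x' \<ominus> a' \<otimes> y') \<otimes> (b \<otimes> b)"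
    if k: "x \<in> carrier A" "y \<in> carrier A" "x' \<in> carrier A" "y' \<in> carrier A"
      and l: "a \<otimes> y' \<oplus> x \<otimes> b' = a' \<otimes> y \<oplus> x' \<otimes> b" for x y x' y'
  proof -
    have "(b \<otimes> x \<ominus> a \<otimes> y) \<otimes> (b' \<otimes> b') =
      ((b \<otimes> b') \<otimes> ((a \<otimes> y' \<oplus> x \<otimes> b') \<ominus> a \<otimes> y')) \<ominus> ((a \<otimes> b') \<otimes> (y \<otimes> b'))"
      using k c by algebra
    also have "\<dots> = (b \<otimes> b') \<otimes> (x' \<otimes> b) \<ominus> a \<otimes> (b \<otimes> (b' \<otimes> y'))"
      unfolding l e using k c by algebra
    also have "\<dots> = (b \<otimes> b') \<otimes> (x' \<otimes> b) \<ominus> b \<otimes> ((a \<otimes> b') \<otimes> y')"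
      using k c by algebra
    also have "\<dots> = (b' \<otimes> x' \<ominus> a' \<otimes> y') \<otimes> (b \<otimes> b)"
      unfolding e using k c by algebra
    finally show ?thesis .
  qed
  have k1: "(b \<otimes> ac \<ominus> a \<otimes> bc) \<otimes> (b' \<otimes> b') = (b' \<otimes> ac' \<ominus> a' \<otimes> bc') \<otimes> (b \<otimes> b)"
    using L c cl by (intro key) (auto simp: D)
  have k2: "(b \<otimes> ad \<ominus> a \<otimes> bd) \<otimes> (b' \<otimes> b') = (b' \<otimes> ad' \<ominus> a' \<otimes> bd') \<otimes> (b \<otimes> b)"
    using L c cl by (intro key) (auto simp: D)
  have "frac_bracket_num A a b c d \<otimes> ((b' \<otimes> d) \<otimes> (b' \<otimes> d)) =
     (d \<otimes> ((b \<otimes> ac \<ominus> a \<otimes> bc) \<otimes> (b' \<otimes> b')) \<ominus> c \<otimes> ((b \<otimes> ad \<ominus> a \<otimes> bd) \<otimes> (b' \<otimes> b'))) \<otimes> (d \<otimes> d)"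
    unfolding frac_bracket_num_def D[symmetric] using c cl by algebra
  also have "\<dots> = frac_bracket_num A a' b' c d \<otimes> ((b \<otimes> d) \<otimes> (b \<otimes> d))"
    unfolding k1 k2 unfolding frac_bracket_num_def D[symmetric] using c cl by algebra
  finally show ?thesis .
qed

lemma frac_bracket_num_swap:
  assumes "a \<in> carrier A" "b \<in> carrier A" "c \<in> carrier A" "d \<in> carrier A"
  shows "frac_bracket_num A a b c d = \<ominus> frac_bracket_num A c d a b"
proof -
  define ac ad bc bd where "ac = \<lbrace>a,c\<rbrace>" "ad = \<lbrace>a,d\<rbrace>" "bc = \<lbrace>b,c\<rbrace>" "bd = \<lbrace>b,d\<rbrace>"
  note D = this
  have cl: "ac \<in> carrier A" "ad \<in> carrier A" "bc \<in> carrier A" "bd \<in> carrier A"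
    using assms bracket_closed by (auto simp: D)
  have "\<lbrace>c,a\<rbrace> = \<ominus> ac" "\<lbrace>d,a\<rbrace> = \<ominus> ad" "\<lbrace>c,b\<rbrace> = \<ominus> bc" "\<lbrace>d,b\<rbrace> = \<ominus> bd"
    unfolding D using assms bracket_antisym by blast+
  then show ?thesis
    unfolding frac_bracket_num_def D[symmetric] using assms cl by (simp only:) algebra
qed
end

lemma poisson_frac_bracket:
  assumes P: "poisson_algebra K D" and dom: "domain D"
    and c: "a \<in> carrier D" "b \<in> carrier D - {\<zero>\<^bsub>D\<^esub>}" "c \<in> carrier D" "d \<in> carrier D - {\<zero>\<^bsub>D\<^esub>}"
  shows "\<lbrace>fraction D a b, fraction D c d\<rbrace>\<^bsub>poisson_frac D\<^esub> =
    fraction D (frac_bracket_num D a b c d) ((b \<otimes>\<^bsub>D\<^esub> d) \<otimes>\<^bsub>D\<^esub> (b \<otimes>\<^bsub>D\<^esub> d))"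
proof -
  interpret poisson_algebra K D by fact
  interpret D: domain D by fact
  let ?q = "\<lambda>a b c d. fraction D (frac_bracket_num D a b c d) ((b \<otimes>\<^bsub>D\<^esub> d) \<otimes>\<^bsub>D\<^esub> (b \<otimes>\<^bsub>D\<^esub> d))"
  have nc: "frac_bracket_num D p q r s \<in> carrier D"
    if "p \<in> carrier D" "q \<in> carrier D" "r \<in> carrier D" "s \<in> carrier D" for p q r s
    unfolding frac_bracket_num_def using that bracket_closed by simp
  have left: "?q p q r s = ?q p' q' r s"
    if "p \<in> carrier D" "q \<in> carrier D - {\<zero>\<^bsub>D\<^esub>}" "p' \<in> carrier D" "q' \<in> carrier D - {\<zero>\<^bsub>D\<^esub>}"
       "r \<in> carrier D" "s \<in> carrier D - {\<zero>\<^bsub>D\<^esub>}" "p \<otimes>\<^bsub>D\<^esub> q' = p' \<otimes>\<^bsub>D\<^esub> q" for p q p' q' r s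
    using that nc frac_bracket_num_left[of p q p' q' r s]
    by (subst frac_eq_iff[OF dom]) (auto simp: D.integral_iff)
  have swap: "?q p q r s = ?q p q r' s'"
    if h: "p \<in> carrier D" "q \<in> carrier D - {\<zero>\<^bsub>D\<^esub>}" "r' \<in> carrier D" "s' \<in> carrier D - {\<zero>\<^bsub>D\<^esub>}"
       "r \<in> carrier D" "s \<in> carrier D - {\<zero>\<^bsub>D\<^esub>}" "r \<otimes>\<^bsub>D\<^esub> s' = r' \<otimes>\<^bsub>D\<^esub> s" for p q r s r' s'
  proof (subst frac_eq_iff[OF dom], goal_cases)
    case 5
    have "\<ominus>\<^bsub>D\<^esub> (frac_bracket_num D r s p q \<otimes>\<^bsub>D\<^esub> ((s' \<otimes>\<^bsub>D\<^esub> q) \<otimes>\<^bsub>D\<^esub> (s' \<otimes>\<^bsub>D\<^esub> q))) =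
       \<ominus>\<^bsub>D\<^esub> (frac_bracket_num D r' s' p q \<otimes>\<^bsub>D\<^esub> ((s \<otimes>\<^bsub>D\<^esub> q) \<otimes>\<^bsub>D\<^esub> (s \<otimes>\<^bsub>D\<^esub> q)))"
      using h frac_bracket_num_left[of r s r' s' p q] by simp
    then show ?case
      using h nc frac_bracket_num_swap[of p q r s] frac_bracket_num_swap[of p q r' s']
      by (simp add: A.l_minus A.m_comm)
  qed (use h nc in \<open>auto simp: D.integral_iff\<close>)
  have "fraction D a b = {(p, q). p \<in> carrier D \<and> q \<in> carrier D - {\<zero>\<^bsub>D\<^esub>} \<and> a \<otimes>\<^bsub>D\<^esub> q = p \<otimes>\<^bsub>D\<^esub> b}"
     "fraction D c d = {(p, q). p \<in> carrier D \<and> q \<in> carrier D - {\<zero>\<^bsub>D\<^esub>} \<and> c \<otimes>\<^bsub>D\<^esub> q = p \<otimes>\<^bsub>D\<^esub> d}"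
    using c by (auto simp: fraction_def frac_rel_def)
  note f = this
  have "?q p q r s = ?q a b c d" if "(p, q) \<in> fraction D a b" "(r, s) \<in> fraction D c d" for p q r s
  proof -
    have "?q a b c d = ?q p q c d" using that c by (intro left) (auto simp: f)
    also have "\<dots> = ?q p q r s" using that c by (intro swap) (auto simp: f)
    finally show ?thesis by simp
  qed
  moreover have "(a, b) \<in> fraction D a b" "(c, d) \<in> fraction D c d"
    using c by (auto simp: f)
  ultimately have "(\<Union>(p, q) \<in> fraction D a b. \<Union>(r, s) \<in> fraction D c d. ?q p q r s) = ?q a b c d"
    by blast
  then show ?thesis
    by (simp add: poisson_frac_def)
qed

lemma poisson_frac_bracket_extends:
  assumes "poisson_algebra K D" "domain D" "a \<in> carrier D" "c \<in> carrier D"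
  shows "\<lbrace>fraction D a \<one>\<^bsub>D\<^esub>, fraction D c \<one>\<^bsub>D\<^esub>\<rbrace>\<^bsub>poisson_frac D\<^esub> = fraction D \<lbrace>a, c\<rbrace>\<^bsub>D\<^esub> \<one>\<^bsub>D\<^esub>"
proof -
  interpret poisson_algebra K D by fact
  interpret D: domain D by fact
  have 1: "\<lbrace>x, \<one>\<^bsub>D\<^esub>\<rbrace>\<^bsub>D\<^esub> = \<zero>\<^bsub>D\<^esub>" if "x \<in> carrier D" for x
    using bracket_leibniz_right[of x "\<one>\<^bsub>D\<^esub>" "\<one>\<^bsub>D\<^esub>"] that bracket_closed
    by (metis A.M.add.l_cancel_one' A.l_one A.r_one A.one_closed)
  have 2: "\<lbrace>\<one>\<^bsub>D\<^esub>, x\<rbrace>\<^bsub>D\<^esub> = \<zero>\<^bsub>D\<^esub>" if "x \<in> carrier D" for x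
    using bracket_antisym[of "\<one>\<^bsub>D\<^esub>" x] 1 that by simp
  have "frac_bracket_num D a \<one>\<^bsub>D\<^esub> c \<one>\<^bsub>D\<^esub> = \<lbrace>a, c\<rbrace>\<^bsub>D\<^esub>"
    unfolding frac_bracket_num_def using assms bracket_closed 1 2 by (simp add: a_minus_def)
  then show ?thesis
    using poisson_frac_bracket[OF assms(1,2,3) _ assms(4), of "\<one>\<^bsub>D\<^esub>" "\<one>\<^bsub>D\<^esub>"] by simp
qed

definition poisson_centre :: "('k, 'a, 'n) poisson_scheme \<Rightarrow> 'a set"
  where "poisson_centre A = {z \<in> carrier A. \<forall>a \<in> carrier A. \<lbrace>z, a\<rbrace>\<^bsub>A\<^esub> = \<zero>\<^bsub>A\<^esub>}"


section \<open>The Poisson spectrum\<close>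

definition spec :: "('a, 'n) ring_scheme \<Rightarrow> 'a set set"
  where "spec R = {P. primeideal P R}"

definition zariski :: "('a, 'n) ring_scheme \<Rightarrow> 'a set topology"
  where "zariski R = topology (\<lambda>U. \<exists>S \<subseteq> carrier R. U = spec R - {P \<in> spec R. S \<subseteq> P})"

lemma istopology_zariski:
  "istopology (\<lambda>U. \<exists>S \<subseteq> carrier R. U = spec R - {P \<in> spec R. S \<subseteq> P})"
  unfolding istopology_def
proof (intro conjI allI impI)
  fix U V
  assume "\<exists>S \<subseteq> carrier R. U = spec R - {P \<in> spec R. S \<subseteq> P}"
    and "\<exists>S \<subseteq> carrier R. V = spec R - {P \<in> spec R. S \<subseteq> P}"
  then obtain S T where S: "S \<subseteq> carrier R" "U = spec R - {P \<in> spec R. S \<subseteq> P}"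
    and T: "T \<subseteq> carrier R" "V = spec R - {P \<in> spec R. T \<subseteq> P}"
    by blast
  let ?W = "{s \<otimes>\<^bsub>R\<^esub> t | s t. s \<in> S \<and> t \<in> T} \<inter> carrier R"
  have key: "?W \<subseteq> P \<longleftrightarrow> S \<subseteq> P \<or> T \<subseteq> P" if "P \<in> spec R" for P
  proof -
    interpret primeideal P R using that by (simp add: spec_def)
    have "s \<in> P" if "?W \<subseteq> P" "t \<in> T" "t \<notin> P" "s \<in> S" for s t
    proof -
      have "s \<otimes>\<^bsub>R\<^esub> t \<in> P" using that S(1) T(1) by blast
      then show ?thesis using I_prime[of s t] that S(1) T(1) by blast
    qed
    moreover have "?W \<subseteq> P" if "S \<subseteq> P \<or> T \<subseteq> P"
      using that S(1) T(1) I_l_closed I_r_closed by blast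
    ultimately show ?thesis by blast
  qed
  have "U \<inter> V = spec R - {P \<in> spec R. ?W \<subseteq> P}"
    unfolding S(2) T(2) using key by blast
  moreover have "?W \<subseteq> carrier R"
    by blast
  ultimately show "\<exists>S \<subseteq> carrier R. U \<inter> V = spec R - {P \<in> spec R. S \<subseteq> P}"
    by blast
next
  fix \<K>
  assume "\<forall>U\<in>\<K>. \<exists>S \<subseteq> carrier R. U = spec R - {P \<in> spec R. S \<subseteq> P}"
  then obtain S where S: "\<And>U. U \<in> \<K> \<Longrightarrow> S U \<subseteq> carrier R"
      "\<And>U. U \<in> \<K> \<Longrightarrow> U = spec R - {P \<in> spec R. S U \<subseteq> P}"
    by metis
  have "\<Union>\<K> = spec R - {P \<in> spec R. (\<Union>U\<in>\<K>. S U) \<subseteq> P}"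
    using S(2) by blast
  moreover have "(\<Union>U\<in>\<K>. S U) \<subseteq> carrier R"
    using S(1) by blast
  ultimately show "\<exists>S \<subseteq> carrier R. \<Union>\<K> = spec R - {P \<in> spec R. S \<subseteq> P}"
    by blast
qed

definition poisson_spec :: "('k, 'a, 'n) poisson_scheme \<Rightarrow> 'a set set"
  where "poisson_spec B = {I. primeideal I B \<and> poisson_ideal I B}"

definition poisson_spec_topology :: "('k, 'a, 'n) poisson_scheme \<Rightarrow> 'a set topology"
  where "poisson_spec_topology B = subtopology (zariski B) (poisson_spec B)"

definition locally_closed_in :: "'a topology \<Rightarrow> 'a set \<Rightarrow> bool"
  where "locally_closed_in T S \<longleftrightarrow> (\<exists>U C. openin T U \<and> closedin T C \<and> S = U \<inter> C)"

definition poisson_locally_closed :: "('k, 'a, 'n) poisson_scheme \<Rightarrow> 'a set \<Rightarrow> bool"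
  where "poisson_locally_closed B I \<longleftrightarrow> locally_closed_in (poisson_spec_topology B) {I}"

definition poisson_primitive :: "('k, 'a, 'n) poisson_scheme \<Rightarrow> 'a set \<Rightarrow> bool"
  where "poisson_primitive B I \<longleftrightarrow> (\<exists>M. maximalideal M B \<and>
    poisson_ideal I B \<and> I \<subseteq> M \<and> (\<forall>J. poisson_ideal J B \<and> J \<subseteq> M \<longrightarrow> J \<subseteq> I))"

definition poisson_rational ::
    "('k, 'm) ring_scheme \<Rightarrow> ('k, 'a, 'n) poisson_scheme \<Rightarrow> 'a set \<Rightarrow> bool"
  where "poisson_rational K B I \<longleftrightarrow>
    (let Q = poisson_frac (poisson_quot B I) in
      \<forall>z \<in> poisson_centre Q. (ring.algebraic Q over (\<lambda>r. r \<odot>\<^bsub>Q\<^esub> \<one>\<^bsub>Q\<^esub>) ` carrier K) z)"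

end

theory Submission
  imports Defs
begin

text \<open>
  Let \<open>B\<close> be the semi-centre. Abelian weights make the bracket \<open>u = {x, y}\<close> of two Poisson normal
  elements of \<open>A\<close> satisfy \<open>{b, u} x y = u {b, x y}\<close>, so \<open>B\<close> is generated by finitely many elements
  \<open>x\<^sub>i\<close> for which the fractions \<open>{x\<^sub>i, x\<^sub>j} / (x\<^sub>i x\<^sub>j)\<close> are Poisson central.

  Locally closed implies primitive: if every Poisson prime strictly above \<open>I\<close> contains \<open>f\<close>, take a
  maximal ideal \<open>M\<close> above \<open>I\<close> avoiding \<open>f\<close>. A Poisson ideal inside \<open>M\<close> but not inside \<open>I\<close> would, in
  characteristic zero, lie in a Poisson prime above \<open>I\<close> avoiding \<open>f\<close>.

  Primitive implies rational: the denominators of a central fraction \<open>z\<close> modulo \<open>I\<close> form a Poisson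
  ideal, so \<open>z\<close> has a value in the residue field of \<open>M\<close>, which is algebraic over \<open>K\<close>. If \<open>p\<close>
  annihilates this value, the denominators of \<open>1 / p z\<close> form a Poisson ideal inside \<open>M\<close>
  unless \<open>p z = 0\<close>.

  Rational implies locally closed: let \<open>L\<close> be a Poisson prime strictly above \<open>I\<close> containing none of
  the \<open>x\<^sub>i\<close> outside \<open>I\<close>, and write an element \<open>f\<close> of \<open>L\<close> outside \<open>I\<close> as a shortest sum of terms
  \<open>z u\<close>, with \<open>u\<close> a monomial in these \<open>x\<^sub>i\<close> and \<open>z\<close> a Poisson central fraction. If \<open>z u\<close> is
  one of the terms, \<open>u {f, x\<^sub>i} - f {u, x\<^sub>i}\<close> is a shorter sum in \<open>L\<close>, hence lies in \<open>I\<close>. So \<open>f / u\<close> is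
  central, hence algebraic over \<open>K\<close>, and some power of \<open>u\<close> lies in \<open>I + f B\<close>, hence in \<open>L\<close>,
  a contradiction. The product of the \<open>x\<^sub>i\<close> outside \<open>I\<close> therefore lies in every such \<open>L\<close>.
\<close>

section \<open>A descent proof of Zariski's lemma\<close>

lemma (in cring) mult_interchange:
  "\<lbrakk>a \<in> carrier R; b \<in> carrier R; c \<in> carrier R; d \<in> carrier R\<rbrakk> \<Longrightarrow>
    (a \<otimes> b) \<otimes> (c \<otimes> d) = (a \<otimes> c) \<otimes> (b \<otimes> d)"
  by algebra

lemma (in cring) add_fractions:
  "\<lbrakk>a \<in> carrier R; b \<in> carrier R; c \<in> carrier R; d \<in> carrier R; i \<in> carrier R; j \<in> carrier R\<rbrakk> \<Longrightarrow>
    (a \<otimes> d \<oplus> c \<otimes> b) \<otimes> (i \<otimes> j) = a \<otimes> i \<otimes> (d \<otimes> j) \<oplus> c \<otimes> j \<otimes> (b \<otimes> i)"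
  by algebra

lemma (in cring) distrib_shift:
  "\<lbrakk>r \<in> carrier R; a \<in> carrier R; u \<in> carrier R; x \<in> carrier R; w \<in> carrier R\<rbrakk> \<Longrightarrow>
    r \<otimes> ((a \<otimes> u \<oplus> w) \<otimes> x) = a \<otimes> (r \<otimes> (u \<otimes> x)) \<oplus> r \<otimes> (w \<otimes> x)"
  by algebra

lemma (in cring) distrib_power_step:
  "\<lbrakk>r \<in> carrier R; s \<in> carrier R; k \<in> carrier R; l \<in> carrier R; x \<in> carrier R\<rbrakk> \<Longrightarrow>
    (s \<otimes> r) \<otimes> (k \<otimes> x \<oplus> l) = r \<otimes> ((s \<otimes> k) \<otimes> x) \<oplus> (s \<otimes> r) \<otimes> l"
  by algebra

lemma (in cring) distrib_last_coefficient:
  "\<lbrakk>r \<in> carrier R; e \<in> carrier R; x \<in> carrier R; z \<in> carrier R; w \<in> carrier R\<rbrakk> \<Longrightarrow>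
    r \<otimes> e \<otimes> x \<oplus> (r \<otimes> z \<ominus> w) = r \<otimes> (e \<otimes> x \<oplus> z) \<ominus> w"
  by algebra

lemma (in cring) distrib_common_denominator:
  "\<lbrakk>b \<in> carrier R; e \<in> carrier R; k \<in> carrier R; x \<in> carrier R; a \<in> carrier R; i \<in> carrier R\<rbrakk> \<Longrightarrow>
    (b \<otimes> e) \<otimes> (k \<otimes> x \<oplus> a \<otimes> i) = b \<otimes> (e \<otimes> k) \<otimes> x \<oplus> (b \<otimes> i) \<otimes> (e \<otimes> a)"
  by algebra

lemma (in field) fractions_subfield:
  assumes "subring S R"
  shows "subfield {a \<otimes> inv b | a b. a \<in> S \<and> b \<in> S - {\<zero>}} R" (is "subfield ?L R")
proof -
  note S = subringE[OF assms]
  have car: "a \<in> carrier R" if "a \<in> S" for a using S(1) that by blast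
  have I: "inv b \<in> carrier R" "b \<otimes> inv b = \<one>" if "b \<in> S - {\<zero>}" for b
    using that car field_Units by auto
  show ?thesis
  proof (rule subfieldI'[OF subringI])
    show "?L \<subseteq> carrier R" using I car by auto
    show "\<one> \<in> ?L" using S(3) I[of \<one>] by force
    fix h assume "h \<in> ?L"
    then obtain a b where ab: "h = a \<otimes> inv b" "a \<in> S" "b \<in> S - {\<zero>}" by auto
    have "\<ominus> h = (\<ominus> a) \<otimes> inv b" using ab I car by (simp add: l_minus)
    then show "\<ominus> h \<in> ?L" using ab S(5) by blast
  next
    fix h1 h2 assume "h1 \<in> ?L" "h2 \<in> ?L"
    then obtain a b c d where h: "h1 = a \<otimes> inv b" "a \<in> S" "b \<in> S - {\<zero>}"
       "h2 = c \<otimes> inv d" "c \<in> S" "d \<in> S - {\<zero>}" by auto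
    have bd: "b \<otimes> d \<in> S - {\<zero>}" using h S(6) car integral[of b d] by blast
    have inv: "inv (b \<otimes> d) = inv b \<otimes> inv d"
    proof (rule comm_inv_char)
      have "b \<otimes> d \<otimes> (inv b \<otimes> inv d) = (b \<otimes> inv b) \<otimes> (d \<otimes> inv d)"
        using h I(1) car by (intro mult_interchange) auto
      then show "b \<otimes> d \<otimes> (inv b \<otimes> inv d) = \<one>" using h I by simp
    qed (use h I car in auto)
    have "h1 \<otimes> h2 = (a \<otimes> c) \<otimes> inv (b \<otimes> d)"
      unfolding inv h using h I car by (simp add: m_ac)
    then show "h1 \<otimes> h2 \<in> ?L" using bd S(6) h by blast
    have "(a \<otimes> d \<oplus> c \<otimes> b) \<otimes> inv (b \<otimes> d) = a \<otimes> inv b \<otimes> (d \<otimes> inv d) \<oplus> c \<otimes> inv d \<otimes> (b \<otimes> inv b)"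
      unfolding inv using h I(1) car by (intro add_fractions) auto
    also have "\<dots> = h1 \<oplus> h2" using h I car by simp
    finally have "h1 \<oplus> h2 = (a \<otimes> d \<oplus> c \<otimes> b) \<otimes> inv (b \<otimes> d)" by simp
    moreover have "a \<otimes> d \<oplus> c \<otimes> b \<in> S" using S(6,7) h by auto
    ultimately show "h1 \<oplus> h2 \<in> ?L" using bd by blast
  next
    fix k assume "k \<in> ?L - {\<zero>}"
    then obtain a b where ab: "k = a \<otimes> inv b" "a \<in> S" "b \<in> S - {\<zero>}" and "k \<noteq> \<zero>" by auto
    then have "a \<noteq> \<zero>" using I(1)[of b] by auto
    note ab = ab this
    have "inv k = b \<otimes> inv a"
    proof (rule comm_inv_char)
      have "k \<otimes> (b \<otimes> inv a) = (b \<otimes> inv b) \<otimes> (a \<otimes> inv a)"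
        unfolding ab(1) using ab car I(1) by (subst m_comm[of a]) (auto simp: m_ac)
      then show "k \<otimes> (b \<otimes> inv a) = \<one>" using ab I by simp
    qed (use ab car I in auto)
    then show "inv k \<in> ?L" using ab by blast
  qed
qed

text \<open>The element \<open>c\<close> witnesses that \<open>S\<close> is a Goldman domain: inverting \<open>c\<close> turns \<open>S\<close> into a field.\<close>

definition (in ring) divides_power :: "'a set \<Rightarrow> 'a \<Rightarrow> bool" where
  "divides_power S c \<longleftrightarrow> c \<in> S - {\<zero>} \<and> (\<forall>r \<in> S - {\<zero>}. \<exists>n::nat. \<exists>s \<in> S. r \<otimes> s = c [^] n)"

lemma (in cring) one_minus_unit:
  assumes T: "subring T R" and y: "y \<in> T" and s: "s \<in> T" "(\<one> \<ominus> y) \<otimes> s = y [^] (n::nat)"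
  shows "\<exists>t \<in> T. (\<one> \<ominus> y) \<otimes> t = \<one>"
  using s
proof (induction n arbitrary: s)
  case 0 then show ?case by auto
next
  case (Suc n)
  note S = subringE[OF T]
  have p: "y [^] n \<in> T" by (induction n) (use S y in auto)
  have c: "y \<in> carrier R" "s \<in> carrier R" "y [^] n \<in> carrier R" using S(1) y Suc p by auto
  have "(\<one> \<ominus> y) \<otimes> (s \<oplus> y [^] n) = (\<one> \<ominus> y) \<otimes> s \<oplus> (y [^] n \<ominus> y \<otimes> y [^] n)"
    using c by algebra
  also have "\<dots> = y [^] n"
    using c unfolding Suc(3) nat_pow_Suc m_comm[OF c(3,1)] by algebra
  finally show ?case using Suc.IH[of "s \<oplus> y [^] n"] S(7) p Suc by blast
qed

lemma (in domain) divides_power_imp_algebraic: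
  assumes S: "subring S R" and x: "x \<in> carrier R"
    and dp: "divides_power (simple_extension S x) c"
  shows "(algebraic over S) x"
proof (rule ccontr)
  assume "\<not> (algebraic over S) x"
  then have tr: "(transcendental over S) x" unfolding over_def by simp
  let ?T = "simple_extension S x"
  have T: "subring ?T R" using simple_extension_is_subring[OF S x] .
  note TE = subringE[OF T]
  interpret UP: domain "S[X]" using univ_poly_is_domain[OF S] .
  interpret ev: ring_hom_ring "S[X]" R "\<lambda>p. eval p x" using eval_ring_hom[OF S x] .
  have img: "?T = (\<lambda>p. eval p x) ` carrier (S[X])"
    using simple_extension_as_eval_img[OF subringE(1)[OF S] x] .
  have xT: "x \<in> ?T" using simple_extension_mem[OF S x] .
  have c: "c \<in> ?T" "c \<noteq> \<zero>" using dp by (auto simp: divides_power_def)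
  obtain g where g: "g \<in> carrier (S[X])" "c = eval g x" using c img by auto
  have gn: "g \<noteq> []" using g c by auto
  have X: "X \<in> carrier (S[X])" "eval X x = x" using var_closed[OF S] eval_var x by auto
  let ?y = "x \<otimes> c"
  let ?h = "\<one>\<^bsub>S[X]\<^esub> \<ominus>\<^bsub>S[X]\<^esub> X \<otimes>\<^bsub>S[X]\<^esub> g"
  have h: "?h \<in> carrier (S[X])" using X g by simp
  have yT: "?y \<in> ?T" using xT c TE(6) by blast
  have hy: "eval ?h x = \<one> \<ominus> ?y" using X g x by (simp add: a_minus_def)
  have deg: "degree (X \<otimes>\<^bsub>S[X]\<^esub> g) = Suc (degree g)"
    using poly_mult_degree_eq[OF S, of X g] X g gn unfolding univ_poly_carrier[symmetric] univ_poly_mult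
    by (simp add: var_def)
  have hn: "?h \<noteq> \<zero>\<^bsub>S[X]\<^esub>"
  proof
    assume "?h = \<zero>\<^bsub>S[X]\<^esub>"
    then have "X \<otimes>\<^bsub>S[X]\<^esub> g = \<one>\<^bsub>S[X]\<^esub>" using X g by (metis UP.m_closed UP.one_closed UP.r_right_minus_eq)
    then show False using deg by (simp add: univ_poly_one)
  qed
  have "\<one> \<ominus> ?y \<noteq> \<zero>" using hn h hy tr eval_transcendental by (metis univ_poly_zero)
  moreover have "\<one> \<ominus> ?y \<in> ?T" using h hy img by (metis image_eqI)
  ultimately obtain n s where s: "s \<in> ?T" "(\<one> \<ominus> ?y) \<otimes> s = c [^] (n::nat)"
    using dp unfolding divides_power_def by blast
  have xn: "x [^] n \<in> ?T" by (induction n) (use TE xT in auto)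
  have car: "s \<in> carrier R" "x [^] n \<in> carrier R" "c \<in> carrier R" "\<one> \<ominus> ?y \<in> carrier R"
    using s xn TE(1) c x by auto
  have "(\<one> \<ominus> ?y) \<otimes> (s \<otimes> x [^] n) = ?y [^] n"
    using car x s(2) by (metis m_assoc m_comm nat_pow_distrib)
  then obtain t where t: "t \<in> ?T" "(\<one> \<ominus> ?y) \<otimes> t = \<one>"
    using one_minus_unit[OF T yT _ , of "s \<otimes> x [^] n" n] s xn TE(6) by blast
  obtain q where q: "q \<in> carrier (S[X])" "t = eval q x" using t img by auto
  have qn: "q \<noteq> []" using q t car by auto
  have "eval (?h \<otimes>\<^bsub>S[X]\<^esub> q) x = eval \<one>\<^bsub>S[X]\<^esub> x" using h q hy t by (metis ev.hom_mult ev.hom_one)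
  then have one: "?h \<otimes>\<^bsub>S[X]\<^esub> q = \<one>\<^bsub>S[X]\<^esub>"
    using tr h q unfolding over_def transcendental_def inj_on_def by (meson UP.m_closed UP.one_closed)
  then have "degree ?h + degree q = 0"
    using poly_mult_degree_eq[OF S, of ?h q] h q
    unfolding univ_poly_carrier[symmetric] univ_poly_mult
    using hn q t qn by (auto simp: univ_poly_one univ_poly_mult univ_poly_zero)
  then have dh: "degree ?h = 0" by simp
  have "X \<otimes>\<^bsub>S[X]\<^esub> g = \<one>\<^bsub>S[X]\<^esub> \<ominus>\<^bsub>S[X]\<^esub> ?h" 
    using X g UP.m_closed[OF X(1) g(1)] UP.one_closed by algebra
  also have "degree \<dots> \<le> max (degree \<one>\<^bsub>S[X]\<^esub>) (degree ?h)"
    using poly_add_degree[of "\<one>\<^bsub>S[X]\<^esub>" "\<ominus>\<^bsub>S[X]\<^esub> ?h"] univ_poly_a_inv_degree[OF S h]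
    by (simp add: a_minus_def univ_poly_add)
  finally show False using dh deg by (simp add: univ_poly_one)
qed

lemma set_map2_closed:
  assumes "\<And>a b. a \<in> S \<Longrightarrow> b \<in> S \<Longrightarrow> f a b \<in> S" "set p \<subseteq> S" "set q \<subseteq> S"
  shows "set (map2 f p q) \<subseteq> S"
  using assms(2,3) by (induction p q rule: list_induct2') (auto intro: assms(1))

lemma (in ring) eval_zip_add:
  assumes "set p \<subseteq> carrier R" "set q \<subseteq> carrier R" "length p = length q" "a \<in> carrier R"
  shows "eval (map2 (\<oplus>) p q) a = eval p a \<oplus> eval q a"
proof -
  have "set (map2 (\<oplus>) p q) \<subseteq> carrier R"
    using assms by (intro set_map2_closed) auto
  then show ?thesis
    using eval_poly_add_aux[OF assms] assms by (auto simp: eval_normalize)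
qed

lemma (in cring) eval_map_mult:
  assumes "set p \<subseteq> carrier R" "r \<in> carrier R" "a \<in> carrier R"
  shows "eval (map ((\<otimes>) r) p) a = r \<otimes> eval p a"
  using assms
proof (induction p)
  case (Cons b p)
  then have "eval p a \<in> carrier R" using eval_in_carrier by simp
  then show ?case using Cons by (simp add: r_distr m_assoc)
qed simp

lemma (in field) simple_extension_common_denominator:
  assumes S: "subring S R" and x: "x \<in> carrier R"
    and y: "y \<in> simple_extension {a \<otimes> inv b | a b. a \<in> S \<and> b \<in> S - {\<zero>}} x"
  shows "\<exists>e \<in> S - {\<zero>}. e \<otimes> y \<in> simple_extension S x"
  using y
proof (induction rule: simple_extension.induct)
  case zero
  have "\<one> \<otimes> \<zero> \<in> simple_extension S x" by simp
  then show ?case using subringE(3)[OF S] by (metis DiffI one_not_zero singletonD)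
next
  case (lin k1 k2)
  note SE = subringE[OF S]
  obtain e where e: "e \<in> S - {\<zero>}" "e \<otimes> k1 \<in> simple_extension S x" using lin by blast
  obtain a b where ab: "k2 = a \<otimes> inv b" "a \<in> S" "b \<in> S - {\<zero>}" using lin by blast
  have car: "e \<in> carrier R" "a \<in> carrier R" "b \<in> carrier R" using e ab SE(1) by auto
  have ib: "inv b \<in> carrier R" "b \<otimes> inv b = \<one>" using ab car field_Units by auto
  have L: "subring {a \<otimes> inv b | a b. a \<in> S \<and> b \<in> S - {\<zero>}} R"
    using fractions_subfield[OF S] subfieldE(1) by blast
  have k1: "k1 \<in> carrier R"
    using lin(1) simple_extension_in_carrier[OF subringE(1)[OF L] x] by blast
  have T: "subring (simple_extension S x) R" using simple_extension_is_subring[OF S x] .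
  have incl: "S \<subseteq> simple_extension S x" using simple_extension_incl[OF SE(1) x] .
  have be: "b \<otimes> (e \<otimes> k1) \<in> simple_extension S x" using ab e incl subringE(6)[OF T] by blast
  have "(b \<otimes> e) \<otimes> (k1 \<otimes> x \<oplus> k2) = b \<otimes> (e \<otimes> k1) \<otimes> x \<oplus> (b \<otimes> inv b) \<otimes> (e \<otimes> a)"
    unfolding ab(1) by (rule distrib_common_denominator) (use k1 x car ib(1) in auto)
  also have "\<dots> = b \<otimes> (e \<otimes> k1) \<otimes> x \<oplus> e \<otimes> a" using ib car by simp
  also have "\<dots> \<in> simple_extension S x"
    using simple_extension.lin[OF be] SE(6) e ab by blast
  finally have "(b \<otimes> e) \<otimes> (k1 \<otimes> x \<oplus> k2) \<in> simple_extension S x" .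
  moreover have "b \<otimes> e \<in> S - {\<zero>}"
    using e ab SE(6) car integral[of b e] by blast
  ultimately show ?case by blast
qed

lemma (in field) divides_power_descend:
  assumes S: "subring S R" and x: "x \<in> carrier R"
    and dp: "divides_power (simple_extension S x) c"
  shows "\<exists>c'. divides_power S c'"
proof -
  note SE = subringE[OF S]
  let ?T = "simple_extension S x"
  have T: "subring ?T R" using simple_extension_is_subring[OF S x] .
  note TE = subringE[OF T]
  have ST: "S \<subseteq> ?T" using simple_extension_incl[OF SE(1) x] .
  have alg: "(algebraic over S) x" using divides_power_imp_algebraic[OF S x dp] .
  let ?L = "{a \<otimes> inv b | a b. a \<in> S \<and> b \<in> S - {\<zero>}}"
  have L: "subfield ?L R" using fractions_subfield[OF S] .
  have SL: "S \<subseteq> ?L"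
  proof
    fix s assume "s \<in> S"
    then have "s = s \<otimes> inv \<one>" "\<one> \<in> S - {\<zero>}" using SE(1,3) by auto
    then show "s \<in> ?L" using \<open>s \<in> S\<close> by blast
  qed
  have Lx: "subfield (simple_extension ?L x) R"
    using simple_extension_is_subfield[OF L x] algebraic_mono[OF SL alg] by blast
  have c: "c \<in> ?T" "c \<noteq> \<zero>" using dp by (auto simp: divides_power_def)
  have cc: "c \<in> carrier R" using c TE(1) by blast
  have "c \<in> simple_extension ?L x" using c mono_simple_extension[OF SL] by blast
  then have ic: "inv c \<in> simple_extension ?L x" using subfield_m_inv(1)[OF Lx] c by blast
  obtain e where e: "e \<in> S - {\<zero>}" "e \<otimes> inv c \<in> ?T"
    using simple_extension_common_denominator[OF S x ic] by blast
  have icc: "inv c \<in> carrier R" "c \<otimes> inv c = \<one>" using c cc field_Units by auto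
  have ec: "e \<in> carrier R" using e SE(1) by blast
  define t where "t = e \<otimes> inv c"
  have t: "t \<in> ?T" "t \<in> carrier R" "e = c \<otimes> t"
    using e icc ec cc TE(1) by (auto simp: t_def) (metis m_assoc m_comm r_one)
  define P where "P p \<longleftrightarrow> p \<in> carrier (S[X]) \<and> p \<noteq> [] \<and> eval p x = \<zero>" for p
  obtain p0 where "P p0" using algebraicE[OF S x alg] unfolding P_def by blast
  then obtain p where p: "P p" and pmin: "\<And>q. P q \<Longrightarrow> length p \<le> length q"
    using arg_min_nat_lemma[of P p0 length] by blast
  obtain r0 p' where pe: "p = r0 # p'" using p unfolding P_def by (cases p) auto
  have r0: "r0 \<in> S - {\<zero>}" and p'S: "set p' \<subseteq> S"
    using p unfolding P_def pe univ_poly_carrier[symmetric] polynomial_def by auto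
  have r0c: "r0 \<in> carrier R" and p'c: "set p' \<subseteq> carrier R" using r0 p'S SE(1) by auto
  define d where "d = length p'"
  have rel: "r0 \<otimes> x [^] d = \<ominus> eval p' x"
  proof -
    have "r0 \<otimes> x [^] d \<oplus> eval p' x = \<zero>" using p unfolding P_def pe d_def by simp
    then show ?thesis using r0c x eval_in_carrier[OF p'c x] by (metis add.inv_equality add.inv_closed m_closed minus_equality nat_pow_closed)
  qed
  have dpos: "d > 0"
  proof (rule ccontr)
    assume "\<not> 0 < d"
    then have "r0 = \<zero>" using rel r0c by (simp add: d_def)
    then show False using r0 by simp
  qed
  have indep: "set q \<subseteq> {\<zero>}" if q: "set q \<subseteq> S" "length q = d" "eval q x = \<zero>" for q
  proof (rule ccontr)
    assume nz: "\<not> set q \<subseteq> {\<zero>}"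
    have qc: "set q \<subseteq> carrier R" using q SE(1) by blast
    have "normalize q \<noteq> []" using nz by (induction q) auto
    moreover have "normalize q \<in> carrier (S[X])"
      using normalize_gives_polynomial[OF q(1)] unfolding univ_poly_carrier .
    moreover have "eval (normalize q) x = \<zero>" using eval_normalize[OF qc x] q by simp
    ultimately have "length p \<le> length (normalize q)" using pmin unfolding P_def by blast
    also have "\<dots> \<le> d" using normalize_length_le[of q] q by simp
    finally show False unfolding pe d_def by simp
  qed
  define V where "V = {eval q x | q. set q \<subseteq> S \<and> length q = d}"
  have VI: "eval q x \<in> V" if "set q \<subseteq> S" "length q = d" for q
    using that unfolding V_def by blast
  have Vc: "V \<subseteq> carrier R"
    using eval_in_carrier[OF _ x] SE(1) unfolding V_def by blast
  have Vadd: "u \<oplus> v \<in> V" if uv: "u \<in> V" "v \<in> V" for u v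
  proof -
    obtain q r where qr: "u = eval q x" "v = eval r x" "set q \<subseteq> S" "set r \<subseteq> S" "length q = d" "length r = d"
      using uv unfolding V_def by auto
    have "set (map2 (\<oplus>) q r) \<subseteq> S" using qr SE(7) by (intro set_map2_closed) auto
    moreover have "eval (map2 (\<oplus>) q r) x = u \<oplus> v"
      using eval_zip_add[of q r x] qr x SE(1) by auto
    ultimately show ?thesis using VI[of "map2 (\<oplus>) q r"] qr by simp
  qed
  have Vmult: "r \<otimes> v \<in> V" if rv: "r \<in> S" "v \<in> V" for r v
  proof -
    obtain q where q: "v = eval q x" "set q \<subseteq> S" "length q = d" using rv unfolding V_def by blast
    have "set (map ((\<otimes>) r) q) \<subseteq> S" using q rv SE(6) by auto
    moreover have "eval (map ((\<otimes>) r) q) x = r \<otimes> v"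
      using eval_map_mult[of q r x] q rv x SE(1) by auto
    ultimately show ?thesis using VI[of "map ((\<otimes>) r) q"] q by simp
  qed
  have VS: "s \<in> V" if "s \<in> S" for s
  proof -
    have "eval (replicate (d - 1) \<zero> @ [s]) x = s"
      using eval_replicate[of "[s]" x "d - 1"] that x SE(1) by auto
    moreover have "set (replicate (d - 1) \<zero> @ [s]) \<subseteq> S" using that SE(2) by auto
    ultimately show ?thesis using VI[of "replicate (d - 1) \<zero> @ [s]"] dpos by simp
  qed
  have Vx: "r0 \<otimes> (v \<otimes> x) \<in> V" if v: "v \<in> V" for v
  proof -
    obtain q where q: "v = eval q x" "set q \<subseteq> S" "length q = d" using v unfolding V_def by blast
    obtain a q' where aq: "q = a # q'" using q dpos by (cases q) auto
    have ac: "a \<in> carrier R" "set q' \<subseteq> carrier R" "a \<in> S" "set q' \<subseteq> S" using q aq SE(1) by auto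
    have l: "length q' = d - 1" using q aq by simp
    have xd: "x [^] d = x [^] (d - 1) \<otimes> x" using dpos by (metis Suc_pred' nat_pow_Suc)
    have e1: "eval (q' @ [\<zero>]) x = eval q' x \<otimes> x"
      using eval_append_aux[OF ac(2) zero_closed x] eval_in_carrier[OF ac(2) x] x by simp
    have ee: "eval q' x \<in> carrier R" "eval p' x \<in> carrier R" "x [^] (d-1) \<in> carrier R"
      using eval_in_carrier ac p'c x by auto
    have vx: "v = a \<otimes> x [^] (d - 1) \<oplus> eval q' x" unfolding q(1) aq using l by simp
    have "r0 \<otimes> (v \<otimes> x) = a \<otimes> (r0 \<otimes> x [^] d) \<oplus> r0 \<otimes> (eval q' x \<otimes> x)"
      unfolding vx xd using r0c ac(1) ee(3) x ee(1) by (rule distrib_shift)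
    also have "\<dots> = (\<ominus> a) \<otimes> eval p' x \<oplus> r0 \<otimes> eval (q' @ [\<zero>]) x"
      unfolding rel e1 using ac ee by (simp add: l_minus r_minus)
    also have "\<dots> \<in> V"
    proof (intro Vadd Vmult)
      show "eval p' x \<in> V" unfolding V_def using p'S d_def by blast
      have "set (q' @ [\<zero>]) \<subseteq> S" "length (q' @ [\<zero>]) = d" using ac SE(2) l dpos by auto
      then show "eval (q' @ [\<zero>]) x \<in> V" unfolding V_def by blast
    qed (use SE(5) ac r0 in auto)
    finally show ?thesis .
  qed
  have pow: "r [^] (m::nat) \<in> S" if "r \<in> S" for r m by (induction m) (use that SE in auto)
  have W: "\<exists>m::nat. r0 [^] m \<otimes> s \<in> V" if "s \<in> ?T" for s
    using that
  proof (induction rule: simple_extension.induct)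
    case zero
    have "\<one> \<otimes> \<zero> \<in> V" using VS[OF SE(2)] by simp
    then show ?case by (intro exI[of _ 0]) simp
  next
    case (lin k1 k2)
    then obtain m :: nat where m: "r0 [^] m \<otimes> k1 \<in> V" by blast
    have k: "k1 \<in> carrier R" "k2 \<in> carrier R" using lin(1,2) TE(1) SE(1) by auto
    have "r0 [^] Suc m \<otimes> (k1 \<otimes> x \<oplus> k2) = r0 \<otimes> ((r0 [^] m \<otimes> k1) \<otimes> x) \<oplus> r0 [^] Suc m \<otimes> k2"
      unfolding nat_pow_Suc by (rule distrib_power_step) (use k r0c x in auto)
    also have "\<dots> \<in> V" by (intro Vadd Vx m VS SE(6) pow lin) (use r0 in auto)
    finally show ?case by blast
  qed
  have "divides_power S (r0 \<otimes> e)" unfolding divides_power_def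
  proof (intro conjI ballI)
    show "r0 \<otimes> e \<in> S - {\<zero>}" using r0 e SE(6) integral[of r0 e] r0c ec by blast
    fix r assume r: "r \<in> S - {\<zero>}"
    then have "r \<in> ?T - {\<zero>}" using ST by blast
    then obtain n s where s: "s \<in> ?T" "r \<otimes> s = c [^] (n::nat)"
      using dp unfolding divides_power_def by blast
    have tn: "t [^] n \<in> ?T" by (induction n) (use TE t in auto)
    then have "s \<otimes> t [^] n \<in> ?T" using s TE(6) by blast
    then obtain m :: nat where m: "r0 [^] m \<otimes> (s \<otimes> t [^] n) \<in> V" using W by blast
    then obtain q where q: "r0 [^] m \<otimes> (s \<otimes> t [^] n) = eval q x" "set q \<subseteq> S" "length q = d"
      unfolding V_def by blast
    have cs: "s \<in> carrier R" "t [^] n \<in> carrier R" "r \<in> carrier R" "r0 [^] m \<in> carrier R"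
       "e [^] n \<in> carrier R"
      using s TE(1) t r SE(1) r0c ec by auto
    have e1: "r0 [^] m \<otimes> e [^] n = r \<otimes> eval q x"
    proof -
      have "e [^] n = c [^] n \<otimes> t [^] n" using t(2,3) cc nat_pow_distrib by simp
      then show ?thesis unfolding s(2)[symmetric] q(1)[symmetric] using cs by (simp add: m_ac)
    qed
    obtain q' z where qz: "q = q' @ [z]" using q(3) dpos by (cases q rule: rev_cases) auto
    define w where "w = r0 [^] m \<otimes> e [^] n"
    have w: "w \<in> S" unfolding w_def using SE(6) pow r0 e by auto
    define y where "y = map ((\<otimes>) r) q' @ [r \<otimes> z \<ominus> w]"
    have zc: "z \<in> carrier R" "set q' \<subseteq> carrier R" "w \<in> carrier R" using q qz SE(1) w by auto
    have yS: "set y \<subseteq> S" unfolding y_def a_minus_def using q qz r SE(5,6,7) w by auto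
    have "eval y x = \<zero>"
    proof -
      have rc: "set (map ((\<otimes>) r) q') \<subseteq> carrier R" using zc cs by auto
      have eq: "eval q' x \<in> carrier R" using eval_in_carrier zc x by blast
      have "eval y x = r \<otimes> eval q' x \<otimes> x \<oplus> (r \<otimes> z \<ominus> w)"
        unfolding y_def using eval_append_aux[OF rc _ x, of "r \<otimes> z \<ominus> w"] zc cs
          eval_map_mult[OF zc(2) cs(3) x] by simp
      also have "\<dots> = r \<otimes> (eval q' x \<otimes> x \<oplus> z) \<ominus> w"
        by (rule distrib_last_coefficient) (use eq x zc cs in auto)
      also have "\<dots> = r \<otimes> eval q x \<ominus> w"
        unfolding qz using eval_append_aux[OF zc(2,1) x] by simp
      also have "\<dots> = \<zero>" using e1 zc unfolding w_def[symmetric] by (metis r_right_minus_eq)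
      finally show ?thesis .
    qed
    moreover have "length y = d" using q qz by (simp add: y_def)
    ultimately have "set y \<subseteq> {\<zero>}" using indep yS by blast
    then have "r \<otimes> z = w" unfolding y_def using zc cs by (auto)
    have cm: "r0 [^] n \<otimes> e [^] m \<in> S" using SE(6) pow r0 e by auto
    have "r \<otimes> (z \<otimes> (r0 [^] n \<otimes> e [^] m)) = w \<otimes> (r0 [^] n \<otimes> e [^] m)"
      using \<open>r \<otimes> z = w\<close> zc cs cm SE(1) by (metis m_assoc subsetD)
    also have "\<dots> = (r0 [^] m \<otimes> r0 [^] n) \<otimes> (e [^] n \<otimes> e [^] m)"
      unfolding w_def by (rule mult_interchange) (use cs r0c ec in auto)
    also have "\<dots> = (r0 \<otimes> e) [^] (m + n)"
      using r0c ec by (simp add: nat_pow_mult nat_pow_distrib add.commute)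
    finally have "r \<otimes> (z \<otimes> (r0 [^] n \<otimes> e [^] m)) = (r0 \<otimes> e) [^] (m + n)" .
    moreover have "z \<otimes> (r0 [^] n \<otimes> e [^] m) \<in> S" using SE(6) cm q qz by auto
    ultimately show "\<exists>n::nat. \<exists>s \<in> S. r \<otimes> s = (r0 \<otimes> e) [^] n" by blast
  qed
  then show ?thesis by blast
qed

lemma (in field) divides_power_imp_subfield:
  assumes K: "subfield K R" and xs: "set xs \<subseteq> carrier R"
    and "divides_power (finite_extension K xs) c"
  shows "subfield (finite_extension K xs) R \<and> finite_dimension K (finite_extension K xs)"
  using xs assms(3)
proof (induction xs arbitrary: c)
  case Nil
  then show ?case using K dimension_one[OF K] finite_dimensionI by auto
next
  case (Cons x xs)
  let ?S = "finite_extension K xs"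
  have S: "subring ?S R" using finite_extension_is_subring[OF subfieldE(1)[OF K]] Cons by auto
  have x: "x \<in> carrier R" using Cons by auto
  have dp: "divides_power (simple_extension ?S x) c" using Cons by simp
  have alg: "(algebraic over ?S) x" using divides_power_imp_algebraic[OF S x dp] .
  obtain c' where "divides_power ?S c'" using divides_power_descend[OF S x dp] by blast
  then have IH: "subfield ?S R" "finite_dimension K ?S" using Cons by auto
  have "subfield (simple_extension ?S x) R" using simple_extension_is_subfield[OF IH(1) x] alg by blast
  moreover have "finite_dimension K (simple_extension ?S x)"
    using telescopic_base_dim(1)[OF K IH(1) IH(2) finite_dimensionI[OF dimension_simple_extension[OF IH(1) x alg]]] .
  ultimately show ?case by simp
qed

section \<open>Quotients and fields of fractions\<close>

lemma domain_cong:
  assumes "domain R" "carrier S = carrier R" "mult S = mult R" "one S = one R"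
    "zero S = zero R" "add S = add R"
  shows "domain S"
proof -
  interpret domain R by fact
  have "id \<in> ring_iso R S"
    using assms(2-) by (intro ring_iso_memI) (auto simp: bij_betw_def)
  from ring_iso_imp_img_domain[OF this] show ?thesis
    using assms(4,5) by (cases S) simp
qed

lemma poisson_quot_domain:
  assumes "primeideal I A"
  shows "domain (poisson_quot A I)"
  by (rule domain_cong[OF primeideal.quotient_is_domain[OF assms]]) (simp_all add: poisson_quot_def)

lemma poisson_quot_sel:
  "carrier (poisson_quot A I) = carrier (A Quot I)" "mult (poisson_quot A I) = mult (A Quot I)"
  "one (poisson_quot A I) = one (A Quot I)" "zero (poisson_quot A I) = zero (A Quot I)"
  "add (poisson_quot A I) = add (A Quot I)"
  by (simp_all add: poisson_quot_def)

lemma poisson_quot_hom: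
  assumes "ideal I A"
  shows "(+>\<^bsub>A\<^esub>) I \<in> ring_hom A (poisson_quot A I)"
  using ideal.rcos_ring_hom[OF assms] unfolding ring_hom_def by (simp add: poisson_quot_sel)

lemma poisson_quot_carrierE:
  assumes "U \<in> carrier (poisson_quot A I)"
  obtains a where "a \<in> carrier A" "U = I +>\<^bsub>A\<^esub> a"
  using assms by (auto simp: poisson_quot_sel FactRing_simps)

context poisson_algebra begin

lemma poisson_ideal_bracket:
  assumes "poisson_ideal I A" "x \<in> carrier A" "i \<in> I"
  shows "\<lbrace>x, i\<rbrace> \<in> I" "\<lbrace>i, x\<rbrace> \<in> I"
proof -
  interpret ideal I A using assms(1) by (simp add: poisson_ideal_def)
  show "\<lbrace>x, i\<rbrace> \<in> I" using assms by (simp add: poisson_ideal_def)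
  then show "\<lbrace>i, x\<rbrace> \<in> I" using bracket_antisym[of i x] assms a_Hcarr by simp
qed

lemma smult_eq_mult: "r \<in> carrier K \<Longrightarrow> a \<in> carrier A \<Longrightarrow> r \<odot> a = (r \<odot> \<one>) \<otimes> a"
  using smult_assoc2[of r \<one> a] by simp

lemma poisson_quot_smult:
  assumes "ideal I A" "r \<in> carrier K" "a \<in> carrier A"
  shows "r \<odot>\<^bsub>poisson_quot A I\<^esub> (I +> a) = I +> (r \<odot> a)"
proof -
  interpret ideal I A by fact
  have "I +> (r \<odot> x) = I +> (r \<odot> a)" if x: "x \<in> I +> a" for x
  proof -
    obtain i where i: "i \<in> I" "x = i \<oplus> a" using x by (auto simp: a_r_coset_def')
    have ri: "r \<odot> i \<in> I" using smult_eq_mult[of r i] i assms I_l_closed[of i "r \<odot> \<one>"] Icarr by simp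
    have "r \<odot> x = r \<odot> i \<oplus> r \<odot> a" using i assms Icarr by (simp add: smult_r_distr)
    then have "r \<odot> x \<in> I +> (r \<odot> a)" using ri by (auto simp: a_r_coset_def')
    then show ?thesis using a_repr_independence assms a_subgroup by (metis smult_closed)
  qed
  moreover have "a \<in> I +> a" using assms a_rcos_self by auto
  ultimately have "(\<Union>x \<in> I +> a. I +> (r \<odot> x)) = I +> (r \<odot> a)" by blast
  then show ?thesis by (simp add: poisson_quot_def)
qed

lemma algebra_poisson_quot:
  assumes "primeideal I A"
  shows "algebra K (poisson_quot A I)" (is "algebra K ?Q")
proof -
  interpret I: primeideal I A by fact
  interpret Q: domain ?Q using poisson_quot_domain[OF assms] .
  interpret h: ring_hom_ring A ?Q "(+>) I"
    using poisson_quot_hom[OF I.is_ideal] by (intro ring_hom_ringI2) unfold_locales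
  note sm = poisson_quot_smult[OF I.is_ideal]
  note hs = h.hom_add[symmetric] h.hom_mult[symmetric]
  show "algebra K ?Q"
  proof (rule algebraI)
    show "cring K" ..
    show "cring ?Q" ..
  qed (auto elim!: poisson_quot_carrierE simp: sm hs smult_l_distr smult_r_distr smult_assoc1 smult_assoc2
        simp del: h.hom_add h.hom_mult)
qed

lemma poisson_quot_poisson_algebra:
  assumes P: "poisson_ideal I A" and prime: "primeideal I A"
  shows "poisson_algebra K (poisson_quot A I)" (is "poisson_algebra K ?Q")
proof -
  interpret I: primeideal I A by fact
  interpret Q: domain ?Q using poisson_quot_domain[OF prime] .
  interpret h: ring_hom_ring A ?Q "(+>) I"
    using poisson_quot_hom[OF I.is_ideal] by (intro ring_hom_ringI2) unfold_locales
  note br = poisson_quot_bracket[OF poisson_algebra_axioms P]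
  note sm = poisson_quot_smult[OF I.is_ideal]
  note hs = h.hom_add[symmetric] h.hom_mult[symmetric]
  interpret alg: algebra K ?Q using algebra_poisson_quot[OF prime] .
  show ?thesis
  proof
    fix a b c assume "a \<in> carrier ?Q" "b \<in> carrier ?Q" "c \<in> carrier ?Q"
    then obtain x y z where x: "x \<in> carrier A" "a = I +> x" "y \<in> carrier A" "b = I +> y"
      "z \<in> carrier A" "c = I +> z" by (auto elim!: poisson_quot_carrierE)
    note xx = x bracket_closed
    show "\<lbrace>a \<oplus>\<^bsub>?Q\<^esub> b, c\<rbrace>\<^bsub>?Q\<^esub> = \<lbrace>a, c\<rbrace>\<^bsub>?Q\<^esub> \<oplus>\<^bsub>?Q\<^esub> \<lbrace>b, c\<rbrace>\<^bsub>?Q\<^esub>"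
      "\<lbrace>a, b \<oplus>\<^bsub>?Q\<^esub> c\<rbrace>\<^bsub>?Q\<^esub> = \<lbrace>a, b\<rbrace>\<^bsub>?Q\<^esub> \<oplus>\<^bsub>?Q\<^esub> \<lbrace>a, c\<rbrace>\<^bsub>?Q\<^esub>"
      "\<lbrace>a \<otimes>\<^bsub>?Q\<^esub> b, c\<rbrace>\<^bsub>?Q\<^esub> = a \<otimes>\<^bsub>?Q\<^esub> \<lbrace>b, c\<rbrace>\<^bsub>?Q\<^esub> \<oplus>\<^bsub>?Q\<^esub> \<lbrace>a, c\<rbrace>\<^bsub>?Q\<^esub> \<otimes>\<^bsub>?Q\<^esub> b"
      "\<lbrace>a, b \<otimes>\<^bsub>?Q\<^esub> c\<rbrace>\<^bsub>?Q\<^esub> = b \<otimes>\<^bsub>?Q\<^esub> \<lbrace>a, c\<rbrace>\<^bsub>?Q\<^esub> \<oplus>\<^bsub>?Q\<^esub> \<lbrace>a, b\<rbrace>\<^bsub>?Q\<^esub> \<otimes>\<^bsub>?Q\<^esub> c"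
      using xx by (simp_all add: br hs bracket_add_left bracket_add_right
          bracket_leibniz_left bracket_leibniz_right del: h.hom_add h.hom_mult)
    show "\<lbrace>a, \<lbrace>b, c\<rbrace>\<^bsub>?Q\<^esub>\<rbrace>\<^bsub>?Q\<^esub> \<oplus>\<^bsub>?Q\<^esub> \<lbrace>b, \<lbrace>c, a\<rbrace>\<^bsub>?Q\<^esub>\<rbrace>\<^bsub>?Q\<^esub> \<oplus>\<^bsub>?Q\<^esub> \<lbrace>c, \<lbrace>a, b\<rbrace>\<^bsub>?Q\<^esub>\<rbrace>\<^bsub>?Q\<^esub> = \<zero>\<^bsub>?Q\<^esub>"
      using xx bracket_jacobi[of x y z] h.hom_zero by (simp add: br hs del: h.hom_add h.hom_mult h.hom_zero)
  next
    fix a b r assume "r \<in> carrier K" "a \<in> carrier ?Q" "b \<in> carrier ?Q"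
    then obtain x y where x: "x \<in> carrier A" "a = I +> x" "y \<in> carrier A" "b = I +> y" "r \<in> carrier K"
      by (auto elim!: poisson_quot_carrierE)
    show "\<lbrace>r \<odot>\<^bsub>?Q\<^esub> a, b\<rbrace>\<^bsub>?Q\<^esub> = r \<odot>\<^bsub>?Q\<^esub> \<lbrace>a, b\<rbrace>\<^bsub>?Q\<^esub>" "\<lbrace>a, r \<odot>\<^bsub>?Q\<^esub> b\<rbrace>\<^bsub>?Q\<^esub> = r \<odot>\<^bsub>?Q\<^esub> \<lbrace>a, b\<rbrace>\<^bsub>?Q\<^esub>"
      using x bracket_closed by (simp_all add: br sm bracket_smult_left bracket_smult_right)
  next
    fix a assume "a \<in> carrier ?Q"
    then obtain x where x: "x \<in> carrier A" "a = I +> x" by (auto elim!: poisson_quot_carrierE)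
    then show "\<lbrace>a, a\<rbrace>\<^bsub>?Q\<^esub> = \<zero>\<^bsub>?Q\<^esub>" using bracket_alternating h.hom_zero by (simp add: br del: h.hom_zero)
  next
    fix a b assume "a \<in> carrier ?Q" "b \<in> carrier ?Q"
    then show "\<lbrace>a, b\<rbrace>\<^bsub>?Q\<^esub> \<in> carrier ?Q"
      using bracket_closed by (auto elim!: poisson_quot_carrierE simp: br)
  qed
qed

end

context domain begin

lemma fraction_eqI:
  assumes "a \<in> carrier R" "b \<in> carrier R - {\<zero>}" "c \<in> carrier R" "d \<in> carrier R - {\<zero>}"
    "a \<otimes> d = c \<otimes> b"
  shows "fraction R a b = fraction R c d"
  using frac_eq_iff[OF domain_axioms assms(1-4)] assms(5) by simp

lemma fraction_mem: 
  assumes "a \<in> carrier R" "b \<in> carrier R - {\<zero>}"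
  shows "(p, q) \<in> fraction R a b \<longleftrightarrow> p \<in> carrier R \<and> q \<in> carrier R - {\<zero>} \<and> a \<otimes> q = p \<otimes> b"
  using assms by (auto simp: fraction_def frac_rel_def)

end

locale fraction_field_domain = domain D for D :: "('k, 'a, 'n) poisson_scheme" (structure)
begin

abbreviation F where "F \<equiv> poisson_frac D"

lemma frac_carrier: "carrier F = {fraction D a b | a b. a \<in> carrier D \<and> b \<in> carrier D - {\<zero>}}"
  unfolding poisson_frac_def by (auto simp: quotient_def fraction_def)

lemma frac_closed [simp]: "a \<in> carrier D \<Longrightarrow> b \<in> carrier D \<Longrightarrow> b \<noteq> \<zero> \<Longrightarrow> fraction D a b \<in> carrier F"
  unfolding frac_carrier by blast

lemma frac_carrierE:
  assumes "U \<in> carrier F"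
  obtains a b where "a \<in> carrier D" "b \<in> carrier D" "b \<noteq> \<zero>" "U = fraction D a b"
  using assms unfolding frac_carrier by blast

lemma frac_zero: "\<zero>\<^bsub>F\<^esub> = fraction D \<zero> \<one>" and frac_one: "\<one>\<^bsub>F\<^esub> = fraction D \<one> \<one>"
  by (simp_all add: poisson_frac_def)

lemma UN_fraction:
  fixes g :: "'a \<Rightarrow> 'a \<Rightarrow> 'c set"
  assumes "a \<in> carrier D" "b \<in> carrier D - {\<zero>}"
    and "\<And>p q. p \<in> carrier D \<Longrightarrow> q \<in> carrier D - {\<zero>} \<Longrightarrow> a \<otimes> q = p \<otimes> b \<Longrightarrow> g p q = W"
  shows "(\<Union>(p, q) \<in> fraction D a b. g p q) = W"
proof -
  have "(a, b) \<in> fraction D a b" using assms fraction_mem by simp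
  moreover have "g p q = W" if "(p, q) \<in> fraction D a b" for p q
    using that assms fraction_mem[OF assms(1,2)] by blast
  ultimately show ?thesis by blast
qed

lemma UN_fraction2:
  fixes g :: "'a \<Rightarrow> 'a \<Rightarrow> 'a \<Rightarrow> 'a \<Rightarrow> 'c set"
  assumes "a \<in> carrier D" "b \<in> carrier D" "b \<noteq> \<zero>" "c \<in> carrier D" "d \<in> carrier D" "d \<noteq> \<zero>"
    and *: "\<And>p q r s. p \<in> carrier D \<Longrightarrow> q \<in> carrier D - {\<zero>} \<Longrightarrow> a \<otimes> q = p \<otimes> b \<Longrightarrow>
      r \<in> carrier D \<Longrightarrow> s \<in> carrier D - {\<zero>} \<Longrightarrow> c \<otimes> s = r \<otimes> d \<Longrightarrow> g p q r s = W"
  shows "(\<Union>(p, q) \<in> fraction D a b. \<Union>(r, s) \<in> fraction D c d. g p q r s) = W"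
proof (rule UN_fraction)
  fix p q assume "p \<in> carrier D" "q \<in> carrier D - {\<zero>}" "a \<otimes> q = p \<otimes> b"
  then show "(\<Union>(r, s) \<in> fraction D c d. g p q r s) = W"
    using assms(4-6) by (intro UN_fraction *) auto
qed (use assms in auto)

lemma frac_mult:
  assumes c: "a \<in> carrier D" "b \<in> carrier D" "b \<noteq> \<zero>" "c \<in> carrier D" "d \<in> carrier D" "d \<noteq> \<zero>"
  shows "fraction D a b \<otimes>\<^bsub>F\<^esub> fraction D c d = fraction D (a \<otimes> c) (b \<otimes> d)"
proof -
  have "fraction D (p \<otimes> r) (q \<otimes> s) = fraction D (a \<otimes> c) (b \<otimes> d)"
    if h: "p \<in> carrier D" "q \<in> carrier D - {\<zero>}" "a \<otimes> q = p \<otimes> b" 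
      "r \<in> carrier D" "s \<in> carrier D - {\<zero>}" "c \<otimes> s = r \<otimes> d" for p q r s
  proof (rule fraction_eqI)
    have k: "q \<in> carrier D" "s \<in> carrier D" using h by auto
    have "(p \<otimes> r) \<otimes> (b \<otimes> d) = (p \<otimes> b) \<otimes> (r \<otimes> d)" using h(1,4) k c(1,2,4,5) by algebra
    also have "\<dots> = (a \<otimes> c) \<otimes> (q \<otimes> s)" unfolding h(3,6)[symmetric] using h(1,4) k c(1,2,4,5) by algebra
    finally show "(p \<otimes> r) \<otimes> (b \<otimes> d) = (a \<otimes> c) \<otimes> (q \<otimes> s)" .
  qed (use h c integral_iff in auto)
  then have "(\<Union>(p, q) \<in> fraction D a b. \<Union>(r, s) \<in> fraction D c d. fraction D (p \<otimes> r) (q \<otimes> s)) =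
     fraction D (a \<otimes> c) (b \<otimes> d)"
    by (rule UN_fraction2[OF c])
  then show ?thesis by (simp add: poisson_frac_def)
qed

lemma frac_add:
  assumes c: "a \<in> carrier D" "b \<in> carrier D" "b \<noteq> \<zero>" "c \<in> carrier D" "d \<in> carrier D" "d \<noteq> \<zero>"
  shows "fraction D a b \<oplus>\<^bsub>F\<^esub> fraction D c d = fraction D (a \<otimes> d \<oplus> c \<otimes> b) (b \<otimes> d)"
proof -
  have "fraction D (p \<otimes> s \<oplus> r \<otimes> q) (q \<otimes> s) = fraction D (a \<otimes> d \<oplus> c \<otimes> b) (b \<otimes> d)"
    if h: "p \<in> carrier D" "q \<in> carrier D - {\<zero>}" "a \<otimes> q = p \<otimes> b" 
      "r \<in> carrier D" "s \<in> carrier D - {\<zero>}" "c \<otimes> s = r \<otimes> d" for p q r s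
  proof (rule fraction_eqI)
    have k: "q \<in> carrier D" "s \<in> carrier D" using h by auto
    have "(p \<otimes> s \<oplus> r \<otimes> q) \<otimes> (b \<otimes> d) = (p \<otimes> b) \<otimes> (s \<otimes> d) \<oplus> (r \<otimes> d) \<otimes> (q \<otimes> b)" using h(1,4) k c(1,2,4,5) by algebra
    also have "\<dots> = (a \<otimes> d \<oplus> c \<otimes> b) \<otimes> (q \<otimes> s)" unfolding h(3,6)[symmetric] using h(1,4) k c(1,2,4,5) by algebra
    finally show "(p \<otimes> s \<oplus> r \<otimes> q) \<otimes> (b \<otimes> d) = (a \<otimes> d \<oplus> c \<otimes> b) \<otimes> (q \<otimes> s)" .
  qed (use h c integral_iff in auto)
  then have "(\<Union>(p, q) \<in> fraction D a b. \<Union>(r, s) \<in> fraction D c d. fraction D (p \<otimes> s \<oplus> r \<otimes> q) (q \<otimes> s)) =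
     fraction D (a \<otimes> d \<oplus> c \<otimes> b) (b \<otimes> d)"
    by (rule UN_fraction2[OF c])
  then show ?thesis by (simp add: poisson_frac_def)
qed

lemma frac_field: "field F"
proof -
  have nz: "b \<otimes> d \<noteq> \<zero>" if "b \<in> carrier D" "b \<noteq> \<zero>" "d \<in> carrier D" "d \<noteq> \<zero>" for b d
    using that integral_iff by auto
  have add: "abelian_group F"
  proof (rule abelian_groupI)
    show "\<zero>\<^bsub>F\<^esub> \<in> carrier F" by (simp add: frac_zero)
  next
    fix x y assume "x \<in> carrier F" "y \<in> carrier F"
    then obtain a b c d where h: "a \<in> carrier D" "b \<in> carrier D" "b \<noteq> \<zero>" "x = fraction D a b"
      "c \<in> carrier D" "d \<in> carrier D" "d \<noteq> \<zero>" "y = fraction D c d" by (metis frac_carrierE)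
    show "x \<oplus>\<^bsub>F\<^esub> y \<in> carrier F" using h nz by (simp add: frac_add)
    show "x \<oplus>\<^bsub>F\<^esub> y = y \<oplus>\<^bsub>F\<^esub> x" using h nz by (simp add: frac_add m_comm a_comm)
    fix z assume "z \<in> carrier F"
    then obtain e f where k: "e \<in> carrier D" "f \<in> carrier D" "f \<noteq> \<zero>" "z = fraction D e f"
      by (metis frac_carrierE)
    have "(a \<otimes> d \<oplus> c \<otimes> b) \<otimes> f \<oplus> e \<otimes> (b \<otimes> d) = a \<otimes> (d \<otimes> f) \<oplus> (c \<otimes> f \<oplus> e \<otimes> d) \<otimes> b"
      using h(1,2,5,6) k(1,2) by algebra
    then show "x \<oplus>\<^bsub>F\<^esub> y \<oplus>\<^bsub>F\<^esub> z = x \<oplus>\<^bsub>F\<^esub> (y \<oplus>\<^bsub>F\<^esub> z)"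
      using h k nz by (simp add: frac_add m_assoc)
  next
    fix x assume "x \<in> carrier F"
    then obtain a b where h: "a \<in> carrier D" "b \<in> carrier D" "b \<noteq> \<zero>" "x = fraction D a b"
      by (metis frac_carrierE)
    show "\<zero>\<^bsub>F\<^esub> \<oplus>\<^bsub>F\<^esub> x = x" using h by (simp add: frac_add frac_zero)
    have "(\<ominus> a) \<otimes> b \<oplus> a \<otimes> b = \<zero>" using h(1,2) by algebra
    then have "fraction D (\<ominus> a) b \<oplus>\<^bsub>F\<^esub> x = \<zero>\<^bsub>F\<^esub>"
      using h nz unfolding h(4) frac_zero by (simp add: frac_add) (intro fraction_eqI; auto)
    then show "\<exists>y\<in>carrier F. y \<oplus>\<^bsub>F\<^esub> x = \<zero>\<^bsub>F\<^esub>" using h by (meson a_inv_closed frac_closed)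
  qed
  have mon: "Group.comm_monoid F"
  proof (rule comm_monoidI)
    show "\<one>\<^bsub>F\<^esub> \<in> carrier F" by (simp add: frac_one)
  next
    fix x y assume "x \<in> carrier F" "y \<in> carrier F"
    then obtain a b c d where h: "a \<in> carrier D" "b \<in> carrier D" "b \<noteq> \<zero>" "x = fraction D a b"
      "c \<in> carrier D" "d \<in> carrier D" "d \<noteq> \<zero>" "y = fraction D c d" by (metis frac_carrierE)
    show "x \<otimes>\<^bsub>F\<^esub> y \<in> carrier F" using h nz by (simp add: frac_mult)
    show "x \<otimes>\<^bsub>F\<^esub> y = y \<otimes>\<^bsub>F\<^esub> x" using h nz by (simp add: frac_mult m_comm)
    fix z assume "z \<in> carrier F"
    then obtain e f where k: "e \<in> carrier D" "f \<in> carrier D" "f \<noteq> \<zero>" "z = fraction D e f"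
      by (metis frac_carrierE)
    show "x \<otimes>\<^bsub>F\<^esub> y \<otimes>\<^bsub>F\<^esub> z = x \<otimes>\<^bsub>F\<^esub> (y \<otimes>\<^bsub>F\<^esub> z)"
      using h k nz by (simp add: frac_mult m_assoc)
  next
    fix x assume "x \<in> carrier F"
    then show "\<one>\<^bsub>F\<^esub> \<otimes>\<^bsub>F\<^esub> x = x" by (auto elim!: frac_carrierE simp: frac_mult frac_one)
  qed
  have "cring F"
  proof (rule cringI[OF add mon])
    fix x y z assume "x \<in> carrier F" "y \<in> carrier F" "z \<in> carrier F"
    then obtain a b c d e f where h: "a \<in> carrier D" "b \<in> carrier D" "b \<noteq> \<zero>" "x = fraction D a b"
      "c \<in> carrier D" "d \<in> carrier D" "d \<noteq> \<zero>" "y = fraction D c d"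
      "e \<in> carrier D" "f \<in> carrier D" "f \<noteq> \<zero>" "z = fraction D e f" by (metis frac_carrierE)
    have "(a \<otimes> d \<oplus> c \<otimes> b) \<otimes> e \<otimes> (b \<otimes> f \<otimes> (d \<otimes> f)) =
       (a \<otimes> e \<otimes> (d \<otimes> f) \<oplus> c \<otimes> e \<otimes> (b \<otimes> f)) \<otimes> (b \<otimes> d \<otimes> f)"
      using h(1,2,5,6,9,10) by algebra
    then show "(x \<oplus>\<^bsub>F\<^esub> y) \<otimes>\<^bsub>F\<^esub> z = x \<otimes>\<^bsub>F\<^esub> z \<oplus>\<^bsub>F\<^esub> y \<otimes>\<^bsub>F\<^esub> z"
      using h nz by (simp add: frac_mult frac_add) (intro fraction_eqI; simp)
  qed
  then show ?thesis
  proof (rule cring.cring_fieldI2)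
    show "\<zero>\<^bsub>F\<^esub> \<noteq> \<one>\<^bsub>F\<^esub>" unfolding frac_zero frac_one
      by (subst frac_eq_iff[OF domain_axioms]) auto
    fix x assume x: "x \<in> carrier F" "x \<noteq> \<zero>\<^bsub>F\<^esub>"
    then obtain a b where h: "a \<in> carrier D" "b \<in> carrier D" "b \<noteq> \<zero>" "x = fraction D a b"
      by (metis frac_carrierE)
    have "a \<noteq> \<zero>" using x h fraction_eqI[of a b \<zero> \<one>] by (auto simp: frac_zero)
    moreover have "x \<otimes>\<^bsub>F\<^esub> fraction D b a = \<one>\<^bsub>F\<^esub>"
      using h nz \<open>a \<noteq> \<zero>\<close> by (simp add: frac_mult frac_one) (intro fraction_eqI; simp add: m_comm)
    ultimately show "\<exists>y\<in>carrier F. x \<otimes>\<^bsub>F\<^esub> y = \<one>\<^bsub>F\<^esub>" using h by (meson frac_closed)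
  qed
qed

lemma frac_embed_hom: "(\<lambda>a. fraction D a \<one>) \<in> ring_hom D F"
  by (intro ring_hom_memI) (auto simp: frac_mult frac_add frac_one)

lemma frac_embed_eq_zero: "a \<in> carrier D \<Longrightarrow> fraction D a \<one> = \<zero>\<^bsub>F\<^esub> \<longleftrightarrow> a = \<zero>"
  unfolding frac_zero by (subst frac_eq_iff[OF domain_axioms]) auto

lemma frac_mult_denominator:
  "\<lbrakk>a \<in> carrier D; b \<in> carrier D; b \<noteq> \<zero>\<rbrakk> \<Longrightarrow> fraction D a b \<otimes>\<^bsub>F\<^esub> fraction D b \<one> = fraction D a \<one>"
  by (simp add: frac_mult) (intro fraction_eqI; simp)

lemma frac_smult:
  assumes "algebra K D" "r \<in> carrier K" "a \<in> carrier D" "b \<in> carrier D" "b \<noteq> \<zero>"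
  shows "r \<odot>\<^bsub>F\<^esub> fraction D a b = fraction D (r \<odot> a) b"
proof -
  interpret algebra K D by fact
  have "(\<Union>(p, q) \<in> fraction D a b. fraction D (r \<odot> p) q) = fraction D (r \<odot> a) b"
  proof (rule UN_fraction)
    fix p q assume h: "p \<in> carrier D" "q \<in> carrier D - {\<zero>}" "a \<otimes> q = p \<otimes> b"
    then show "fraction D (r \<odot> p) q = fraction D (r \<odot> a) b"
      using assms by (intro fraction_eqI) (auto simp: smult_assoc2)
  qed (use assms in auto)
  then show ?thesis by (simp add: poisson_frac_def)
qed

end

section \<open>Rationality without fractions\<close>

text \<open>With \<open>n\<close> the length of \<open>p\<close>, this is \<open>g\<^sup>n\<close> times the value of the polynomial \<open>p\<close> (leading
  coefficient first) at \<open>f / g\<close>; it makes sense without dividing by \<open>g\<close>.\<close>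

primrec homog_eval :: "('k, 'a, 'n) module_scheme \<Rightarrow> 'k list \<Rightarrow> 'a \<Rightarrow> 'a \<Rightarrow> 'a" where
  "homog_eval A [] f g = \<zero>\<^bsub>A\<^esub>"
| "homog_eval A (c # p) f g = g \<otimes>\<^bsub>A\<^esub> ((c \<odot>\<^bsub>A\<^esub> (f [^]\<^bsub>A\<^esub> length p)) \<oplus>\<^bsub>A\<^esub> homog_eval A p f g)"

definition frac_class :: "('k, 'a, 'n) poisson_scheme \<Rightarrow> 'a set \<Rightarrow> 'a \<Rightarrow> ('a set \<times> 'a set) set" where
  "frac_class A P a = fraction (poisson_quot A P) (P +>\<^bsub>A\<^esub> a) \<one>\<^bsub>poisson_quot A P\<^esub>"

lemma (in ring) normalize_not_Nil:
  assumes "c \<in> set p" "c \<noteq> \<zero>"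
  shows "normalize p \<noteq> []"
  using assms by (induction p) auto

context poisson_algebra begin

lemma homog_eval_closed:
  "\<lbrakk>set p \<subseteq> carrier K; f \<in> carrier A; g \<in> carrier A\<rbrakk> \<Longrightarrow> homog_eval A p f g \<in> carrier A"
  by (induction p) auto

lemma smult_one_hom: "(\<lambda>r. r \<odot> \<one>) \<in> ring_hom K A"
proof (rule ring_hom_memI)
  fix r s assume rs: "r \<in> carrier K" "s \<in> carrier K"
  show "(r \<otimes>\<^bsub>K\<^esub> s) \<odot> \<one> = (r \<odot> \<one>) \<otimes> (s \<odot> \<one>)"
    using rs by (simp add: smult_assoc1 smult_eq_mult[of r "s \<odot> \<one>"])
qed (auto simp: smult_l_distr)

lemma smult_closed_ideal:
  assumes "ideal I A" "r \<in> carrier K" "a \<in> I"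
  shows "r \<odot> a \<in> I"
proof -
  interpret ideal I A by fact
  show ?thesis using smult_eq_mult[of r a] assms Icarr I_l_closed by simp
qed

end

locale residue = poisson_algebra K A + P?: primeideal P A
  for K :: "('k, 'm) ring_scheme" and A :: "('k, 'a, 'n) poisson_scheme" (structure) and P
begin

abbreviation "Q \<equiv> poisson_quot A P"
abbreviation "F \<equiv> poisson_frac Q"
abbreviation "\<phi> \<equiv> frac_class A P"

sublocale Q: fraction_field_domain Q
  unfolding fraction_field_domain_def using poisson_quot_domain[OF P.primeideal] .

sublocale F: field F using Q.frac_field .

sublocale q: ring_hom_ring A Q "(+>) P"
  using poisson_quot_hom[OF P.is_ideal] by (intro ring_hom_ringI2) unfold_locales

sublocale \<phi>: ring_hom_ring A F \<phi>
proof (rule ring_hom_ringI2)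
  show "ring A" "ring F" ..
  have "(\<lambda>a. fraction Q a \<one>\<^bsub>Q\<^esub>) \<circ> (+>) P \<in> ring_hom A F"
    using ring_hom_trans[OF _ Q.frac_embed_hom] q.homh by blast
  moreover have "\<phi> = (\<lambda>a. fraction Q a \<one>\<^bsub>Q\<^esub>) \<circ> (+>) P" by (simp add: frac_class_def fun_eq_iff)
  ultimately show "\<phi> \<in> ring_hom A F" by simp
qed

lemma class_eq_zero: "a \<in> carrier A \<Longrightarrow> P +> a = \<zero>\<^bsub>Q\<^esub> \<longleftrightarrow> a \<in> P"
  by (metis P.a_rcos_const P.rcos_const_imp_mem FactRing_def poisson_quot_sel(4) ring_record_simps(11))

lemma phi_eq_zero: "a \<in> carrier A \<Longrightarrow> \<phi> a = \<zero>\<^bsub>F\<^esub> \<longleftrightarrow> a \<in> P"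
  using Q.frac_embed_eq_zero class_eq_zero by (simp add: frac_class_def)

lemma scalar_eq: "r \<in> carrier K \<Longrightarrow> r \<odot>\<^bsub>F\<^esub> \<one>\<^bsub>F\<^esub> = \<phi> (r \<odot> \<one>)"
  using poisson_quot_smult[OF P.is_ideal, of r \<one>] q.hom_one
  by (simp add: Q.frac_one Q.frac_smult[OF algebra_poisson_quot[OF P.primeideal]] frac_class_def)

abbreviation "\<sigma> r \<equiv> \<phi> (r \<odot> \<one>)"

sublocale \<sigma>: ring_hom_ring K F \<sigma>
proof (rule ring_hom_ringI2)
  show "ring K" "ring F" ..
  have "\<phi> \<circ> (\<lambda>r. r \<odot> \<one>) \<in> ring_hom K F"
    using ring_hom_trans[OF smult_one_hom \<phi>.homh] .
  then show "\<sigma> \<in> ring_hom K F" by (simp add: comp_def)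
qed

lemma scalars_subfield: "subfield (\<sigma> ` carrier K) F"
  using \<sigma>.img_is_subfield[OF K.carrier_is_subfield] by simp

lemma sigma_eq_zero: "r \<in> carrier K \<Longrightarrow> \<sigma> r = \<zero>\<^bsub>F\<^esub> \<longleftrightarrow> r = \<zero>\<^bsub>K\<^esub>"
proof -
  assume r: "r \<in> carrier K"
  have "inj_on \<sigma> (carrier K)"
    using \<sigma>.non_trivial_field_hom_imp_inj[OF K.field_axioms] \<sigma>.hom_one F.one_not_zero
    by (metis K.one_closed \<sigma>.img_is_add_subgroup insertCI singletonD image_eqI)
  from inj_on_eq_iff[OF this r K.zero_closed] show ?thesis using \<sigma>.hom_zero by simp
qed

lemma phi_homog_eval:
  assumes "set p \<subseteq> carrier K" "f \<in> carrier A" "g \<in> carrier A" "z \<in> carrier F"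
    and z: "\<phi> f = z \<otimes>\<^bsub>F\<^esub> \<phi> g"
  shows "\<phi> (homog_eval A p f g) = (\<phi> g [^]\<^bsub>F\<^esub> length p) \<otimes>\<^bsub>F\<^esub> F.eval (map \<sigma> p) z"
  using assms(1)
proof (induction p)
  case Nil then show ?case by simp
next
  case (Cons c p)
  define E where "E = F.eval (map \<sigma> p) z"
  define n where "n = length p"
  have E: "E \<in> carrier F" unfolding E_def using Cons assms by (intro F.eval_in_carrier) auto
  have c: "c \<in> carrier K" and p: "set p \<subseteq> carrier K" using Cons by auto
  have pf: "\<phi> (f [^] n) = z [^]\<^bsub>F\<^esub> n \<otimes>\<^bsub>F\<^esub> \<phi> g [^]\<^bsub>F\<^esub> n"
    using \<phi>.hom_nat_pow assms z by (simp add: F.nat_pow_distrib)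
  have "\<phi> (homog_eval A (c # p) f g) = \<phi> g \<otimes>\<^bsub>F\<^esub> (\<sigma> c \<otimes>\<^bsub>F\<^esub> \<phi> (f [^] n) \<oplus>\<^bsub>F\<^esub> \<phi> g [^]\<^bsub>F\<^esub> n \<otimes>\<^bsub>F\<^esub> E)"
    using Cons c p assms smult_eq_mult[of c "f [^] n"] homog_eval_closed[OF p assms(2,3)]
    by (simp add: E_def n_def)
  also have "\<dots> = (\<phi> g [^]\<^bsub>F\<^esub> Suc n) \<otimes>\<^bsub>F\<^esub> (\<sigma> c \<otimes>\<^bsub>F\<^esub> z [^]\<^bsub>F\<^esub> n \<oplus>\<^bsub>F\<^esub> E)"
  proof -
    define G s u where "G = \<phi> g" "s = \<sigma> c" "u = z [^]\<^bsub>F\<^esub> n"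
    note defs = this
    define v where "v = G [^]\<^bsub>F\<^esub> n"
    have "G \<in> carrier F" "s \<in> carrier F" "u \<in> carrier F" "v \<in> carrier F"
      using assms c by (auto simp: defs v_def)
    then show ?thesis unfolding pf F.nat_pow_Suc defs[symmetric] v_def[symmetric] using E by algebra
  qed
  finally show ?case using c assms by (simp add: E_def n_def)
qed

lemma algebraic_iff_homog_eval:
  assumes "f \<in> carrier A" "g \<in> carrier A" "g \<notin> P" "z \<in> carrier F" and z: "\<phi> f = z \<otimes>\<^bsub>F\<^esub> \<phi> g"
  shows "(F.algebraic over (\<sigma> ` carrier K)) z \<longleftrightarrow>
    (\<exists>p. set p \<subseteq> carrier K \<and> (\<exists>c \<in> set p. c \<noteq> \<zero>\<^bsub>K\<^esub>) \<and> homog_eval A p f g \<in> P)"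
proof
  have gz: "\<phi> g \<noteq> \<zero>\<^bsub>F\<^esub>" using phi_eq_zero assms by simp
  have gn: "\<phi> g [^]\<^bsub>F\<^esub> (n::nat) \<noteq> \<zero>\<^bsub>F\<^esub>" for n
    using gz assms by (induction n) (auto simp: F.integral_iff)
  note S = subfieldE(1)[OF scalars_subfield]
  {
    assume "(F.algebraic over (\<sigma> ` carrier K)) z"
    then obtain q where q: "q \<in> carrier ((\<sigma> ` carrier K)[X]\<^bsub>F\<^esub>)" "q \<noteq> []" "F.eval q z = \<zero>\<^bsub>F\<^esub>"
      using F.algebraicE[OF S assms(4)] by blast
    then have qq: "set q \<subseteq> \<sigma> ` carrier K" "hd q \<noteq> \<zero>\<^bsub>F\<^esub>"
      unfolding univ_poly_carrier[symmetric] polynomial_def by auto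
    define p where "p = map (inv_into (carrier K) \<sigma>) q"
    have "\<sigma> (inv_into (carrier K) \<sigma> x) = x" if "x \<in> set q" for x
      using f_inv_into_f[of x \<sigma> "carrier K"] qq(1) that by blast
    then have "map \<sigma> p = q" unfolding p_def map_map comp_def by (rule map_idI)
    moreover have "set p \<subseteq> carrier K"
      unfolding p_def using qq(1) by (auto intro: inv_into_into)
    ultimately have p: "q = map \<sigma> p" "set p \<subseteq> carrier K" by auto
    have "hd p \<noteq> \<zero>\<^bsub>K\<^esub>" using qq p q(2) by (cases p) auto
    then have "\<exists>c \<in> set p. c \<noteq> \<zero>\<^bsub>K\<^esub>" using p q(2) by (cases p) auto
    moreover have "\<phi> (homog_eval A p f g) = \<zero>\<^bsub>F\<^esub>"
      using phi_homog_eval[OF p(2) assms(1,2,4) z] q p assms by simp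
    then have "homog_eval A p f g \<in> P" using phi_eq_zero homog_eval_closed p assms by simp
    ultimately show "\<exists>p. set p \<subseteq> carrier K \<and> (\<exists>c \<in> set p. c \<noteq> \<zero>\<^bsub>K\<^esub>) \<and> homog_eval A p f g \<in> P"
      using p by blast
  }
  {
    assume "\<exists>p. set p \<subseteq> carrier K \<and> (\<exists>c \<in> set p. c \<noteq> \<zero>\<^bsub>K\<^esub>) \<and> homog_eval A p f g \<in> P"
    then obtain p where p: "set p \<subseteq> carrier K" "\<exists>c \<in> set p. c \<noteq> \<zero>\<^bsub>K\<^esub>" "homog_eval A p f g \<in> P" by blast
    have mp: "set (map \<sigma> p) \<subseteq> carrier F" "set (map \<sigma> p) \<subseteq> \<sigma> ` carrier K" using p by auto
    have ec: "F.eval (map \<sigma> p) z \<in> carrier F" using F.eval_in_carrier[OF mp(1) assms(4)] .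
    have "\<phi> (homog_eval A p f g) = \<zero>\<^bsub>F\<^esub>" using phi_eq_zero homog_eval_closed p assms by simp
    then have "F.eval (map \<sigma> p) z = \<zero>\<^bsub>F\<^esub>"
      using phi_homog_eval[OF p(1) assms(1,2,4) z] gn ec assms F.integral by fastforce
    then have e: "F.eval (F.normalize (map \<sigma> p)) z = \<zero>\<^bsub>F\<^esub>"
      using F.eval_normalize[OF mp(1) assms(4)] by simp
    obtain c where c: "c \<in> set p" "c \<noteq> \<zero>\<^bsub>K\<^esub>" using p(2) by blast
    then have "\<sigma> c \<noteq> \<zero>\<^bsub>F\<^esub>" using sigma_eq_zero p(1) by blast
    moreover have "\<sigma> c \<in> set (map \<sigma> p)" using c(1) unfolding set_map by (rule imageI)
    ultimately have "F.normalize (map \<sigma> p) \<noteq> []" by (rule F.normalize_not_Nil[rotated])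
    moreover have "F.normalize (map \<sigma> p) \<in> carrier ((\<sigma> ` carrier K)[X]\<^bsub>F\<^esub>)"
      using F.normalize_gives_polynomial[OF mp(2)] unfolding univ_poly_carrier .
    ultimately show "(F.algebraic over (\<sigma> ` carrier K)) z" using F.algebraicI e by blast
  }
qed

end

lemma (in poisson_algebra) bracket_one: "a \<in> carrier A \<Longrightarrow> \<lbrace>a, \<one>\<rbrace> = \<zero>"
  using bracket_leibniz_right[of a \<one> \<one>] bracket_closed[of a \<one>]
  by simp

lemma (in poisson_algebra) poisson_centre_frac_iff:
  assumes dom: "domain A"
    and ab: "a \<in> carrier A" "b \<in> carrier A" "b \<noteq> \<zero>"
  shows "fraction A a b \<in> poisson_centre (poisson_frac A) \<longleftrightarrow>
    (\<forall>c \<in> carrier A. b \<otimes> \<lbrace>a, c\<rbrace> = a \<otimes> \<lbrace>b, c\<rbrace>)"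
proof -
  interpret D: fraction_field_domain A unfolding fraction_field_domain_def by fact
  have num: "frac_bracket_num A a b c d =
     d \<otimes> (b \<otimes> \<lbrace>a, c\<rbrace> \<ominus> a \<otimes> \<lbrace>b, c\<rbrace>) \<ominus> c \<otimes> (b \<otimes> \<lbrace>a, d\<rbrace> \<ominus> a \<otimes> \<lbrace>b, d\<rbrace>)"
    if cd: "c \<in> carrier A" "d \<in> carrier A" for c d
  proof -
    define p q r s where "p = \<lbrace>a, c\<rbrace>" "q = \<lbrace>a, d\<rbrace>" "r = \<lbrace>b, c\<rbrace>" "s = \<lbrace>b, d\<rbrace>"
    have "p \<in> carrier A" "q \<in> carrier A" "r \<in> carrier A" "s \<in> carrier A"
      using bracket_closed ab cd by (auto simp: p_q_r_s_def)
    then show ?thesis unfolding frac_bracket_num_def p_q_r_s_def[symmetric] using ab(1,2) cd by algebra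
  qed
  note br = poisson_frac_bracket[OF poisson_algebra_axioms dom ab(1)]
  have zero: "fraction A x y = \<zero>\<^bsub>poisson_frac A\<^esub> \<longleftrightarrow> x = \<zero>"
    if "x \<in> carrier A" "y \<in> carrier A" "y \<noteq> \<zero>" for x y
    unfolding D.frac_zero using that by (subst frac_eq_iff[OF dom]) auto
  have nc: "frac_bracket_num A a b c d \<in> carrier A" if "c \<in> carrier A" "d \<in> carrier A" for c d
    using that ab bracket_closed by (simp add: num)
  have iff: "\<lbrace>fraction A a b, fraction A c d\<rbrace>\<^bsub>poisson_frac A\<^esub> = \<zero>\<^bsub>poisson_frac A\<^esub> \<longleftrightarrow>
     frac_bracket_num A a b c d = \<zero>" if "c \<in> carrier A" "d \<in> carrier A" "d \<noteq> \<zero>" for c d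
    using that ab nc by (subst br) (auto simp: zero D.integral_iff)
  show ?thesis
  proof
    assume L: "fraction A a b \<in> poisson_centre (poisson_frac A)"
    show "\<forall>c \<in> carrier A. b \<otimes> \<lbrace>a, c\<rbrace> = a \<otimes> \<lbrace>b, c\<rbrace>"
    proof
      fix c assume c: "c \<in> carrier A"
      have "frac_bracket_num A a b c \<one> = \<zero>"
        using L iff[of c "\<one>"] c unfolding poisson_centre_def by simp
      then have "b \<otimes> \<lbrace>a, c\<rbrace> \<ominus> a \<otimes> \<lbrace>b, c\<rbrace> = \<zero>"
        using num[of c "\<one>"] c ab bracket_one bracket_closed by (simp add: a_minus_def)
      then show "b \<otimes> \<lbrace>a, c\<rbrace> = a \<otimes> \<lbrace>b, c\<rbrace>"
        using c ab bracket_closed by simp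
    qed
  next
    assume R: "\<forall>c \<in> carrier A. b \<otimes> \<lbrace>a, c\<rbrace> = a \<otimes> \<lbrace>b, c\<rbrace>"
    have "frac_bracket_num A a b c d = \<zero>" if "c \<in> carrier A" "d \<in> carrier A" for c d
    proof -
      have "b \<otimes> \<lbrace>a, x\<rbrace> \<ominus> a \<otimes> \<lbrace>b, x\<rbrace> = \<zero>" if "x \<in> carrier A" for x
        using that ab R bracket_closed A.r_right_minus_eq by simp
      then show ?thesis using that by (simp add: num a_minus_def)
    qed
    then show "fraction A a b \<in> poisson_centre (poisson_frac A)"
      using iff ab unfolding poisson_centre_def by (auto elim!: D.frac_carrierE)
  qed
qed

lemma (in poisson_algebra) poisson_rational_iff:
  assumes I: "I \<in> poisson_spec A"
  shows "poisson_rational K A I \<longleftrightarrow>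
    (\<forall>f \<in> carrier A. \<forall>g \<in> carrier A - I.
      (\<forall>b \<in> carrier A. g \<otimes> \<lbrace>f, b\<rbrace> \<ominus> f \<otimes> \<lbrace>g, b\<rbrace> \<in> I) \<longrightarrow>
      (\<exists>p. set p \<subseteq> carrier K \<and> (\<exists>c \<in> set p. c \<noteq> \<zero>\<^bsub>K\<^esub>) \<and> homog_eval A p f g \<in> I))"
    (is "?rat \<longleftrightarrow> ?hom")
proof -
  have prime: "primeideal I A" and pI: "poisson_ideal I A" using I by (auto simp: poisson_spec_def)
  interpret residue K A I unfolding residue_def using poisson_algebra_axioms prime by blast
  have PQ: "poisson_algebra K Q" using poisson_quot_poisson_algebra[OF pI prime] .
  have sc: "(\<lambda>r. r \<odot>\<^bsub>F\<^esub> \<one>\<^bsub>F\<^esub>) ` carrier K = \<sigma> ` carrier K" using scalar_eq by simp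
  have cent: "fraction Q (I +> f) (I +> g) \<in> poisson_centre F \<longleftrightarrow>
     (\<forall>b \<in> carrier A. g \<otimes> \<lbrace>f, b\<rbrace> \<ominus> f \<otimes> \<lbrace>g, b\<rbrace> \<in> I)"
    if fg: "f \<in> carrier A" "g \<in> carrier A - I" for f g
  proof -
    have "(I +> g) \<otimes>\<^bsub>Q\<^esub> \<lbrace>I +> f, I +> b\<rbrace>\<^bsub>Q\<^esub> = (I +> f) \<otimes>\<^bsub>Q\<^esub> \<lbrace>I +> g, I +> b\<rbrace>\<^bsub>Q\<^esub> \<longleftrightarrow>
      g \<otimes> \<lbrace>f, b\<rbrace> \<ominus> f \<otimes> \<lbrace>g, b\<rbrace> \<in> I" if b: "b \<in> carrier A" for b
    proof -
      have "(I +> g) \<otimes>\<^bsub>Q\<^esub> \<lbrace>I +> f, I +> b\<rbrace>\<^bsub>Q\<^esub> = I +> (g \<otimes> \<lbrace>f, b\<rbrace>)"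
        "(I +> f) \<otimes>\<^bsub>Q\<^esub> \<lbrace>I +> g, I +> b\<rbrace>\<^bsub>Q\<^esub> = I +> (f \<otimes> \<lbrace>g, b\<rbrace>)"
        using fg b bracket_closed by (simp_all add: poisson_quot_bracket[OF poisson_algebra_axioms pI])
      then show ?thesis
        using fg b bracket_closed A.quotient_eq_iff_same_a_r_cos[OF P.is_ideal] by simp
    qed
    moreover have "(\<forall>c \<in> carrier Q. Z c) \<longleftrightarrow> (\<forall>b \<in> carrier A. Z (I +> b))" for Z
      using q.hom_closed by (metis poisson_quot_carrierE)
    ultimately show ?thesis
      using fg class_eq_zero by (subst poisson_algebra.poisson_centre_frac_iff[OF PQ Q.domain_axioms]) auto
  qed
  have zeq: "fraction Q (I +> f) (I +> g) \<in> carrier F"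
     "\<phi> f = fraction Q (I +> f) (I +> g) \<otimes>\<^bsub>F\<^esub> \<phi> g"
    if fg: "f \<in> carrier A" "g \<in> carrier A - I" for f g
    using fg class_eq_zero by (auto simp: Q.frac_mult_denominator frac_class_def)
  have alg: "(F.algebraic over (\<sigma> ` carrier K)) (fraction Q (I +> f) (I +> g)) \<longleftrightarrow>
    (\<exists>p. set p \<subseteq> carrier K \<and> (\<exists>c \<in> set p. c \<noteq> \<zero>\<^bsub>K\<^esub>) \<and> homog_eval A p f g \<in> I)"
    if fg: "f \<in> carrier A" "g \<in> carrier A - I" for f g
    using algebraic_iff_homog_eval[OF _ _ _ zeq[OF fg]] fg by blast
  have rat: "?rat \<longleftrightarrow> (\<forall>z \<in> poisson_centre F. (F.algebraic over (\<sigma> ` carrier K)) z)"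
    by (simp add: poisson_rational_def Let_def sc)
  show ?thesis
  proof
    assume ?rat then show ?hom using rat cent alg by blast
  next
    assume hom: ?hom
    have "(F.algebraic over (\<sigma> ` carrier K)) z" if z: "z \<in> poisson_centre F" for z
    proof -
      have "z \<in> carrier F" using z by (simp add: poisson_centre_def)
      then obtain U V where "U \<in> carrier Q" "V \<in> carrier Q" "V \<noteq> \<zero>\<^bsub>Q\<^esub>" "z = fraction Q U V"
        by (rule Q.frac_carrierE)
      then obtain f g where fg: "f \<in> carrier A" "g \<in> carrier A - I" "z = fraction Q (I +> f) (I +> g)"
        using class_eq_zero by (metis DiffI poisson_quot_carrierE)
      have "\<forall>b \<in> carrier A. g \<otimes> \<lbrace>f, b\<rbrace> \<ominus> f \<otimes> \<lbrace>g, b\<rbrace> \<in> I"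
        using cent[OF fg(1,2)] z unfolding fg(3) by (rule iffD1)
      then have "\<exists>p. set p \<subseteq> carrier K \<and> (\<exists>c \<in> set p. c \<noteq> \<zero>\<^bsub>K\<^esub>) \<and> homog_eval A p f g \<in> I"
        by (rule hom[THEN bspec[OF _ fg(1)], THEN bspec[OF _ fg(2)], THEN mp])
      then show ?thesis unfolding fg(3) by (rule alg[OF fg(1,2), THEN iffD2])
    qed
    then show ?rat using rat by blast
  qed
qed

section \<open>Maximal ideals of finitely generated algebras\<close>

lemma (in cring) ideal_if_closed:
  assumes "I \<subseteq> carrier R" "\<zero> \<in> I"
    and "\<And>a b. \<lbrakk>a \<in> I; b \<in> I\<rbrakk> \<Longrightarrow> a \<oplus> b \<in> I"
    and m: "\<And>a x. \<lbrakk>a \<in> carrier R; x \<in> I\<rbrakk> \<Longrightarrow> a \<otimes> x \<in> I"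
  shows "ideal I R"
proof (rule idealI[OF ring_axioms])
  have "\<ominus> x \<in> I" if "x \<in> I" for x
    using m[of "\<ominus> \<one>" x] that assms(1) by (simp add: l_minus subset_iff)
  then show "subgroup I (add_monoid R)"
    using assms(1-3) by (intro add.subgroupI) (auto simp: a_inv_def)
  fix a x assume "a \<in> I" "x \<in> carrier R"
  then show "x \<otimes> a \<in> I" "a \<otimes> x \<in> I" using m[of x a] assms(1) m_comm[of a x] by auto
qed

lemma (in cring) ideal_Union_chain:
  assumes "subset.chain {J. ideal J R} C" "C \<noteq> {}"
  shows "ideal (\<Union>C) R"
proof (rule ideal_if_closed)
  have id: "ideal J R" if "J \<in> C" for J using assms that by (auto simp: subset.chain_def)
  note additive_subgroup.a_subset[OF ideal.axioms(1)[OF id]] 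
  then show "\<Union>C \<subseteq> carrier R" by blast
  obtain J where "J \<in> C" using assms by blast
  then show "\<zero> \<in> \<Union>C" using additive_subgroup.zero_closed[OF ideal.axioms(1)[OF id]] by blast
  fix a b assume "a \<in> \<Union>C" "b \<in> \<Union>C"
  then obtain J L where J: "J \<in> C" "a \<in> J" "L \<in> C" "b \<in> L" by blast
  then have "J \<subseteq> L \<or> L \<subseteq> J" using assms(1) by (auto simp: subset.chain_def)
  then obtain N where "N \<in> C" "a \<in> N" "b \<in> N" using J by blast
  then show "a \<oplus> b \<in> \<Union>C" using additive_subgroup.a_closed[OF ideal.axioms(1)[OF id]] by blast
next
  have id: "ideal J R" if "J \<in> C" for J using assms that by (auto simp: subset.chain_def)
  fix a x assume "a \<in> carrier R" "x \<in> \<Union>C"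
  then show "a \<otimes> x \<in> \<Union>C" using ideal.I_l_closed[OF id] by blast
qed

lemma (in cring) ideal_add_element:
  assumes I: "ideal I R" and r: "r \<in> carrier R"
  obtains J where "ideal J R" "I \<subseteq> J" "r \<in> J" "\<And>x. x \<in> J \<Longrightarrow> \<exists>s \<in> carrier R. x \<ominus> r \<otimes> s \<in> I"
proof
  interpret I: ideal I R by fact
  let ?J = "{x \<in> carrier R. \<exists>s \<in> carrier R. x \<ominus> r \<otimes> s \<in> I}"
  show "ideal ?J R"
  proof (rule ideal_if_closed)
    show "\<zero> \<in> ?J" using r by (auto intro!: bexI[of _ \<zero>] simp: a_minus_def)
  next
    fix a b assume "a \<in> ?J" "b \<in> ?J"
    then obtain s t where h: "a \<in> carrier R" "b \<in> carrier R" "s \<in> carrier R" "t \<in> carrier R"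
      and m: "a \<ominus> r \<otimes> s \<in> I" "b \<ominus> r \<otimes> t \<in> I" by blast
    have "(a \<ominus> r \<otimes> s) \<oplus> (b \<ominus> r \<otimes> t) = (a \<oplus> b) \<ominus> r \<otimes> (s \<oplus> t)" using h r by algebra
    then have "(a \<oplus> b) \<ominus> r \<otimes> (s \<oplus> t) \<in> I" using I.a_closed[OF m] by simp
    then show "a \<oplus> b \<in> ?J" using h by blast
  next
    fix a b assume a: "a \<in> carrier R" and "b \<in> ?J"
    then obtain t where h: "b \<in> carrier R" "t \<in> carrier R"
      and m: "b \<ominus> r \<otimes> t \<in> I" by blast
    have "a \<otimes> (b \<ominus> r \<otimes> t) = (a \<otimes> b) \<ominus> r \<otimes> (a \<otimes> t)" using h r a by algebra
    then have "(a \<otimes> b) \<ominus> r \<otimes> (a \<otimes> t) \<in> I" using I.I_l_closed[OF m a] by simp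
    then show "a \<otimes> b \<in> ?J" using h a by blast
  qed auto
  show "I \<subseteq> ?J" using r I.Icarr by (auto intro!: bexI[of _ \<zero>] simp: a_minus_def)
  show "r \<in> ?J" using r by (auto intro!: bexI[of _ \<one>] simp: a_minus_def r_neg)
qed auto

lemma (in cring) maximal_missing_powers:
  assumes J: "ideal J R" "Z J" "\<And>n::nat. f [^] n \<notin> J"
    and chain: "\<And>C. \<lbrakk>subset.chain {J. ideal J R \<and> Z J} C; C \<noteq> {}\<rbrakk> \<Longrightarrow> Z (\<Union>C)"
  obtains M where "ideal M R" "Z M" "J \<subseteq> M" "\<And>n::nat. f [^] n \<notin> M"
    "\<And>L. \<lbrakk>ideal L R; Z L; M \<subseteq> L; \<And>n::nat. f [^] n \<notin> L\<rbrakk> \<Longrightarrow> L = M"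
proof -
  let ?A = "{L. ideal L R \<and> Z L \<and> J \<subseteq> L \<and> (\<forall>n::nat. f [^] n \<notin> L)}"
  have "\<exists>M\<in>?A. \<forall>L\<in>?A. M \<subseteq> L \<longrightarrow> L = M"
  proof (rule subset_Zorn_nonempty)
    show "?A \<noteq> {}" using J by blast
    fix C assume C: "C \<noteq> {}" "subset.chain ?A C"
    have 1: "subset.chain {J. ideal J R} C" "subset.chain {J. ideal J R \<and> Z J} C"
      using C(2) unfolding subset.chain_def by auto
    have "\<forall>n::nat. f [^] n \<notin> \<Union>C" "J \<subseteq> \<Union>C"
      using C unfolding subset.chain_def by blast+
    then show "\<Union>C \<in> ?A" using ideal_Union_chain[OF 1(1) C(1)] chain[OF 1(2) C(1)] by blast
  qed
  then show thesis using that by (smt (verit, ccfv_threshold) mem_Collect_eq subset_trans)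
qed

lemma (in cring) primeideal_power:
  assumes "primeideal P R" "f \<in> carrier R" "f [^] (n::nat) \<in> P"
  shows "f \<in> P"
  using assms(3)
proof (induction n)
  case 0
  then show ?case using primeideal.I_notcarr[OF assms(1)] ideal.one_imp_carrier[OF primeideal.axioms(1)[OF assms(1)]] by simp
next
  case (Suc n)
  then show ?case using primeideal.I_prime[OF assms(1), of "f [^] n" f] assms(2) by auto
qed

lemma (in cring) prime_missing_powers:
  assumes I: "ideal I R" and f: "f \<in> carrier R" "\<And>n::nat. f [^] n \<notin> I"
  obtains P where "primeideal P R" "I \<subseteq> P" "f \<notin> P"
    "\<And>r. r \<in> carrier R - P \<Longrightarrow> \<exists>n::nat. \<exists>s \<in> carrier R. f [^] n \<ominus> r \<otimes> s \<in> P"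
proof -
  obtain P where P: "ideal P R" "I \<subseteq> P" "\<And>n::nat. f [^] n \<notin> P"
    and max: "\<And>L. \<lbrakk>ideal L R; P \<subseteq> L; \<And>n::nat. f [^] n \<notin> L\<rbrakk> \<Longrightarrow> L = P"
    using maximal_missing_powers[of I "\<lambda>_. True" f] I f(2) by (metis (full_types))
  interpret P: ideal P R by fact
  have key: "\<exists>n::nat. \<exists>s \<in> carrier R. f [^] n \<ominus> r \<otimes> s \<in> P" if r: "r \<in> carrier R - P" for r
  proof -
    obtain L where L: "ideal L R" "P \<subseteq> L" "r \<in> L"
      "\<And>x. x \<in> L \<Longrightarrow> \<exists>s \<in> carrier R. x \<ominus> r \<otimes> s \<in> P"
      using ideal_add_element[OF P(1), of r] r by blast
    then obtain n :: nat where "f [^] n \<in> L" using max[OF L(1,2)] r by blast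
    then show ?thesis using L(4) by blast
  qed
  have prime: "primeideal P R"
  proof (rule primeidealI[OF P(1) is_cring])
    show "carrier R \<noteq> P" using P(3) f(1) by blast
    fix a b assume ab: "a \<in> carrier R" "b \<in> carrier R" "a \<otimes> b \<in> P"
    show "a \<in> P \<or> b \<in> P"
    proof (rule ccontr)
      assume "\<not> ?thesis"
      then obtain m n :: nat and s t where s: "s \<in> carrier R" "f [^] m \<ominus> a \<otimes> s \<in> P"
        and t: "t \<in> carrier R" "f [^] n \<ominus> b \<otimes> t \<in> P" using key ab by (metis DiffI)
      define u v where "u = f [^] m" "v = f [^] n"
      have uv: "u \<in> carrier R" "v \<in> carrier R" using f by (auto simp: u_v_def)
      have e: "v \<otimes> (u \<ominus> a \<otimes> s) \<oplus> (a \<otimes> s) \<otimes> (v \<ominus> b \<otimes> t) \<oplus> (s \<otimes> t) \<otimes> (a \<otimes> b) = u \<otimes> v"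
        using uv ab(1,2) s(1) t(1) by algebra
      have "v \<otimes> (u \<ominus> a \<otimes> s) \<oplus> (a \<otimes> s) \<otimes> (v \<ominus> b \<otimes> t) \<oplus> (s \<otimes> t) \<otimes> (a \<otimes> b) \<in> P"
        using P.a_closed[OF P.a_closed[OF P.I_l_closed[OF s(2), of v] P.I_l_closed[OF t(2), of "a \<otimes> s"]]
          P.I_l_closed[OF ab(3), of "s \<otimes> t"]] s(1) t(1) ab(1) uv by (simp add: u_v_def)
      then have "f [^] (m + n) \<in> P" unfolding e using f(1) by (simp add: u_v_def nat_pow_mult)
      then show False using P(3) by blast
    qed
  qed
  have "f \<notin> P" using P(3)[of 1] f(1) by simp
  then show thesis using that prime P(2) key by blast
qed

context poisson_algebra begin

lemma generated_subalgebra_subset: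
  assumes "T \<subseteq> carrier A" "S \<subseteq> T" "\<one> \<in> T"
    and add: "\<And>a b. \<lbrakk>a \<in> T; b \<in> T\<rbrakk> \<Longrightarrow> a \<oplus> b \<in> T"
    and mult: "\<And>a b. \<lbrakk>a \<in> T; b \<in> T\<rbrakk> \<Longrightarrow> a \<otimes> b \<in> T"
    and smult: "\<And>r a. \<lbrakk>r \<in> carrier K; a \<in> T\<rbrakk> \<Longrightarrow> r \<odot> a \<in> T"
  shows "subring T A" "submodule T K A" "generated_subalgebra K A S \<subseteq> T"
proof -
  have neg: "\<ominus> a \<in> T" if "a \<in> T" for a
    using smult[of "\<ominus>\<^bsub>K\<^esub> \<one>\<^bsub>K\<^esub>" a] that assms(1) by (simp add: smult_l_minus subset_iff)
  have zero: "\<zero> \<in> T" using smult[of "\<zero>\<^bsub>K\<^esub>" \<one>] assms(3) by simp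
  show sr: "subring T A" using assms neg by (intro A.subringI) auto
  show sm: "submodule T K A" using assms neg zero by (intro submoduleI) auto
  show "generated_subalgebra K A S \<subseteq> T" unfolding generated_subalgebra_def using sr sm assms(2) by blast
qed

end

context residue begin

lemma image_eq_finite_extension:
  assumes S: "S \<subseteq> carrier A" "generated_subalgebra K A S = carrier A" and xs: "set xs = \<phi> ` S"
  shows "F.finite_extension (\<sigma> ` carrier K) xs = \<phi> ` carrier A"
proof
  let ?E = "F.finite_extension (\<sigma> ` carrier K) xs"
  note sK = subfieldE(1)[OF scalars_subfield]
  have xc: "set xs \<subseteq> carrier F" using xs S(1) by auto
  have E: "subring ?E F" using F.finite_extension_is_subring[OF sK xc] .
  note EE = subringE[OF E]
  have "subring (\<phi> ` carrier A) F" using \<phi>.img_is_subring[OF A.carrier_is_subring] .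
  then show "?E \<subseteq> \<phi> ` carrier A"
    using xs S(1) by (intro F.finite_extension_subring_incl) auto
  have incl: "\<sigma> ` carrier K \<subseteq> ?E" using F.finite_extension_incl[OF subringE(1)[OF sK] xc] .
  let ?T = "{a \<in> carrier A. \<phi> a \<in> ?E}"
  have "generated_subalgebra K A S \<subseteq> ?T"
  proof (rule generated_subalgebra_subset(3))
    show "S \<subseteq> ?T" using S(1) xs F.finite_extension_mem[OF sK xc] by blast
    show "\<one> \<in> ?T" using EE(3) by simp
  next
    fix a b assume "a \<in> ?T" "b \<in> ?T"
    then show "a \<oplus> b \<in> ?T" "a \<otimes> b \<in> ?T" using EE(6,7) by auto
  next
    fix r a assume r: "r \<in> carrier K" "a \<in> ?T"
    then have "\<phi> (r \<odot> a) = \<sigma> r \<otimes>\<^bsub>F\<^esub> \<phi> a" using smult_eq_mult[of r a] by simp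
    moreover have "\<sigma> r \<in> ?E" using r incl by blast
    ultimately show "r \<odot> a \<in> ?T" using r EE(6) by simp
  qed auto
  then show "\<phi> ` carrier A \<subseteq> ?E" using S(2) by auto
qed

lemma maximal_and_algebraic:
  assumes fg: "finitely_generated_algebra K A" and f: "f \<in> carrier A" "f \<notin> P"
    and dp: "\<And>r. r \<in> carrier A - P \<Longrightarrow> \<exists>n::nat. \<exists>s \<in> carrier A. f [^] n \<ominus> r \<otimes> s \<in> P"
  shows "maximalideal P A" "\<And>y. y \<in> carrier A \<Longrightarrow> (F.algebraic over (\<sigma> ` carrier K)) (\<phi> y)"
proof -
  obtain S where S: "finite S" "S \<subseteq> carrier A" "generated_subalgebra K A S = carrier A"
    using fg unfolding finitely_generated_algebra_def by blast
  obtain xs where xs: "set xs = \<phi> ` S" using finite_list[of "\<phi> ` S"] S(1) by blast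
  let ?E = "F.finite_extension (\<sigma> ` carrier K) xs"
  have E: "?E = \<phi> ` carrier A" using image_eq_finite_extension[OF S(2,3) xs] .
  have xc: "set xs \<subseteq> carrier F" using xs S(2) by auto
  have "F.divides_power ?E (\<phi> f)"
    unfolding F.divides_power_def
  proof (intro conjI ballI)
    show "\<phi> f \<in> ?E - {\<zero>\<^bsub>F\<^esub>}" unfolding E using f phi_eq_zero by simp
    fix r assume "r \<in> ?E - {\<zero>\<^bsub>F\<^esub>}"
    then obtain a where a: "a \<in> carrier A" "r = \<phi> a" "a \<notin> P" unfolding E using phi_eq_zero by auto
    then obtain n :: nat and s where s: "s \<in> carrier A" "f [^] n \<ominus> a \<otimes> s \<in> P" using dp[of a] by blast
    have "\<phi> (f [^] n \<ominus> a \<otimes> s) = \<zero>\<^bsub>F\<^esub>" using s a f phi_eq_zero by simp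
    then have "\<phi> f [^]\<^bsub>F\<^esub> n \<ominus>\<^bsub>F\<^esub> r \<otimes>\<^bsub>F\<^esub> \<phi> s = \<zero>\<^bsub>F\<^esub>"
      using s(1) a f \<phi>.hom_nat_pow by (simp add: a_minus_def)
    then have "r \<otimes>\<^bsub>F\<^esub> \<phi> s = \<phi> f [^]\<^bsub>F\<^esub> n" using s(1) a f F.r_right_minus_eq by simp
    then show "\<exists>n::nat. \<exists>s\<in>?E. r \<otimes>\<^bsub>F\<^esub> s = \<phi> f [^]\<^bsub>F\<^esub> n" unfolding E using s(1) by blast
  qed
  then have sub: "subfield ?E F" "F.finite_dimension (\<sigma> ` carrier K) ?E"
    using F.divides_power_imp_subfield[OF scalars_subfield xc] by auto
  show "(F.algebraic over (\<sigma> ` carrier K)) (\<phi> y)" if "y \<in> carrier A" for y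
    using F.finite_dimension_imp_algebraic[OF scalars_subfield subfieldE(1)[OF sub(1)] sub(2)] that E by simp
  show "maximalideal P A"
  proof (rule maximalidealI[OF P.is_ideal P.I_notcarr])
    fix J assume J: "ideal J A" "P \<subseteq> J" "J \<subseteq> carrier A"
    show "J = P \<or> J = carrier A"
    proof (rule disjCI)
      assume "J \<noteq> carrier A"
      show "J = P"
      proof (rule ccontr)
        assume "J \<noteq> P"
        then obtain j where j: "j \<in> J" "j \<notin> P" "j \<in> carrier A" using J by blast
        have "\<phi> j \<in> ?E - {\<zero>\<^bsub>F\<^esub>}" unfolding E using j phi_eq_zero by simp
        then have "inv\<^bsub>F\<^esub> \<phi> j \<in> ?E" "\<phi> j \<otimes>\<^bsub>F\<^esub> inv\<^bsub>F\<^esub> \<phi> j = \<one>\<^bsub>F\<^esub>"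
          using F.subfield_m_inv[OF sub(1)] by auto
        then obtain k where k: "k \<in> carrier A" "\<phi> j \<otimes>\<^bsub>F\<^esub> \<phi> k = \<one>\<^bsub>F\<^esub>" unfolding E by auto
        then have "\<phi> (\<one> \<ominus> j \<otimes> k) = \<zero>\<^bsub>F\<^esub>" using j by (simp add: a_minus_def F.r_neg)
        then have "\<one> \<ominus> j \<otimes> k \<in> J" using phi_eq_zero j k J(2) by auto
        moreover have "j \<otimes> k \<in> J" using ideal.I_r_closed[OF J(1)] j k by simp
        ultimately have "(\<one> \<ominus> j \<otimes> k) \<oplus> j \<otimes> k \<in> J"
          using additive_subgroup.a_closed[OF ideal.axioms(1)[OF J(1)]] by blast
        moreover have "(\<one> \<ominus> j \<otimes> k) \<oplus> j \<otimes> k = \<one>" using j(3) k(1) by algebra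
        ultimately have "J = carrier A" using ideal.one_imp_carrier[OF J(1)] by simp
        then show False using \<open>J \<noteq> carrier A\<close> by blast
      qed
    qed
  qed
qed

end

context poisson_algebra begin

lemma exists_maximal_missing:
  assumes fg: "finitely_generated_algebra K A" and I: "primeideal I A" and f: "f \<in> carrier A" "f \<notin> I"
  obtains M where "maximalideal M A" "I \<subseteq> M" "f \<notin> M"
proof -
  have "f [^] n \<notin> I" for n :: nat using A.primeideal_power[OF I f(1)] f(2) by blast
  then obtain P where P: "primeideal P A" "I \<subseteq> P" "f \<notin> P"
    "\<And>r. r \<in> carrier A - P \<Longrightarrow> \<exists>n::nat. \<exists>s \<in> carrier A. f [^] n \<ominus> r \<otimes> s \<in> P"
    using A.prime_missing_powers[OF primeideal.axioms(1)[OF I] f(1)] by metis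
  interpret residue K A P unfolding residue_def using poisson_algebra_axioms P(1) by blast
  show thesis using that maximal_and_algebraic(1)[OF fg f(1) P(3,4)] P(2,3) by blast
qed

lemma algebraic_mod_maximal:
  assumes fg: "finitely_generated_algebra K A" and M: "maximalideal M A"
    and yu: "y \<in> carrier A" "u \<in> carrier A - M"
  shows "\<exists>p. set p \<subseteq> carrier K \<and> (\<exists>c \<in> set p. c \<noteq> \<zero>\<^bsub>K\<^esub>) \<and> homog_eval A p y u \<in> M"
proof -
  interpret M: maximalideal M A by fact
  have prime: "primeideal M A" using A.maximalideal_prime[OF M] .
  interpret residue K A M unfolding residue_def using poisson_algebra_axioms prime by blast
  have inv: "\<exists>s \<in> carrier A. \<one> \<ominus> r \<otimes> s \<in> M" if r: "r \<in> carrier A - M" for r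
  proof -
    obtain L where L: "ideal L A" "M \<subseteq> L" "r \<in> L"
      "\<And>x. x \<in> L \<Longrightarrow> \<exists>s \<in> carrier A. x \<ominus> r \<otimes> s \<in> M"
      using A.ideal_add_element[OF M.is_ideal, of r] r by blast
    then have "L = carrier A"
      using M.I_maximal[OF L(1)] r additive_subgroup.a_subset[OF ideal.axioms(1)[OF L(1)]] by blast
    then show ?thesis using L(4) by blast
  qed
  have "\<exists>n::nat. \<exists>s \<in> carrier A. \<one> [^] n \<ominus> r \<otimes> s \<in> M" if r: "r \<in> carrier A - M" for r
    using inv[OF r] by simp
  moreover have "\<one> \<notin> M" using M.one_imp_carrier M.I_notcarr by blast
  ultimately have alg: "(F.algebraic over (\<sigma> ` carrier K)) (\<phi> x)" if "x \<in> carrier A" for x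
    using maximal_and_algebraic(2)[OF fg A.one_closed] that by blast
  obtain v where v: "v \<in> carrier A" "\<one> \<ominus> u \<otimes> v \<in> M" using inv[OF yu(2)] by blast
  have uc: "u \<in> carrier A" using yu by blast
  have "\<phi> (\<one> \<ominus> u \<otimes> v) = \<zero>\<^bsub>F\<^esub>" using phi_eq_zero v uc by simp
  then have uv: "\<phi> u \<otimes>\<^bsub>F\<^esub> \<phi> v = \<one>\<^bsub>F\<^esub>" using v uc F.r_right_minus_eq[of "\<one>\<^bsub>F\<^esub>" "\<phi> u \<otimes>\<^bsub>F\<^esub> \<phi> v"] by (simp add: a_minus_def)
  have "\<phi> y = \<phi> (y \<otimes> v) \<otimes>\<^bsub>F\<^esub> \<phi> u"
    using uv v uc yu by (simp add: F.m_assoc F.m_comm[of "\<phi> v"])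
  moreover have "u \<notin> M" "\<phi> (y \<otimes> v) \<in> carrier F" using yu v(1) by auto
  moreover have "(F.algebraic over (\<sigma> ` carrier K)) (\<phi> (y \<otimes> v))" using alg yu v(1) by blast
  ultimately show ?thesis using algebraic_iff_homog_eval[OF yu(1) uc, THEN iffD1] by blast
qed

end

section \<open>Poisson primes and locally closed points\<close>

lemma (in ideal) add_mem_cancel:
  assumes "x \<in> I" "y \<in> carrier R" "x \<oplus> y \<in> I"
  shows "y \<in> I"
proof -
  have "\<ominus> x \<oplus> (x \<oplus> y) \<in> I"
    using additive_subgroup.a_closed[OF additive_subgroup_axioms] additive_subgroup.a_inv_closed[OF additive_subgroup_axioms]
      assms by blast
  then show ?thesis using assms Icarr r_neg1 by simp
qed

lemma (in ring) add_pow_mem: "x \<in> carrier R \<Longrightarrow> [(n::nat)] \<cdot> x \<in> carrier R"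
  by simp

context poisson_algebra begin

lemma bracket_zero [simp]: "a \<in> carrier A \<Longrightarrow> \<lbrace>a, \<zero>\<rbrace> = \<zero>" "a \<in> carrier A \<Longrightarrow> \<lbrace>\<zero>, a\<rbrace> = \<zero>"
  using bracket_smult_right[of "\<zero>\<^bsub>K\<^esub>" a a] bracket_smult_left[of "\<zero>\<^bsub>K\<^esub>" a a] bracket_closed by auto

lemma bracket_minus_right: "\<lbrakk>a \<in> carrier A; b \<in> carrier A\<rbrakk> \<Longrightarrow> \<lbrace>a, \<ominus> b\<rbrace> = \<ominus> \<lbrace>a, b\<rbrace>"
  using bracket_add_right[of a b "\<ominus> b"] bracket_closed[of a b] bracket_closed[of a "\<ominus> b"]
  by (simp add: A.M.r_neg) (metis A.M.minus_equality A.M.a_comm)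

lemma bracket_minus_left: "\<lbrakk>a \<in> carrier A; b \<in> carrier A\<rbrakk> \<Longrightarrow> \<lbrace>\<ominus> a, b\<rbrace> = \<ominus> \<lbrace>a, b\<rbrace>"
  using bracket_minus_right[of b a] bracket_antisym[of "\<ominus> a" b] bracket_antisym[of a b]
    bracket_closed by simp

lemma bracket_diff:
  "\<lbrakk>a \<in> carrier A; b \<in> carrier A; c \<in> carrier A\<rbrakk> \<Longrightarrow> \<lbrace>a, b \<ominus> c\<rbrace> = \<lbrace>a, b\<rbrace> \<ominus> \<lbrace>a, c\<rbrace>"
  "\<lbrakk>a \<in> carrier A; b \<in> carrier A; c \<in> carrier A\<rbrakk> \<Longrightarrow> \<lbrace>b \<ominus> c, a\<rbrace> = \<lbrace>b, a\<rbrace> \<ominus> \<lbrace>c, a\<rbrace>"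
  by (simp_all add: a_minus_def bracket_add_right bracket_add_left bracket_minus_right bracket_minus_left)

lemma bracket_scalar: "\<lbrakk>r \<in> carrier K; a \<in> carrier A\<rbrakk> \<Longrightarrow> \<lbrace>r \<odot> \<one>, a\<rbrace> = \<zero>"
  using bracket_antisym[of \<one> a] bracket_one[of a] by (simp add: bracket_smult_left)

lemma add_pow_smult: "x \<in> carrier A \<Longrightarrow> [(n::nat)] \<cdot> x = ([n] \<cdot>\<^bsub>K\<^esub> \<one>\<^bsub>K\<^esub>) \<odot> x"
  by (induction n) (auto simp: smult_l_distr)

lemma char_zero_divide:
  assumes "char_zero K" "ideal I A" "x \<in> carrier A" "[Suc n] \<cdot> x \<in> I"
  shows "x \<in> I"
proof -
  let ?r = "[Suc n] \<cdot>\<^bsub>K\<^esub> \<one>\<^bsub>K\<^esub>"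
  have r: "?r \<in> carrier K" "?r \<noteq> \<zero>\<^bsub>K\<^esub>" using assms(1) unfolding char_zero_def by auto
  then have i: "inv\<^bsub>K\<^esub> ?r \<in> carrier K" "inv\<^bsub>K\<^esub> ?r \<otimes>\<^bsub>K\<^esub> ?r = \<one>\<^bsub>K\<^esub>" using K.field_Units by auto
  have "?r \<odot> x \<in> I" using assms(4) unfolding add_pow_smult[OF assms(3)] .
  then have "inv\<^bsub>K\<^esub> ?r \<odot> (?r \<odot> x) \<in> I" by (rule smult_closed_ideal[OF assms(2) i(1)])
  then show ?thesis using smult_assoc1[OF i(1) r(1) assms(3)] i(2) assms(3) by simp
qed

lemma bracket_power:
  assumes "c \<in> carrier A" "x \<in> carrier A"
  shows "\<lbrace>c, x [^] Suc m\<rbrace> = [Suc m] \<cdot> (x [^] m \<otimes> \<lbrace>c, x\<rbrace>)"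
proof (induction m)
  case 0 then show ?case using assms bracket_closed by simp
next
  case (Suc m)
  define d y where "d = \<lbrace>c, x\<rbrace>" "y = x [^] m"
  have cl: "d \<in> carrier A" "y \<in> carrier A" using assms bracket_closed by (auto simp: d_y_def)
  have "\<lbrace>c, x [^] Suc (Suc m)\<rbrace> = x [^] Suc m \<otimes> d \<oplus> \<lbrace>c, x [^] Suc m\<rbrace> \<otimes> x"
    unfolding d_y_def(1) using assms bracket_leibniz_right[of c "x [^] Suc m" x] by simp
  also have "\<lbrace>c, x [^] Suc m\<rbrace> \<otimes> x = [Suc m] \<cdot> ((y \<otimes> d) \<otimes> x)"
    unfolding Suc.IH d_y_def[symmetric] using cl assms by (intro A.add_pow_ldistr) auto
  also have "(y \<otimes> d) \<otimes> x = x [^] Suc m \<otimes> d"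
    using cl assms by (simp add: A.m_ac d_y_def(2)[symmetric])
  finally show ?case using cl assms by (simp add: d_y_def A.M.a_comm)
qed

lemma mult_bracket_power:
  assumes "c \<in> carrier A" "d \<in> carrier A"
  shows "\<exists>y \<in> carrier A. d \<otimes> \<lbrace>c, d [^] (m::nat)\<rbrace> = d [^] m \<otimes> y"
proof (cases m)
  case 0
  then show ?thesis using assms bracket_one by (auto intro!: bexI[of _ \<zero>])
next
  case (Suc k)
  define b where "b = \<lbrace>c, d\<rbrace>"
  have b: "b \<in> carrier A" using assms bracket_closed by (simp add: b_def)
  have "d \<otimes> ([j] \<cdot> (d [^] k \<otimes> b)) = (d [^] k \<otimes> d) \<otimes> ([j] \<cdot> b)" for j :: nat
    using assms b by (simp add: A.add_pow_rdistr A.m_ac)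
  then have "d \<otimes> \<lbrace>c, d [^] m\<rbrace> = d [^] m \<otimes> ([Suc k] \<cdot> b)"
    unfolding Suc bracket_power[OF assms] b_def[symmetric] unfolding A.nat_pow_Suc by blast
  then show ?thesis using b by blast
qed

lemma power_bracket_mem:
  assumes ch: "char_zero K" and Q: "poisson_ideal Q A" and a: "a \<in> carrier A" "c \<in> carrier A" "a [^] n \<in> Q"
    and k: "k \<le> n"
  shows "a [^] (n - k) \<otimes> \<lbrace>c, a\<rbrace> [^] (2 * k :: nat) \<in> Q"
  using k
proof (induction k)
  case 0
  then show ?case using a by simp
next
  case (Suc k)
  interpret Q: ideal Q A using Q by (simp add: poisson_ideal_def)
  define d where "d = \<lbrace>c, a\<rbrace>"
  define w where "w = d [^] (2 * k)"
  obtain j where j: "n - k = Suc j" "n - Suc k = j" using Suc.prems by (metis Suc_diff_Suc Suc_le_eq)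
  have d: "d \<in> carrier A" "w \<in> carrier A" using a bracket_closed by (auto simp: d_def w_def)
  have bw: "\<lbrace>c, w\<rbrace> \<in> carrier A" using a d bracket_closed by simp
  obtain y where y: "y \<in> carrier A" "d \<otimes> \<lbrace>c, w\<rbrace> = w \<otimes> y"
    using mult_bracket_power[OF a(2) d(1), of "2 * k"] unfolding w_def by blast
  define s t where "s = a [^] Suc j" "t = a [^] j"
  have st: "s \<in> carrier A" "t \<in> carrier A" using a by (auto simp: s_t_def)
  have IH: "s \<otimes> w \<in> Q" using Suc j by (simp add: w_def d_def s_t_def)
  have "\<lbrace>c, s \<otimes> w\<rbrace> \<in> Q" using poisson_ideal_bracket[OF Q a(2) IH] by simp
  then have "d \<otimes> \<lbrace>c, s \<otimes> w\<rbrace> \<in> Q" using d Q.I_l_closed by simp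
  moreover have "d \<otimes> \<lbrace>c, s \<otimes> w\<rbrace> = (s \<otimes> w) \<otimes> y \<oplus> [Suc j] \<cdot> (t \<otimes> (w \<otimes> d \<otimes> d))"
  proof -
    have d2: "d \<otimes> (([i] \<cdot> (t \<otimes> d)) \<otimes> w) = [i] \<cdot> (t \<otimes> (w \<otimes> d \<otimes> d))" for i :: nat
      using st d by (simp add: A.add_pow_ldistr A.add_pow_rdistr A.m_ac)
    have "d \<otimes> \<lbrace>c, s \<otimes> w\<rbrace> = s \<otimes> (d \<otimes> \<lbrace>c, w\<rbrace>) \<oplus> d \<otimes> (\<lbrace>c, s\<rbrace> \<otimes> w)"
      using d st a bw bracket_closed[of c s]
      by (simp add: bracket_leibniz_right A.r_distr A.m_lcomm)
    also have "s \<otimes> (d \<otimes> \<lbrace>c, w\<rbrace>) = (s \<otimes> w) \<otimes> y" unfolding y(2) using st d y by (simp add: A.m_assoc)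
    also have "d \<otimes> (\<lbrace>c, s\<rbrace> \<otimes> w) = [Suc j] \<cdot> (t \<otimes> (w \<otimes> d \<otimes> d))"
      unfolding s_t_def(1) bracket_power[OF a(2,1)] d_def[symmetric] s_t_def(2)[symmetric] by (rule d2)
    finally show ?thesis .
  qed
  moreover have "(s \<otimes> w) \<otimes> y \<in> Q" using Q.I_r_closed IH y by simp
  ultimately have "[Suc j] \<cdot> (t \<otimes> (w \<otimes> d \<otimes> d)) \<in> Q"
    using Q.add_mem_cancel[OF _ A.add_pow_mem] st d by (metis A.m_closed)
  then have "t \<otimes> (w \<otimes> d \<otimes> d) \<in> Q"
    using char_zero_divide[OF ch Q.is_ideal, of "t \<otimes> (w \<otimes> d \<otimes> d)" j] st d by simp
  moreover have "w \<otimes> d \<otimes> d = d [^] (2 * Suc k)" using d by (simp add: w_def)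
  ultimately show ?case by (simp add: j s_t_def d_def)
qed

lemma radical_poisson_ideal:
  assumes ch: "char_zero K" and Q: "poisson_ideal Q A"
  shows "poisson_ideal {a \<in> carrier A. \<exists>n::nat. a [^] n \<in> Q} A"
proof -
  interpret Q: ideal Q A using Q by (simp add: poisson_ideal_def)
  let ?R = "{a \<in> carrier A. \<exists>n::nat. a [^] n \<in> Q}"
  have pw: "a [^] i \<in> Q" if "a [^] m \<in> Q" "m \<le> i" "a \<in> carrier A" for a and m i :: nat
  proof -
    have "a [^] m \<otimes> a [^] (i - m) \<in> Q" using Q.I_r_closed that by simp
    then show ?thesis using that by (simp add: A.nat_pow_mult)
  qed
  have "ideal ?R A"
  proof (rule A.ideal_if_closed)
    have "\<zero> [^] (1::nat) \<in> Q" by simp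
    then show "\<zero> \<in> ?R" by blast
  next
    fix a b assume "a \<in> ?R" "b \<in> ?R"
    then obtain m n :: nat where ab: "a \<in> carrier A" "b \<in> carrier A" "a [^] m \<in> Q" "b [^] n \<in> Q" by blast
    have "m + n \<le> i + j + k \<Longrightarrow> a [^] i \<otimes> b [^] j \<otimes> (a \<oplus> b) [^] k \<in> Q" for i j k :: nat
    proof (induction k arbitrary: i j)
      case 0
      then have "m \<le> i \<or> n \<le> j" by linarith
      then have "a [^] i \<otimes> b [^] j \<in> Q"
        using pw[OF ab(3) _ ab(1)] pw[OF ab(4) _ ab(2)] Q.I_r_closed Q.I_l_closed ab by auto
      then show ?case using ab by simp
    next
      case (Suc k)
      define u v w where "u = a [^] i" "v = b [^] j" "w = (a \<oplus> b) [^] k"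
      have uvw: "u \<in> carrier A" "v \<in> carrier A" "w \<in> carrier A" using ab by (auto simp: u_v_w_def)
      have "a [^] Suc i \<otimes> b [^] j \<otimes> (a \<oplus> b) [^] k \<in> Q" "a [^] i \<otimes> b [^] Suc j \<otimes> (a \<oplus> b) [^] k \<in> Q"
        using Suc.IH[of "Suc i" j] Suc.IH[of i "Suc j"] Suc.prems by auto
      then have m: "(u \<otimes> a) \<otimes> v \<otimes> w \<oplus> u \<otimes> (v \<otimes> b) \<otimes> w \<in> Q" using Q.a_closed by (simp add: u_v_w_def)
      have "u \<otimes> v \<otimes> (w \<otimes> (a \<oplus> b)) = (u \<otimes> a) \<otimes> v \<otimes> w \<oplus> u \<otimes> (v \<otimes> b) \<otimes> w"
        using uvw ab(1,2) by algebra
      then show ?case using m by (simp add: u_v_w_def)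
    qed
    from this[of 0 0 "m + n"] have "(a \<oplus> b) [^] (m + n) \<in> Q" using ab by simp
    then show "a \<oplus> b \<in> ?R" using ab by blast
  next
    fix a x assume a: "a \<in> carrier A" "x \<in> ?R"
    then obtain n :: nat where n: "x [^] n \<in> Q" "x \<in> carrier A" by blast
    then have "(a \<otimes> x) [^] n \<in> Q" using a Q.I_l_closed by (simp add: A.nat_pow_distrib)
    then show "a \<otimes> x \<in> ?R" using a n by blast
  qed auto
  moreover have "\<lbrace>c, a\<rbrace> \<in> ?R" if ca: "c \<in> carrier A" "a \<in> ?R" for c a
  proof -
    obtain n :: nat where n: "a [^] n \<in> Q" "a \<in> carrier A" using ca by blast
    have "\<lbrace>c, a\<rbrace> [^] (2 * n) \<in> Q"
      using power_bracket_mem[OF ch Q n(2) ca(1) n(1), of n] ca n bracket_closed by simp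
    then show ?thesis using ca bracket_closed by blast
  qed
  ultimately show ?thesis by (simp add: poisson_ideal_def)
qed

lemma radical_annihilator:
  assumes Q: "poisson_ideal Q A" and rad: "\<And>x. \<lbrakk>x \<in> carrier A; x \<otimes> x \<in> Q\<rbrakk> \<Longrightarrow> x \<in> Q" and a: "a \<in> carrier A"
  shows "poisson_ideal {x \<in> carrier A. a \<otimes> x \<in> Q} A" "Q \<subseteq> {x \<in> carrier A. a \<otimes> x \<in> Q}"
proof -
  interpret Q: ideal Q A using Q by (simp add: poisson_ideal_def)
  let ?R = "{x \<in> carrier A. a \<otimes> x \<in> Q}"
  have "ideal ?R A"
    using a Q.a_closed Q.I_l_closed by (intro A.ideal_if_closed) (auto simp: A.r_distr A.m_lcomm)
  moreover have "\<lbrace>c, x\<rbrace> \<in> ?R" if cx: "c \<in> carrier A" "x \<in> ?R" for c x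
  proof -
    define d e where "d = \<lbrace>c, x\<rbrace>" "e = \<lbrace>c, a\<rbrace>"
    have cl: "d \<in> carrier A" "e \<in> carrier A" "x \<in> carrier A" using cx a bracket_closed by (auto simp: d_e_def)
    have ax: "a \<otimes> x \<in> Q" using cx by blast
    have "\<lbrace>c, a \<otimes> x\<rbrace> \<in> Q" using poisson_ideal_bracket[OF Q cx(1) ax] by simp
    then have "a \<otimes> d \<oplus> e \<otimes> x \<in> Q" using cx a by (simp add: bracket_leibniz_right d_e_def)
    then have "(a \<otimes> d) \<otimes> (a \<otimes> d \<oplus> e \<otimes> x) \<ominus> (d \<otimes> e) \<otimes> (a \<otimes> x) \<in> Q"
      using Q.I_l_closed ax a cl Q.a_closed Q.a_inv_closed by (simp add: a_minus_def)
    moreover have "(a \<otimes> d) \<otimes> (a \<otimes> d \<oplus> e \<otimes> x) \<ominus> (d \<otimes> e) \<otimes> (a \<otimes> x) = (a \<otimes> d) \<otimes> (a \<otimes> d)"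
      using a cl by algebra
    ultimately show ?thesis using rad[of "a \<otimes> d"] a cl by (simp add: d_e_def)
  qed
  ultimately show "poisson_ideal ?R A" by (simp add: poisson_ideal_def)
  show "Q \<subseteq> ?R" using a Q.I_l_closed Q.Icarr by blast
qed

lemma exists_poisson_prime_missing:
  assumes ch: "char_zero K" and J: "poisson_ideal J A" and f: "f \<in> carrier A" "\<And>n::nat. f [^] n \<notin> J"
  obtains Q where "Q \<in> poisson_spec A" "J \<subseteq> Q" "f \<notin> Q"
proof -
  let ?Z = "\<lambda>J. \<forall>a \<in> carrier A. \<forall>x \<in> J. \<lbrace>a, x\<rbrace> \<in> J"
  have "\<exists>Q. ideal Q A \<and> ?Z Q \<and> J \<subseteq> Q \<and> (\<forall>n::nat. f [^] n \<notin> Q) \<and>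
    (\<forall>L. ideal L A \<and> ?Z L \<and> Q \<subseteq> L \<and> (\<forall>n::nat. f [^] n \<notin> L) \<longrightarrow> L = Q)"
  proof (rule A.maximal_missing_powers[of J ?Z f])
    show "ideal J A" "?Z J" using J by (auto simp: poisson_ideal_def)
    show "\<And>n::nat. f [^] n \<notin> J" by fact
    show "?Z (\<Union>C)" if "subset.chain {J. ideal J A \<and> ?Z J} C" "C \<noteq> {}" for C
      using that unfolding subset.chain_def by blast
  qed blast
  then obtain Q where Q: "ideal Q A" "?Z Q" "J \<subseteq> Q" and fn: "\<And>n::nat. f [^] n \<notin> Q"
    and max: "\<And>L. \<lbrakk>ideal L A; ?Z L; Q \<subseteq> L; \<And>n::nat. f [^] n \<notin> L\<rbrakk> \<Longrightarrow> L = Q"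
    by metis
  interpret Q: ideal Q A by fact
  have pQ: "poisson_ideal Q A" using Q by (simp add: poisson_ideal_def)
  have max': "L = Q" if "poisson_ideal L A" "Q \<subseteq> L" "\<And>n::nat. f [^] n \<notin> L" for L
    using max[of L] that unfolding poisson_ideal_def by blast
  have "{a \<in> carrier A. \<exists>n::nat. a [^] n \<in> Q} = Q"
  proof (rule max'[OF radical_poisson_ideal[OF ch pQ]])
    have "x [^] (1::nat) \<in> Q" if "x \<in> Q" for x using that Q.Icarr by simp
    then show "Q \<subseteq> {a \<in> carrier A. \<exists>n::nat. a [^] n \<in> Q}" using Q.Icarr by blast
    show "f [^] n \<notin> {a \<in> carrier A. \<exists>n::nat. a [^] n \<in> Q}" for n :: nat
      using fn f(1) by (auto simp: A.nat_pow_pow)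
  qed
  then have rad: "x \<in> Q" if "x \<in> carrier A" "x [^] (n::nat) \<in> Q" for x n using that by blast
  have rad2: "x \<in> Q" if "x \<in> carrier A" "x \<otimes> x \<in> Q" for x
    using rad[of x 2] that by (simp add: numeral_2_eq_2)
  have ann: "\<exists>n::nat. a \<otimes> f [^] n \<in> Q" if ab: "a \<in> carrier A" "b \<in> carrier A" "a \<otimes> b \<in> Q" "b \<notin> Q" for a b
  proof (rule ccontr)
    assume "\<not> ?thesis"
    then have "{x \<in> carrier A. a \<otimes> x \<in> Q} = Q"
      using radical_annihilator[OF pQ rad2 ab(1)] by (intro max') blast+
    then show False using ab by blast
  qed
  have "primeideal Q A"
  proof (rule primeidealI[OF Q(1) A.is_cring])
    show "carrier A \<noteq> Q" using fn[of 0] by auto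
    fix a b assume ab: "a \<in> carrier A" "b \<in> carrier A" "a \<otimes> b \<in> Q"
    show "a \<in> Q \<or> b \<in> Q"
    proof (rule ccontr)
      assume n: "\<not> ?thesis"
      then obtain n :: nat where "a \<otimes> f [^] n \<in> Q" using ann ab by blast
      then have "f [^] n \<otimes> a \<in> Q" using A.m_comm[of a "f [^] n"] ab f by simp
      then obtain m :: nat where "f [^] n \<otimes> f [^] m \<in> Q" using ann[of "f [^] n" a] n ab f by auto
      then show False using fn f by (simp add: A.nat_pow_mult)
    qed
  qed
  then show thesis using that[of Q] pQ Q(3) fn[of 1] f(1) by (simp add: poisson_spec_def)
qed

end

lemma openin_zariski:
  "openin (zariski R) U \<longleftrightarrow> (\<exists>S \<subseteq> carrier R. U = spec R - {P \<in> spec R. S \<subseteq> P})"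
  unfolding zariski_def topology_inverse'[OF istopology_zariski] ..

lemma topspace_zariski: "topspace (zariski R) = spec R"
proof
  show "topspace (zariski R) \<subseteq> spec R"
    unfolding topspace_def openin_zariski by blast
  have "P \<in> spec R - {P \<in> spec R. carrier R \<subseteq> P}" if "P \<in> spec R" for P
  proof -
    interpret primeideal P R using that by (simp add: spec_def)
    show ?thesis using that I_notcarr a_subset by blast
  qed
  then have "spec R = spec R - {P \<in> spec R. carrier R \<subseteq> P}" by blast
  then have "openin (zariski R) (spec R)" unfolding openin_zariski by blast
  then show "spec R \<subseteq> topspace (zariski R)" by (rule openin_subset)
qed

lemma poisson_locally_closed_iff:
  assumes I: "I \<in> poisson_spec A"
  shows "poisson_locally_closed A I \<longleftrightarrow>
    (\<exists>f \<in> carrier A - I. \<forall>P \<in> poisson_spec A. I \<subseteq> P \<and> P \<noteq> I \<longrightarrow> f \<in> P)"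
proof -
  have sp: "poisson_spec A \<subseteq> spec A" by (auto simp: poisson_spec_def spec_def)
  have ts: "topspace (poisson_spec_topology A) = poisson_spec A"
    using sp by (auto simp: poisson_spec_topology_def topspace_zariski)
  have op: "openin (poisson_spec_topology A) U \<longleftrightarrow>
     (\<exists>S \<subseteq> carrier A. U = {P \<in> poisson_spec A. \<not> S \<subseteq> P})" for U
    unfolding poisson_spec_topology_def openin_subtopology openin_zariski using sp by blast
  have Ic: "I \<subseteq> carrier A"
    using I by (auto simp: poisson_spec_def intro: additive_subgroup.a_Hcarr[OF ideal.axioms(1)[OF primeideal.axioms(1)]])
  show ?thesis
  proof
    assume "poisson_locally_closed A I"
    then obtain U C where U: "openin (poisson_spec_topology A) U"
      and C: "closedin (poisson_spec_topology A) C" and UC: "{I} = U \<inter> C"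
      unfolding poisson_locally_closed_def locally_closed_in_def by blast
    obtain S where S: "S \<subseteq> carrier A" "U = {P \<in> poisson_spec A. \<not> S \<subseteq> P}" using U op by blast
    obtain T where T: "poisson_spec A - C = {P \<in> poisson_spec A. \<not> T \<subseteq> P}"
      using C unfolding closedin_def ts op by blast
    have "\<not> S \<subseteq> I" "T \<subseteq> I" using UC S T I by blast+
    then obtain f where f: "f \<in> S" "f \<notin> I" by blast
    have "f \<in> P" if "P \<in> poisson_spec A" "I \<subseteq> P" "P \<noteq> I" for P
    proof -
      have "P \<in> C" using T \<open>T \<subseteq> I\<close> that by blast
      then have "P \<notin> U" using UC that by blast
      then show ?thesis using S f that by blast
    qed
    then show "\<exists>f \<in> carrier A - I. \<forall>P \<in> poisson_spec A. I \<subseteq> P \<and> P \<noteq> I \<longrightarrow> f \<in> P" using f S by blast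
  next
    assume "\<exists>f \<in> carrier A - I. \<forall>P \<in> poisson_spec A. I \<subseteq> P \<and> P \<noteq> I \<longrightarrow> f \<in> P"
    then obtain f where f: "f \<in> carrier A" "f \<notin> I" "\<And>P. \<lbrakk>P \<in> poisson_spec A; I \<subseteq> P; P \<noteq> I\<rbrakk> \<Longrightarrow> f \<in> P"
      by blast
    let ?U = "{P \<in> poisson_spec A. \<not> {f} \<subseteq> P}" and ?C = "{P \<in> poisson_spec A. I \<subseteq> P}"
    have "openin (poisson_spec_topology A) ?U" unfolding op using f(1) by blast
    moreover have "poisson_spec A - ?C = {P \<in> poisson_spec A. \<not> I \<subseteq> P}" by blast
    then have "closedin (poisson_spec_topology A) ?C" unfolding closedin_def ts op using Ic by blast
    moreover have "{I} = ?U \<inter> ?C" using f I by blast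
    ultimately show "poisson_locally_closed A I"
      unfolding poisson_locally_closed_def locally_closed_in_def by blast
  qed
qed

context poisson_algebra begin

lemma locally_closed_imp_primitive:
  assumes ch: "char_zero K" and fg: "finitely_generated_algebra K A" and I: "I \<in> poisson_spec A"
    and lc: "poisson_locally_closed A I"
  shows "poisson_primitive A I"
proof -
  have prime: "primeideal I A" and pI: "poisson_ideal I A" using I by (auto simp: poisson_spec_def)
  interpret I: primeideal I A by fact
  obtain f where f: "f \<in> carrier A" "f \<notin> I"
    and fP: "\<And>P. \<lbrakk>P \<in> poisson_spec A; I \<subseteq> P; P \<noteq> I\<rbrakk> \<Longrightarrow> f \<in> P"
    using lc poisson_locally_closed_iff[OF I] by blast
  obtain M where M: "maximalideal M A" "I \<subseteq> M" "f \<notin> M"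
    using exists_maximal_missing[OF fg prime f] by blast
  interpret M: maximalideal M A by fact
  have "J \<subseteq> I" if J: "poisson_ideal J A" "J \<subseteq> M" for J
  proof -
    interpret J: ideal J A using J by (simp add: poisson_ideal_def)
    let ?L = "{i \<oplus> j | i j. i \<in> I \<and> j \<in> J}"
    have LI: "i \<oplus> j \<in> ?L" if "i \<in> I" "j \<in> J" for i j using that by blast
    have pL: "poisson_ideal ?L A" unfolding poisson_ideal_def
    proof (intro conjI ballI)
      have "?L = set_add A I J" by (auto simp: set_add_def')
      then show "ideal ?L A" using A.add_ideals[OF I.is_ideal J.is_ideal] by (simp only:)
      fix a x assume a: "a \<in> carrier A" "x \<in> ?L"
      then obtain i j where h: "i \<in> I" "j \<in> J" "x = i \<oplus> j" by blast
      then have "\<lbrace>a, x\<rbrace> = \<lbrace>a, i\<rbrace> \<oplus> \<lbrace>a, j\<rbrace>" using a I.Icarr J.Icarr by (simp add: bracket_add_right)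
      then show "\<lbrace>a, x\<rbrace> \<in> ?L"
        using LI[OF poisson_ideal_bracket(1)[OF pI a(1) h(1)] poisson_ideal_bracket(1)[OF J(1) a(1) h(2)]] by simp
    qed
    have "?L \<subseteq> M" using M(2) J(2) M.a_closed by blast
    then have fL: "f [^] n \<notin> ?L" for n :: nat
      using A.primeideal_power[OF A.maximalideal_prime[OF M(1)] f(1)] M(3) by blast
    obtain Q where Q: "Q \<in> poisson_spec A" "?L \<subseteq> Q" "f \<notin> Q"
      by (rule exists_poisson_prime_missing[OF ch pL f(1) fL])
    have "I \<subseteq> ?L"
    proof
      fix i assume "i \<in> I"
      then have "i = i \<oplus> \<zero>" using I.Icarr by simp
      then show "i \<in> ?L" using \<open>i \<in> I\<close> J.zero_closed by blast
    qed
    then have "Q = I" using fP[OF Q(1)] Q by blast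
    moreover have "J \<subseteq> ?L"
    proof
      fix j assume "j \<in> J"
      then have "j = \<zero> \<oplus> j" using J.Icarr by simp
      then show "j \<in> ?L" using \<open>j \<in> J\<close> I.zero_closed by blast
    qed
    ultimately show "J \<subseteq> I" using Q(2) by blast
  qed
  then show ?thesis unfolding poisson_primitive_def using M pI by blast
qed

end

section \<open>Poisson central fractions\<close>

inductive_set monomials :: "('a, 'b) monoid_scheme \<Rightarrow> 'a set \<Rightarrow> 'a set" for G and S where
  one: "\<one>\<^bsub>G\<^esub> \<in> monomials G S"
| mult: "\<lbrakk>u \<in> monomials G S; x \<in> S\<rbrakk> \<Longrightarrow> u \<otimes>\<^bsub>G\<^esub> x \<in> monomials G S"

lemma (in cring) monomials_avoid_prime:
  assumes "primeideal L R" "S \<subseteq> carrier R - L"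
  shows "monomials R S \<subseteq> carrier R - L"
proof
  interpret L: primeideal L R by fact
  fix u assume "u \<in> monomials R S"
  then show "u \<in> carrier R - L"
  proof induction
    case one
    show ?case using L.one_imp_carrier L.I_notcarr by auto
  next
    case (mult u x)
    then show ?case using L.I_prime[of u x] assms(2) by auto
  qed
qed

lemma (in monoid) monomials_mult:
  assumes "S \<subseteq> carrier G" "u \<in> monomials G S" "v \<in> monomials G S"
  shows "u \<otimes> v \<in> monomials G S"
proof -
  have car: "w \<in> carrier G" if "w \<in> monomials G S" for w
    using that by induction (use assms(1) in auto)
  show ?thesis using assms(3)
  proof induction
    case one
    then show ?case using assms(2) car by simp
  next
    case (mult v x)
    then show ?case
      using monomials.mult[OF mult.IH mult.hyps(2)] car[OF assms(2)] car[OF mult.hyps(1)] assms(1)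
      by (simp add: m_assoc subset_iff)
  qed
qed

lemma (in cring) exists_monomial_in_ideals:
  assumes "finite T" "T \<subseteq> S" "S \<subseteq> carrier R"
  shows "\<exists>u \<in> monomials R S. \<forall>L x. ideal L R \<and> x \<in> T \<and> x \<in> L \<longrightarrow> u \<in> L"
  using assms(1,2)
proof (induction T)
  case empty
  then show ?case using monomials.one[of R S] by blast
next
  case (insert y T)
  have car: "w \<in> carrier R" if "w \<in> monomials R S" for w
    using that by induction (use assms(3) in auto)
  obtain u where u: "u \<in> monomials R S" "\<And>L x. \<lbrakk>ideal L R; x \<in> T; x \<in> L\<rbrakk> \<Longrightarrow> u \<in> L"
    using insert by blast
  have y: "y \<in> S" "y \<in> carrier R" using insert assms(3) by auto
  have "u \<otimes> y \<in> L" if "ideal L R" "x \<in> insert y T" "x \<in> L" for L x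
    using that u(2)[of L x] ideal.I_l_closed[OF that(1), of y u] ideal.I_r_closed[OF that(1), of u y] car[OF u(1)] y
    by blast
  then show ?case using monomials.mult[OF u(1) y(1)] by blast
qed

primrec iter_sums :: "('a, 'b) ring_scheme \<Rightarrow> 'a set \<Rightarrow> 'a set \<Rightarrow> nat \<Rightarrow> 'a set" where
  "iter_sums R I G 0 = I"
| "iter_sums R I G (Suc n) = {h \<oplus>\<^bsub>R\<^esub> g | h g. h \<in> iter_sums R I G n \<and> g \<in> G}"

context ring begin

lemma iter_sums_carrier:
  assumes "I \<subseteq> carrier R" "G \<subseteq> carrier R"
  shows "iter_sums R I G n \<subseteq> carrier R"
  using assms by (induction n) auto

lemma iter_sums_map:
  assumes IG: "I \<subseteq> carrier R" "G \<subseteq> carrier R"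
    and D: "\<And>a b. \<lbrakk>a \<in> carrier R; b \<in> carrier R\<rbrakk> \<Longrightarrow> D (a \<oplus> b) = D a \<oplus> D b"
    and DI: "\<And>a. a \<in> I \<Longrightarrow> D a \<in> I" and DG: "\<And>a. a \<in> G \<Longrightarrow> D a \<in> G"
    and x: "x \<in> iter_sums R I G n"
  shows "D x \<in> iter_sums R I G n"
  using x
proof (induction n arbitrary: x)
  case 0
  then show ?case using DI by simp
next
  case (Suc n)
  then obtain h g where h: "h \<in> iter_sums R I G n" "g \<in> G" "x = h \<oplus> g" by auto
  have "D x = D h \<oplus> D g" using D h iter_sums_carrier[OF IG] IG by blast
  then show ?case using Suc.IH[OF h(1)] DG[OF h(2)] by auto
qed

lemma iter_sums_add:
  assumes IG: "I \<subseteq> carrier R" "G \<subseteq> carrier R" and I: "\<And>a b. \<lbrakk>a \<in> I; b \<in> I\<rbrakk> \<Longrightarrow> a \<oplus> b \<in> I"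
    and "x \<in> iter_sums R I G m" "y \<in> iter_sums R I G n"
  shows "x \<oplus> y \<in> iter_sums R I G (m + n)"
proof -
  note c = subsetD[OF iter_sums_carrier[OF IG]]
  have aux: "x \<oplus> i \<in> iter_sums R I G m" if "x \<in> iter_sums R I G m" "i \<in> I" for x i m
    using that(1)
  proof (induction m arbitrary: x)
    case 0 then show ?case using I that by simp
  next
    case (Suc m)
    then obtain h g where h: "h \<in> iter_sums R I G m" "g \<in> G" "x = h \<oplus> g" by auto
    have "x \<oplus> i = (h \<oplus> i) \<oplus> g" unfolding h(3) using c[OF h(1)] h(2) that(2) IG by (simp add: a_ac subset_iff)
    then show ?case using Suc.IH[OF h(1)] h(2) by auto
  qed
  show ?thesis using assms(5)
  proof (induction n arbitrary: y)
    case 0 then show ?case using aux[OF assms(4)] by simp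
  next
    case (Suc n)
    then obtain h g where h: "h \<in> iter_sums R I G n" "g \<in> G" "y = h \<oplus> g" by auto
    have "x \<oplus> y = (x \<oplus> h) \<oplus> g" unfolding h(3) using c[OF h(1)] c[OF assms(4)] h(2) IG by (simp add: a_assoc subset_iff)
    then show ?case using Suc.IH[OF h(1)] h(2) by auto
  qed
qed

end

lemma (in poisson_algebra) homog_eval_append:
  assumes "set q \<subseteq> carrier K" "c \<in> carrier K" "f \<in> carrier A" "u \<in> carrier A"
  shows "homog_eval A (q @ [c]) f u = f \<otimes> homog_eval A q f u \<oplus> c \<odot> (u [^] Suc (length q))"
  using assms(1)
proof (induction q)
  case Nil
  then show ?case using assms(2-4) smult_eq_mult[of c u] by (simp add: A.m_comm)
next
  case (Cons a q)
  define s t h w v where "s = a \<odot> \<one>" "t = c \<odot> \<one>" "h = homog_eval A q f u" "w = f [^] length q" "v = u [^] Suc (length q)"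
  note D = this
  have cl: "s \<in> carrier A" "t \<in> carrier A" "h \<in> carrier A" "w \<in> carrier A" "v \<in> carrier A"
    using Cons.prems assms homog_eval_closed[of q f u] by (auto simp: D)
  have sm: "a \<odot> x = s \<otimes> x" "c \<odot> x = t \<otimes> x" if "x \<in> carrier A" for x
    unfolding D(1,2) by (rule smult_eq_mult; use that Cons.prems assms in simp)+
  have v: "u [^] length q \<otimes> u = v" by (simp add: D)
  have "homog_eval A ((a # q) @ [c]) f u = u \<otimes> (s \<otimes> (w \<otimes> f) \<oplus> (f \<otimes> h \<oplus> t \<otimes> v))"
    using Cons assms cl by (simp add: sm v D(3,4)[symmetric])
  also have "\<dots> = f \<otimes> (u \<otimes> (s \<otimes> w \<oplus> h)) \<oplus> t \<otimes> (v \<otimes> u)"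
    using cl assms(3,4) by algebra
  also have "\<dots> = f \<otimes> homog_eval A (a # q) f u \<oplus> c \<odot> (u [^] Suc (length (a # q)))"
    using assms cl by (simp add: sm v D(3,4)[symmetric])
  finally show ?case .
qed

locale poisson_residue = residue K A P
  for K :: "('k, 'm) ring_scheme" and A :: "('k, 'a, 'n) poisson_scheme" (structure) and P +
  assumes poisson_ideal: "poisson_ideal P A"
begin

lemmas P_bracket = poisson_ideal_bracket[OF poisson_ideal]

lemma P_not_mult: "\<lbrakk>a \<in> carrier A - P; b \<in> carrier A - P\<rbrakk> \<Longrightarrow> a \<otimes> b \<in> carrier A - P"
  using P.I_prime by auto

lemma P_cancel: "\<lbrakk>a \<in> carrier A - P; b \<in> carrier A; a \<otimes> b \<in> P\<rbrakk> \<Longrightarrow> b \<in> P"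
  using P.I_prime by auto

lemma P_diff: "\<lbrakk>a \<in> P; b \<in> P\<rbrakk> \<Longrightarrow> a \<ominus> b \<in> P"
  using P.a_closed P.a_inv_closed by (simp add: a_minus_def)

text \<open>Modulo \<open>P\<close>, membership of \<open>g\<close> in \<open>central_over u\<close> says that \<open>g / u\<close> is Poisson central.\<close>

definition central_over :: "'a \<Rightarrow> 'a set" where
  "central_over u = {g \<in> carrier A. \<forall>b \<in> carrier A. u \<otimes> \<lbrace>g, b\<rbrace> \<ominus> g \<otimes> \<lbrace>u, b\<rbrace> \<in> P}"

lemma central_overD: "\<lbrakk>g \<in> central_over u; b \<in> carrier A\<rbrakk> \<Longrightarrow> u \<otimes> \<lbrace>g, b\<rbrace> \<ominus> g \<otimes> \<lbrace>u, b\<rbrace> \<in> P"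
  by (simp add: central_over_def)

lemma central_over_carrier: "g \<in> central_over u \<Longrightarrow> g \<in> carrier A"
  by (simp add: central_over_def)

lemma central_over_self: "u \<in> carrier A \<Longrightarrow> u \<in> central_over u"
  using bracket_closed by (simp add: central_over_def a_minus_def A.M.r_neg)

lemma central_over_sym:
  assumes "u \<in> carrier A" "g \<in> central_over u"
  shows "u \<in> central_over g"
  unfolding central_over_def
proof (intro CollectI conjI ballI)
  fix b assume b: "b \<in> carrier A"
  define p q where "p = \<lbrace>g, b\<rbrace>" "q = \<lbrace>u, b\<rbrace>"
  have cl: "p \<in> carrier A" "q \<in> carrier A" "g \<in> carrier A"
    using assms b bracket_closed central_over_carrier by (auto simp: p_q_def)
  have "\<ominus> (u \<otimes> p \<ominus> g \<otimes> q) \<in> P"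
    using central_overD[OF assms(2) b] P.a_inv_closed by (simp add: p_q_def)
  also have "\<ominus> (u \<otimes> p \<ominus> g \<otimes> q) = g \<otimes> q \<ominus> u \<otimes> p" using cl assms(1) by algebra
  finally show "g \<otimes> \<lbrace>u, b\<rbrace> \<ominus> u \<otimes> \<lbrace>g, b\<rbrace> \<in> P" by (simp add: p_q_def)
qed (use assms in auto)

lemma ideal_central_over: "\<lbrakk>u \<in> carrier A; g \<in> P\<rbrakk> \<Longrightarrow> g \<in> central_over u"
  unfolding central_over_def
  using P_bracket(2) P.Icarr P_diff P.I_l_closed P.I_r_closed bracket_closed by auto

lemma central_over_add:
  assumes "u \<in> carrier A" "g \<in> central_over u" "h \<in> central_over u"
  shows "g \<oplus> h \<in> central_over u"
  unfolding central_over_def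
proof (intro CollectI conjI ballI)
  have c: "g \<in> carrier A" "h \<in> carrier A" using assms central_over_carrier by auto
  then show "g \<oplus> h \<in> carrier A" by simp
  fix b assume b: "b \<in> carrier A"
  define p q r where "p = \<lbrace>g, b\<rbrace>" "q = \<lbrace>u, b\<rbrace>" "r = \<lbrace>h, b\<rbrace>"
  have cl: "p \<in> carrier A" "q \<in> carrier A" "r \<in> carrier A"
    using assms(1) c b bracket_closed by (auto simp: p_q_r_def)
  have "(u \<otimes> p \<ominus> g \<otimes> q) \<oplus> (u \<otimes> r \<ominus> h \<otimes> q) \<in> P"
    using central_overD[OF assms(2) b] central_overD[OF assms(3) b] P.a_closed by (simp add: p_q_r_def)
  also have "(u \<otimes> p \<ominus> g \<otimes> q) \<oplus> (u \<otimes> r \<ominus> h \<otimes> q) = u \<otimes> (p \<oplus> r) \<ominus> (g \<oplus> h) \<otimes> q"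
    using cl c assms(1) by algebra
  finally show "u \<otimes> \<lbrace>g \<oplus> h, b\<rbrace> \<ominus> (g \<oplus> h) \<otimes> \<lbrace>u, b\<rbrace> \<in> P"
    using c b by (simp add: p_q_r_def bracket_add_left)
qed

lemma central_over_mult:
  assumes "u \<in> carrier A" "v \<in> carrier A" "g \<in> central_over u" "h \<in> central_over v"
  shows "g \<otimes> h \<in> central_over (u \<otimes> v)"
  unfolding central_over_def
proof (intro CollectI conjI ballI)
  have c: "g \<in> carrier A" "h \<in> carrier A" using assms central_over_carrier by auto
  then show "g \<otimes> h \<in> carrier A" by simp
  fix b assume b: "b \<in> carrier A"
  define p q r s where "p = \<lbrace>g, b\<rbrace>" "q = \<lbrace>u, b\<rbrace>" "r = \<lbrace>h, b\<rbrace>" "s = \<lbrace>v, b\<rbrace>"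
  have cl: "p \<in> carrier A" "q \<in> carrier A" "r \<in> carrier A" "s \<in> carrier A"
    using assms(1,2) c b bracket_closed by (auto simp: p_q_r_s_def)
  have "(v \<otimes> h) \<otimes> (u \<otimes> p \<ominus> g \<otimes> q) \<oplus> (u \<otimes> g) \<otimes> (v \<otimes> r \<ominus> h \<otimes> s) \<in> P"
    using central_overD[OF assms(3) b] central_overD[OF assms(4) b] P.a_closed P.I_l_closed assms(1,2) c
    by (simp add: p_q_r_s_def)
  also have "(v \<otimes> h) \<otimes> (u \<otimes> p \<ominus> g \<otimes> q) \<oplus> (u \<otimes> g) \<otimes> (v \<otimes> r \<ominus> h \<otimes> s) =
      (u \<otimes> v) \<otimes> (g \<otimes> r \<oplus> p \<otimes> h) \<ominus> (g \<otimes> h) \<otimes> (u \<otimes> s \<oplus> q \<otimes> v)"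
    using cl c assms(1,2) by algebra
  finally show "(u \<otimes> v) \<otimes> \<lbrace>g \<otimes> h, b\<rbrace> \<ominus> (g \<otimes> h) \<otimes> \<lbrace>u \<otimes> v, b\<rbrace> \<in> P"
    using c b assms(1,2) by (simp add: p_q_r_s_def bracket_leibniz_left)
qed

lemma central_over_scalar: "r \<in> carrier K \<Longrightarrow> r \<odot> \<one> \<in> central_over \<one>"
  unfolding central_over_def using bracket_scalar[of r] bracket_antisym[of \<one>] bracket_one
  by (simp add: a_minus_def)

lemma central_over_cancel:
  assumes "u \<in> carrier A - P" "v \<in> carrier A" "h \<in> carrier A" "u \<otimes> h \<in> central_over (u \<otimes> v)"
  shows "h \<in> central_over v"
  unfolding central_over_def
proof (intro CollectI conjI ballI)
  show "h \<in> carrier A" by fact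
  fix b assume b: "b \<in> carrier A"
  have c: "u \<in> carrier A" using assms by blast
  define q r s where "q = \<lbrace>u, b\<rbrace>" "r = \<lbrace>h, b\<rbrace>" "s = \<lbrace>v, b\<rbrace>"
  have cl: "q \<in> carrier A" "r \<in> carrier A" "s \<in> carrier A"
    using assms(2,3) c b bracket_closed by (auto simp: q_r_s_def)
  have "(u \<otimes> v) \<otimes> \<lbrace>u \<otimes> h, b\<rbrace> \<ominus> (u \<otimes> h) \<otimes> \<lbrace>u \<otimes> v, b\<rbrace> \<in> P"
    using central_overD[OF assms(4) b] .
  then have "(u \<otimes> v) \<otimes> (u \<otimes> r \<oplus> q \<otimes> h) \<ominus> (u \<otimes> h) \<otimes> (u \<otimes> s \<oplus> q \<otimes> v) \<in> P"
    using c b assms(2,3) by (simp add: q_r_s_def bracket_leibniz_left)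
  also have "(u \<otimes> v) \<otimes> (u \<otimes> r \<oplus> q \<otimes> h) \<ominus> (u \<otimes> h) \<otimes> (u \<otimes> s \<oplus> q \<otimes> v) =
      (u \<otimes> u) \<otimes> (v \<otimes> r \<ominus> h \<otimes> s)"
    using cl c assms(2,3) by algebra
  finally show "v \<otimes> \<lbrace>h, b\<rbrace> \<ominus> h \<otimes> \<lbrace>v, b\<rbrace> \<in> P"
    using P_cancel[OF P_not_mult[OF assms(1,1)]] cl assms(2,3) by (simp add: q_r_s_def)
qed

lemma central_over_homog_eval:
  assumes e: "e \<in> central_over d" and d: "d \<in> carrier A" and p: "set p \<subseteq> carrier K"
  shows "homog_eval A p e d \<in> central_over (d [^] length p)"
  using p
proof (induction p)
  case Nil
  then show ?case using central_over_scalar[of "\<zero>\<^bsub>K\<^esub>"] by simp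
next
  case (Cons c p)
  have ec: "e \<in> carrier A" using e central_over_carrier by blast
  have en: "e [^] n \<in> central_over (d [^] n)" for n :: nat
    by (induction n) (use central_over_self[of \<one>] central_over_mult[OF _ d _ e] d in auto)
  have "(c \<odot> \<one>) \<otimes> e [^] length p \<in> central_over (\<one> \<otimes> d [^] length p)"
    using central_over_mult[OF _ _ central_over_scalar en] Cons.prems d by simp
  then have "c \<odot> (e [^] length p) \<in> central_over (d [^] length p)"
    using Cons.prems d ec smult_eq_mult[of c "e [^] length p"] by simp
  then have "c \<odot> (e [^] length p) \<oplus> homog_eval A p e d \<in> central_over (d [^] length p)"
    using central_over_add Cons d by simp
  then have "d \<otimes> (c \<odot> (e [^] length p) \<oplus> homog_eval A p e d) \<in> central_over (d \<otimes> d [^] length p)"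
    using central_over_mult central_over_self d by simp
  then show ?case using d by (simp add: A.m_comm)
qed

text \<open>The ideal of denominators of the Poisson central fraction \<open>f / g\<close>.\<close>

lemma denominator_poisson_ideal:
  assumes g: "g \<in> carrier A - P" and f: "f \<in> central_over g"
  shows "poisson_ideal {d \<in> carrier A. \<exists>e \<in> carrier A. d \<otimes> f \<ominus> e \<otimes> g \<in> P} A" (is "poisson_ideal ?J A")
  unfolding poisson_ideal_def
proof (intro conjI ballI)
  have c: "g \<in> carrier A" "f \<in> carrier A" using g f central_over_carrier by auto
  show "ideal ?J A"
  proof (rule A.ideal_if_closed)
    show "\<zero> \<in> ?J" using c by (auto intro!: bexI[of _ \<zero>] simp: a_minus_def)
  next
    fix d d' assume "d \<in> ?J" "d' \<in> ?J"
    then obtain e e' where h: "d \<in> carrier A" "d' \<in> carrier A" "e \<in> carrier A" "e' \<in> carrier A"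
      and m: "d \<otimes> f \<ominus> e \<otimes> g \<in> P" "d' \<otimes> f \<ominus> e' \<otimes> g \<in> P" by blast
    have "(d \<otimes> f \<ominus> e \<otimes> g) \<oplus> (d' \<otimes> f \<ominus> e' \<otimes> g) = (d \<oplus> d') \<otimes> f \<ominus> (e \<oplus> e') \<otimes> g"
      using h c by algebra
    then have "(d \<oplus> d') \<otimes> f \<ominus> (e \<oplus> e') \<otimes> g \<in> P" using P.a_closed[OF m] by simp
    then show "d \<oplus> d' \<in> ?J" using h by blast
  next
    fix a d assume a: "a \<in> carrier A" and "d \<in> ?J"
    then obtain e where h: "d \<in> carrier A" "e \<in> carrier A" and m: "d \<otimes> f \<ominus> e \<otimes> g \<in> P" by blast
    have "a \<otimes> (d \<otimes> f \<ominus> e \<otimes> g) = (a \<otimes> d) \<otimes> f \<ominus> (a \<otimes> e) \<otimes> g" using h c a by algebra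
    then have "(a \<otimes> d) \<otimes> f \<ominus> (a \<otimes> e) \<otimes> g \<in> P" using P.I_l_closed[OF m a] by simp
    then show "a \<otimes> d \<in> ?J" using h a by blast
  qed auto
  fix a d assume a: "a \<in> carrier A" and "d \<in> ?J"
  then obtain e where h: "d \<in> carrier A" "e \<in> carrier A" and m: "d \<otimes> f \<ominus> e \<otimes> g \<in> P" by blast
  define ad ae af ag where "ad = \<lbrace>a, d\<rbrace>" "ae = \<lbrace>a, e\<rbrace>" "af = \<lbrace>a, f\<rbrace>" "ag = \<lbrace>a, g\<rbrace>"
  note D = this
  have cl: "ad \<in> carrier A" "ae \<in> carrier A" "af \<in> carrier A" "ag \<in> carrier A"
    using a h c bracket_closed by (auto simp: D)
  have "\<lbrace>a, d \<otimes> f \<ominus> e \<otimes> g\<rbrace> \<in> P" using P_bracket(1)[OF a m] .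
  then have 1: "(d \<otimes> af \<oplus> ad \<otimes> f) \<ominus> (e \<otimes> ag \<oplus> ae \<otimes> g) \<in> P"
    using a h c by (simp add: bracket_diff bracket_leibniz_right D)
  have 2: "g \<otimes> (\<ominus> af) \<ominus> f \<otimes> (\<ominus> ag) \<in> P"
    using central_overD[OF f a] bracket_antisym[of f a] bracket_antisym[of g a] a c by (simp add: D)
  have "(g \<otimes> ((d \<otimes> af \<oplus> ad \<otimes> f) \<ominus> (e \<otimes> ag \<oplus> ae \<otimes> g)) \<oplus> d \<otimes> (g \<otimes> (\<ominus> af) \<ominus> f \<otimes> (\<ominus> ag)))
     \<ominus> ag \<otimes> (d \<otimes> f \<ominus> e \<otimes> g) \<in> P"
    by (intro P_diff P.a_closed P.I_l_closed[OF 1 c(1)] P.I_l_closed[OF 2 h(1)] P.I_l_closed[OF m cl(4)])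
  also have "(g \<otimes> ((d \<otimes> af \<oplus> ad \<otimes> f) \<ominus> (e \<otimes> ag \<oplus> ae \<otimes> g)) \<oplus> d \<otimes> (g \<otimes> (\<ominus> af) \<ominus> f \<otimes> (\<ominus> ag)))
     \<ominus> ag \<otimes> (d \<otimes> f \<ominus> e \<otimes> g) = g \<otimes> (ad \<otimes> f \<ominus> ae \<otimes> g)"
    using cl h c by algebra
  finally have gP: "g \<otimes> (ad \<otimes> f \<ominus> ae \<otimes> g) \<in> P" .
  have "ad \<otimes> f \<ominus> ae \<otimes> g \<in> P" by (rule P_cancel[OF g _ gP]) (use cl c in simp)
  then show "\<lbrace>a, d\<rbrace> \<in> ?J" using cl by (auto simp: D)
qed

lemma central_over_other_fraction:
  assumes g: "g \<in> carrier A - P" and f: "f \<in> central_over g"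
    and d: "d \<in> carrier A" and e: "e \<in> carrier A" and m: "d \<otimes> f \<ominus> e \<otimes> g \<in> P"
  shows "e \<in> central_over d"
  unfolding central_over_def
proof (intro CollectI conjI ballI)
  show "e \<in> carrier A" by fact
  have c: "g \<in> carrier A" "f \<in> carrier A" using g f central_over_carrier by auto
  fix b assume b: "b \<in> carrier A"
  define db eb fb gb where "db = \<lbrace>d, b\<rbrace>" "eb = \<lbrace>e, b\<rbrace>" "fb = \<lbrace>f, b\<rbrace>" "gb = \<lbrace>g, b\<rbrace>"
  note D = this
  have cl: "db \<in> carrier A" "eb \<in> carrier A" "fb \<in> carrier A" "gb \<in> carrier A"
    using b d e c bracket_closed by (auto simp: D)
  have "\<lbrace>d \<otimes> f \<ominus> e \<otimes> g, b\<rbrace> \<in> P" using P_bracket(2)[OF b m] .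
  then have 1: "(d \<otimes> fb \<oplus> db \<otimes> f) \<ominus> (e \<otimes> gb \<oplus> eb \<otimes> g) \<in> P"
    using b d e c by (simp add: bracket_diff bracket_leibniz_left D)
  have 2: "g \<otimes> fb \<ominus> f \<otimes> gb \<in> P" using central_overD[OF f b] by (simp add: D)
  have "((d \<otimes> d) \<otimes> (g \<otimes> fb \<ominus> f \<otimes> gb) \<oplus> (d \<otimes> gb \<oplus> g \<otimes> db) \<otimes> (d \<otimes> f \<ominus> e \<otimes> g))
     \<ominus> (d \<otimes> g) \<otimes> ((d \<otimes> fb \<oplus> db \<otimes> f) \<ominus> (e \<otimes> gb \<oplus> eb \<otimes> g)) \<in> P"
    by (intro P_diff P.a_closed P.I_l_closed[OF 1] P.I_l_closed[OF 2] P.I_l_closed[OF m]) (use cl c d in auto)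
  also have "((d \<otimes> d) \<otimes> (g \<otimes> fb \<ominus> f \<otimes> gb) \<oplus> (d \<otimes> gb \<oplus> g \<otimes> db) \<otimes> (d \<otimes> f \<ominus> e \<otimes> g))
     \<ominus> (d \<otimes> g) \<otimes> ((d \<otimes> fb \<oplus> db \<otimes> f) \<ominus> (e \<otimes> gb \<oplus> eb \<otimes> g)) = (g \<otimes> g) \<otimes> (d \<otimes> eb \<ominus> e \<otimes> db)"
    using cl c d e by algebra
  finally have gP: "(g \<otimes> g) \<otimes> (d \<otimes> eb \<ominus> e \<otimes> db) \<in> P" .
  have "d \<otimes> eb \<ominus> e \<otimes> db \<in> P"
    by (rule P_cancel[OF P_not_mult[OF g g] _ gP]) (use cl d e in simp)
  then show "d \<otimes> \<lbrace>e, b\<rbrace> \<ominus> e \<otimes> \<lbrace>d, b\<rbrace> \<in> P" by (simp add: D)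
qed

definition homog_algebraic :: "'a \<Rightarrow> 'a \<Rightarrow> bool" where
  "homog_algebraic f g \<longleftrightarrow>
    (\<exists>p. set p \<subseteq> carrier K \<and> (\<exists>c \<in> set p. c \<noteq> \<zero>\<^bsub>K\<^esub>) \<and> homog_eval A p f g \<in> P)"

lemma homog_algebraic_transfer:
  assumes "g \<in> carrier A - P" "d \<in> carrier A - P" "f \<in> carrier A" "e \<in> carrier A"
    and m: "d \<otimes> f \<ominus> e \<otimes> g \<in> P" and "homog_algebraic e d"
  shows "homog_algebraic f g"
proof -
  have c: "g \<in> carrier A" "d \<in> carrier A" "g \<notin> P" "d \<notin> P" using assms by auto
  have nz: "\<phi> g \<noteq> \<zero>\<^bsub>F\<^esub>" "\<phi> d \<noteq> \<zero>\<^bsub>F\<^esub>" using phi_eq_zero c by auto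
  have cF: "\<phi> g \<in> carrier F" "\<phi> d \<in> carrier F" "\<phi> f \<in> carrier F" "\<phi> e \<in> carrier F" using c assms by auto
  have iv: "inv\<^bsub>F\<^esub> \<phi> g \<in> carrier F" "inv\<^bsub>F\<^esub> \<phi> g \<otimes>\<^bsub>F\<^esub> \<phi> g = \<one>\<^bsub>F\<^esub>" using nz cF F.field_Units by auto
  define z where "z = \<phi> f \<otimes>\<^bsub>F\<^esub> inv\<^bsub>F\<^esub> \<phi> g"
  have z: "z \<in> carrier F" "\<phi> f = z \<otimes>\<^bsub>F\<^esub> \<phi> g" using iv cF by (auto simp: z_def F.m_assoc)
  have "\<phi> (d \<otimes> f \<ominus> e \<otimes> g) = \<zero>\<^bsub>F\<^esub>" using phi_eq_zero m c assms by simp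
  then have "\<phi> d \<otimes>\<^bsub>F\<^esub> \<phi> f = \<phi> e \<otimes>\<^bsub>F\<^esub> \<phi> g"
    using c assms(3,4) F.r_right_minus_eq[of "\<phi> d \<otimes>\<^bsub>F\<^esub> \<phi> f" "\<phi> e \<otimes>\<^bsub>F\<^esub> \<phi> g"] by (simp add: a_minus_def)
  then have "\<phi> g \<otimes>\<^bsub>F\<^esub> \<phi> e = \<phi> g \<otimes>\<^bsub>F\<^esub> (z \<otimes>\<^bsub>F\<^esub> \<phi> d)"
    unfolding z(2) using cF z(1) by (simp add: F.m_ac)
  then have ze: "\<phi> e = z \<otimes>\<^bsub>F\<^esub> \<phi> d" using F.m_lcancel[OF nz(1) cF(1)] cF z(1) by simp
  have "(F.algebraic over (\<sigma> ` carrier K)) z"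
    using algebraic_iff_homog_eval[OF assms(4) c(2,4) z(1) ze] assms(6) unfolding homog_algebraic_def by blast
  then show ?thesis
    using algebraic_iff_homog_eval[OF assms(3) c(1,3) z] unfolding homog_algebraic_def by blast
qed

lemma rational_iff:
  "poisson_rational K A P \<longleftrightarrow> (\<forall>g \<in> carrier A - P. \<forall>f \<in> central_over g. homog_algebraic f g)"
proof -
  have "P \<in> poisson_spec A" using P.primeideal poisson_ideal by (simp add: poisson_spec_def)
  from poisson_rational_iff[OF this]
  show ?thesis unfolding homog_algebraic_def central_over_def by blast
qed

lemma primitive_imp_rational:
  assumes fg: "finitely_generated_algebra K A" and prim: "poisson_primitive A P"
  shows "poisson_rational K A P"
  unfolding rational_iff
proof (intro ballI)
  fix g f assume g: "g \<in> carrier A - P" and f: "f \<in> central_over g"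
  have c: "g \<in> carrier A" "f \<in> carrier A" using g f central_over_carrier by auto
  from prim[unfolded poisson_primitive_def] obtain M where
    "maximalideal M A \<and> poisson_ideal P A \<and> P \<subseteq> M \<and> (\<forall>J. poisson_ideal J A \<and> J \<subseteq> M \<longrightarrow> J \<subseteq> P)" ..
  then have M: "maximalideal M A" "P \<subseteq> M" "\<And>J. \<lbrakk>poisson_ideal J A; J \<subseteq> M\<rbrakk> \<Longrightarrow> J \<subseteq> P" by auto
  have Mp: "primeideal M A" using A.maximalideal_prime[OF M(1)] .
  interpret M: primeideal M A by fact
  let ?J = "\<lambda>f g. {d \<in> carrier A. \<exists>e \<in> carrier A. d \<otimes> f \<ominus> e \<otimes> g \<in> P}"
  have gJ: "g \<in> ?J f g" if "g \<in> carrier A" "f \<in> carrier A" for f g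
  proof -
    have "g \<otimes> f \<ominus> f \<otimes> g = \<zero>" using that by algebra
    then have "g \<otimes> f \<ominus> f \<otimes> g \<in> P" using P.zero_closed by (simp only:)
    then show ?thesis using that by blast
  qed
  have "\<not> ?J f g \<subseteq> M" using M(3)[OF denominator_poisson_ideal[OF g f]] gJ[OF c] g by blast
  then obtain d e where d: "d \<in> carrier A" "d \<notin> M" and e: "e \<in> carrier A" and m: "d \<otimes> f \<ominus> e \<otimes> g \<in> P"
    by blast
  have dP: "d \<in> carrier A - P" using d M(2) by blast
  have ce: "e \<in> central_over d" using central_over_other_fraction[OF g f d(1) e m] .
  obtain p where p: "set p \<subseteq> carrier K" "\<exists>c \<in> set p. c \<noteq> \<zero>\<^bsub>K\<^esub>" "homog_eval A p e d \<in> M"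
    using algebraic_mod_maximal[OF fg M(1) e, of d] d by blast
  define h where "h = homog_eval A p e d"
  define dn where "dn = d [^] length p"
  have h: "h \<in> carrier A" "h \<in> central_over dn" "h \<in> M"
    using homog_eval_closed[OF p(1) e d(1)] central_over_homog_eval[OF ce d(1) p(1)] p(3)
    by (auto simp: h_def dn_def)
  have dn: "dn \<in> carrier A" "dn \<notin> M"
    using d A.primeideal_power[OF Mp d(1)] by (auto simp: dn_def)
  have "h \<in> P"
  proof (rule ccontr)
    assume "h \<notin> P"
    then have hP: "h \<in> carrier A - P" using h by blast
    have "poisson_ideal (?J dn h) A"
      using denominator_poisson_ideal[OF hP central_over_sym[OF dn(1) h(2)]] .
    moreover have "?J dn h \<subseteq> M"
    proof
      fix y assume "y \<in> ?J dn h"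
      then obtain x where x: "y \<in> carrier A" "x \<in> carrier A" "y \<otimes> dn \<ominus> x \<otimes> h \<in> P" by blast
      have "(y \<otimes> dn \<ominus> x \<otimes> h) \<oplus> x \<otimes> h \<in> M"
        using M.a_closed[OF subsetD[OF M(2) x(3)] M.I_l_closed[OF h(3) x(2)]] .
      also have "(y \<otimes> dn \<ominus> x \<otimes> h) \<oplus> x \<otimes> h = y \<otimes> dn" using x(1,2) h(1) dn(1) by algebra
      finally show "y \<in> M" using M.I_prime[OF x(1) dn(1)] dn(2) by blast
    qed
    ultimately have "?J dn h \<subseteq> P" using M(3) by blast
    then show False using gJ[OF h(1) dn(1)] \<open>h \<notin> P\<close> by blast
  qed
  then have "homog_algebraic e d" unfolding homog_algebraic_def h_def using p(1,2) by blast
  then show "homog_algebraic f g" using homog_algebraic_transfer[OF g dP c(2) e m] by blast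
qed

lemma central_over_minus: "\<lbrakk>u \<in> carrier A; g \<in> central_over u\<rbrakk> \<Longrightarrow> \<ominus> g \<in> central_over u"
proof -
  assume u: "u \<in> carrier A" and g: "g \<in> central_over u"
  have "((\<ominus>\<^bsub>K\<^esub> \<one>\<^bsub>K\<^esub>) \<odot> \<one>) \<otimes> g \<in> central_over (\<one> \<otimes> u)"
    by (rule central_over_mult[OF A.one_closed u central_over_scalar g]) simp
  then show ?thesis using u central_over_carrier[OF g] by (simp add: smult_l_minus A.l_minus)
qed

lemma homog_algebraic_denominator:
  assumes L: "primeideal L A" "P \<subseteq> L" and f: "f \<in> L" "f \<notin> P" and u: "u \<in> carrier A" "u \<notin> L"
  shows "\<not> homog_algebraic f u"
proof -
  interpret L: primeideal L A by fact
  have fc: "f \<in> carrier A" using f L.Icarr by blast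
  have "\<forall>c \<in> set p. c = \<zero>\<^bsub>K\<^esub>" if "set p \<subseteq> carrier K" "homog_eval A p f u \<in> P" for p
    using that
  proof (induction p rule: rev_induct)
    case Nil
    then show ?case by simp
  next
    case (snoc c q)
    define h v where "h = homog_eval A q f u" "v = u [^] Suc (length q)"
    have q: "set q \<subseteq> carrier K" "c \<in> carrier K" using snoc.prems by auto
    have cl: "h \<in> carrier A" "v \<in> carrier A" using homog_eval_closed[OF q(1) fc u(1)] u by (auto simp: h_v_def)
    have e: "f \<otimes> h \<oplus> c \<odot> v \<in> P" using snoc.prems homog_eval_append[OF q fc u(1)] by (simp add: h_v_def)
    have "c \<odot> v \<in> L"
      by (rule L.add_mem_cancel[OF L.I_r_closed[OF f(1) cl(1)] _ subsetD[OF L(2) e]]) (use q(2) cl in simp)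
    have "c = \<zero>\<^bsub>K\<^esub>"
    proof (rule ccontr)
      assume "c \<noteq> \<zero>\<^bsub>K\<^esub>"
      then have i: "inv\<^bsub>K\<^esub> c \<in> carrier K" "inv\<^bsub>K\<^esub> c \<otimes>\<^bsub>K\<^esub> c = \<one>\<^bsub>K\<^esub>" using q K.field_Units by auto
      have "inv\<^bsub>K\<^esub> c \<odot> (c \<odot> v) \<in> L" using smult_closed_ideal[OF L.is_ideal i(1) \<open>c \<odot> v \<in> L\<close>] .
      then have "v \<in> L" using smult_assoc1[OF i(1) q(2) cl(2)] i(2) cl by simp
      then have "u \<in> L" unfolding h_v_def by (rule A.primeideal_power[OF L(1) u(1)])
      then show False using u(2) by blast
    qed
    then have "f \<otimes> h \<in> P" using e fc cl by simp
    then have "h \<in> P" using P.I_prime[OF fc cl(1)] f(2) by blast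
    then show ?case using snoc.IH q \<open>c = \<zero>\<^bsub>K\<^esub>\<close> by (simp add: h_v_def)
  qed
  then show ?thesis unfolding homog_algebraic_def by blast
qed

lemma central_over_if_generators:
  assumes gen: "generated_subalgebra K A S = carrier A" "S \<subseteq> carrier A"
    and f: "f \<in> carrier A" "u \<in> carrier A"
    and S: "\<And>x. x \<in> S \<Longrightarrow> u \<otimes> \<lbrace>f, x\<rbrace> \<ominus> f \<otimes> \<lbrace>u, x\<rbrace> \<in> P"
  shows "f \<in> central_over u"
proof -
  let ?T = "{b \<in> carrier A. u \<otimes> \<lbrace>f, b\<rbrace> \<ominus> f \<otimes> \<lbrace>u, b\<rbrace> \<in> P}"
  have add: "a \<oplus> b \<in> ?T" and mult: "a \<otimes> b \<in> ?T" if ab: "a \<in> ?T" "b \<in> ?T" for a b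
  proof -
    define fa fb ua ub where "fa = \<lbrace>f, a\<rbrace>" "fb = \<lbrace>f, b\<rbrace>" "ua = \<lbrace>u, a\<rbrace>" "ub = \<lbrace>u, b\<rbrace>"
    note D = this
    have c: "a \<in> carrier A" "b \<in> carrier A" using ab by auto
    have cl: "fa \<in> carrier A" "fb \<in> carrier A" "ua \<in> carrier A" "ub \<in> carrier A"
      using f c bracket_closed by (auto simp: D)
    have m: "u \<otimes> fa \<ominus> f \<otimes> ua \<in> P" "u \<otimes> fb \<ominus> f \<otimes> ub \<in> P" using ab by (auto simp: D)
    have "(u \<otimes> fa \<ominus> f \<otimes> ua) \<oplus> (u \<otimes> fb \<ominus> f \<otimes> ub) = u \<otimes> (fa \<oplus> fb) \<ominus> f \<otimes> (ua \<oplus> ub)"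
      using cl f by algebra
    then show "a \<oplus> b \<in> ?T" using P.a_closed[OF m] c f by (simp add: bracket_add_right D)
    have "b \<otimes> (u \<otimes> fa \<ominus> f \<otimes> ua) \<oplus> a \<otimes> (u \<otimes> fb \<ominus> f \<otimes> ub) \<in> P"
      by (rule P.a_closed[OF P.I_l_closed[OF m(1) c(2)] P.I_l_closed[OF m(2) c(1)]])
    also have "b \<otimes> (u \<otimes> fa \<ominus> f \<otimes> ua) \<oplus> a \<otimes> (u \<otimes> fb \<ominus> f \<otimes> ub) =
       u \<otimes> (a \<otimes> fb \<oplus> fa \<otimes> b) \<ominus> f \<otimes> (a \<otimes> ub \<oplus> ua \<otimes> b)"
      using cl c f by algebra
    finally show "a \<otimes> b \<in> ?T" using c f by (simp add: bracket_leibniz_right D)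
  qed
  have scalar: "r \<odot> \<one> \<in> ?T" if "r \<in> carrier K" for r
  proof -
    have "\<lbrace>x, r \<odot> \<one>\<rbrace> = \<zero>" if "x \<in> carrier A" for x
      using bracket_smult_right[of r x \<one>] bracket_one that \<open>r \<in> carrier K\<close> by simp
    then show ?thesis using f that P.zero_closed by (simp add: a_minus_def)
  qed
  have "generated_subalgebra K A S \<subseteq> ?T"
  proof (rule generated_subalgebra_subset(3))
    show "S \<subseteq> ?T" using S gen(2) by blast
    show "\<one> \<in> ?T" using scalar[of "\<one>\<^bsub>K\<^esub>"] by simp
    show "r \<odot> a \<in> ?T" if "r \<in> carrier K" "a \<in> ?T" for r a
      using mult[OF scalar[OF that(1)] that(2)] smult_eq_mult[of r a] that by simp
  qed (use add mult in auto)
  then show ?thesis unfolding central_over_def using gen(1) f(1) by blast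
qed

lemma rational_imp_locally_closed:
  assumes S: "finite S" "S \<subseteq> carrier A" "generated_subalgebra K A S = carrier A"
    and br: "\<And>x y. \<lbrakk>x \<in> S; y \<in> S\<rbrakk> \<Longrightarrow> \<lbrace>x, y\<rbrace> \<in> central_over (x \<otimes> y)"
    and rat: "poisson_rational K A P"
  shows "poisson_locally_closed A P"
proof -
  define T where "T = S - P"
  define M where "M = monomials A T"
  have T: "T \<subseteq> carrier A - P" "T \<subseteq> carrier A" using S by (auto simp: T_def)
  have MP: "M \<subseteq> carrier A - P" using A.monomials_avoid_prime[OF P.primeideal T(1)] by (simp add: M_def)
  then have Mc: "u \<in> carrier A" if "u \<in> M" for u using that by blast
  have Tc: "x \<in> carrier A" if "x \<in> T" for x using that T by blast
  have Mmult: "u \<otimes> v \<in> M" if "u \<in> M" "v \<in> M" for u v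
    using A.monomials_mult[OF T(2)] that by (simp add: M_def)
  have TM: "x \<in> M" if "x \<in> T" for x
    using monomials.mult[OF monomials.one that, of A] Tc[OF that] by (simp add: M_def)
  have Mbr: "\<lbrace>u, x\<rbrace> \<in> central_over (u \<otimes> x)" if "u \<in> M" "x \<in> T" for u x
    using that(1) unfolding M_def
  proof induction
    case one
    have "\<lbrace>\<one>, x\<rbrace> = \<zero>" using bracket_scalar[of "\<one>\<^bsub>K\<^esub>" x] Tc that by simp
    then show ?case using ideal_central_over[OF _ P.zero_closed] Tc that by simp
  next
    case (mult u y)
    have c: "u \<in> carrier A" "y \<in> carrier A" "x \<in> carrier A"
      using mult.hyps Mc Tc that(2) by (auto simp: M_def)
    have "u \<otimes> \<lbrace>y, x\<rbrace> \<in> central_over (u \<otimes> (y \<otimes> x))"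
      using central_over_mult central_over_self br[of y x] mult.hyps(2) that(2) c by (simp add: T_def)
    moreover have "\<lbrace>u, x\<rbrace> \<otimes> y \<in> central_over ((u \<otimes> x) \<otimes> y)"
      using central_over_mult central_over_self mult.IH c by simp
    moreover have "(u \<otimes> x) \<otimes> y = u \<otimes> (y \<otimes> x)" "(u \<otimes> y) \<otimes> x = u \<otimes> (y \<otimes> x)"
      using c by (simp_all add: A.m_ac)
    ultimately show ?case using c central_over_add by (simp add: bracket_leibniz_left)
  qed
  define G where "G = (\<Union>u \<in> M. central_over u)"
  have Gc: "G \<subseteq> carrier A" using central_over_carrier by (auto simp: G_def)
  have GI: "g \<in> G" if "u \<in> M" "g \<in> central_over u" for u g using that by (auto simp: G_def)
  have Gmult: "g \<otimes> h \<in> G" if gh: "g \<in> G" "h \<in> G" for g h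
  proof -
    obtain u v where "u \<in> M" "v \<in> M" "g \<in> central_over u" "h \<in> central_over v"
      using gh by (auto simp: G_def)
    then show ?thesis using GI[OF Mmult] central_over_mult Mc by blast
  qed
  have Gstep: "u \<otimes> \<lbrace>g, x\<rbrace> \<ominus> g \<otimes> \<lbrace>u, x\<rbrace> \<in> G" if u: "u \<in> M" and x: "x \<in> T" and g: "g \<in> G" for u x g
  proof -
    obtain v where v: "v \<in> M" "g \<in> central_over v" using g by (auto simp: G_def)
    have c: "u \<in> carrier A" "x \<in> carrier A" "v \<in> carrier A" "g \<in> carrier A" "v \<in> carrier A - P"
      using u x v Mc Tc central_over_carrier MP by auto
    have vx: "v \<otimes> x \<in> carrier A" using c by simp
    have bc: "\<lbrace>g, x\<rbrace> \<in> carrier A" "\<lbrace>v, x\<rbrace> \<in> carrier A" "\<lbrace>u, x\<rbrace> \<in> carrier A" using c bracket_closed by auto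
    have "(v \<otimes> \<lbrace>g, x\<rbrace> \<ominus> g \<otimes> \<lbrace>v, x\<rbrace>) \<oplus> g \<otimes> \<lbrace>v, x\<rbrace> \<in> central_over (v \<otimes> (v \<otimes> x))"
      using ideal_central_over[OF _ central_overD[OF v(2) c(2)], of "v \<otimes> (v \<otimes> x)"]
        central_over_mult[OF c(3) vx v(2) Mbr[OF v(1) x]] central_over_add[of "v \<otimes> (v \<otimes> x)"] c by simp
    also have "(v \<otimes> \<lbrace>g, x\<rbrace> \<ominus> g \<otimes> \<lbrace>v, x\<rbrace>) \<oplus> g \<otimes> \<lbrace>v, x\<rbrace> = v \<otimes> \<lbrace>g, x\<rbrace>"
      using bc c(3,4) by algebra
    finally have "\<lbrace>g, x\<rbrace> \<in> central_over (v \<otimes> x)" using central_over_cancel[OF c(5) vx bc(1)] by blast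
    then have 1: "u \<otimes> \<lbrace>g, x\<rbrace> \<in> central_over (u \<otimes> (v \<otimes> x))"
      using central_over_mult[OF c(1) vx central_over_self[OF c(1)]] by blast
    have "g \<otimes> \<lbrace>u, x\<rbrace> \<in> central_over (v \<otimes> (u \<otimes> x))"
      using central_over_mult[OF c(3) _ v(2) Mbr[OF u x]] c by simp
    also have "v \<otimes> (u \<otimes> x) = u \<otimes> (v \<otimes> x)" using c by (simp add: A.m_lcomm)
    finally have "\<ominus> (g \<otimes> \<lbrace>u, x\<rbrace>) \<in> central_over (u \<otimes> (v \<otimes> x))" using central_over_minus c by simp
    then have "u \<otimes> \<lbrace>g, x\<rbrace> \<ominus> g \<otimes> \<lbrace>u, x\<rbrace> \<in> central_over (u \<otimes> (v \<otimes> x))"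
      unfolding a_minus_def using central_over_add[OF _ 1] c by simp
    then show ?thesis using GI[OF Mmult[OF u Mmult[OF v(1) TM[OF x]]]] by blast
  qed
  let ?W = "iter_sums A P G"
  have Pc: "P \<subseteq> carrier A" using P.Icarr by blast
  note Wc = A.iter_sums_carrier[OF Pc Gc]
  have Wadd: "x \<oplus> y \<in> ?W (m + n)" if "x \<in> ?W m" "y \<in> ?W n" for x y m n
    by (rule A.iter_sums_add[OF Pc Gc _ that]) (rule P.a_closed)
  note Wmap = A.iter_sums_map[OF Pc Gc]
  have Wmult: "x \<otimes> g \<in> ?W n" if "x \<in> ?W n" "g \<in> G" for x g n
    using that(1)
  proof (rule Wmap[rotated -1])
    have gc: "g \<in> carrier A" using that Gc by blast
    show "(a \<oplus> b) \<otimes> g = a \<otimes> g \<oplus> b \<otimes> g" if "a \<in> carrier A" "b \<in> carrier A" for a b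
      using that gc by (simp add: A.l_distr)
    show "a \<otimes> g \<in> P" if "a \<in> P" for a using that gc P.I_r_closed by simp
    show "a \<otimes> g \<in> G" if "a \<in> G" for a using Gmult that \<open>g \<in> G\<close> by blast
  qed
  have PW: "x \<in> ?W 0" if "x \<in> P" for x using that by simp
  have GW: "g \<in> ?W 1" if "g \<in> G" for g
  proof -
    have "g = \<zero> \<oplus> g" using that Gc by auto
    then show ?thesis unfolding One_nat_def iter_sums.simps using that P.zero_closed by blast
  qed
  have scalarG: "r \<odot> \<one> \<in> G" if "r \<in> carrier K" for r
    using GI[OF _ central_over_scalar[OF that]] monomials.one[of A T] by (simp add: M_def)
  have "generated_subalgebra K A S \<subseteq> (\<Union>n. ?W n)"
  proof (rule generated_subalgebra_subset(3))
    show "(\<Union>n. ?W n) \<subseteq> carrier A" using Wc by blast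
    show "S \<subseteq> (\<Union>n. ?W n)"
    proof
      fix x assume "x \<in> S"
      then have "x \<in> P \<or> x \<in> G" using GI[OF TM central_over_self[OF Tc]] by (auto simp: T_def)
      then show "x \<in> (\<Union>n. ?W n)" using PW GW by blast
    qed
    have "\<one> \<in> G" using scalarG[of "\<one>\<^bsub>K\<^esub>"] by simp
    then show "\<one> \<in> (\<Union>n. ?W n)" using GW by blast
    show "a \<oplus> b \<in> (\<Union>n. ?W n)" if "a \<in> (\<Union>n. ?W n)" "b \<in> (\<Union>n. ?W n)" for a b
      using that Wadd by blast
    show "r \<odot> a \<in> (\<Union>n. ?W n)" if ra: "r \<in> carrier K" "a \<in> (\<Union>n. ?W n)" for r a
    proof -
      obtain n where n: "a \<in> ?W n" using ra by blast
      have ac: "a \<in> carrier A" using n Wc by blast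
      have "a \<otimes> (r \<odot> \<one>) \<in> ?W n" using Wmult[OF n scalarG[OF ra(1)]] .
      also have "a \<otimes> (r \<odot> \<one>) = r \<odot> a" using smult_eq_mult[of r a] ra(1) ac by (simp add: A.m_comm)
      finally show ?thesis by blast
    qed
    show "a \<otimes> b \<in> (\<Union>n. ?W n)" if ab: "a \<in> (\<Union>n. ?W n)" "b \<in> (\<Union>n. ?W n)" for a b
    proof -
      obtain m where m: "a \<in> ?W m" using ab by blast
      have ac: "a \<in> carrier A" using m Wc by blast
      have "a \<otimes> y \<in> (\<Union>n. ?W n)" if "y \<in> ?W n" for y n
        using that
      proof (induction n arbitrary: y)
        case 0
        then have "a \<otimes> y \<in> P" using P.I_l_closed ac by simp
        then show ?case using PW by blast
      next
        case (Suc n)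
        then obtain h g where h: "h \<in> ?W n" "g \<in> G" "y = h \<oplus> g" by auto
        have hg: "h \<in> carrier A" "g \<in> carrier A" using h Wc Gc by auto
        obtain k where k: "a \<otimes> h \<in> ?W k" using Suc.IH[OF h(1)] by blast
        have "a \<otimes> y = a \<otimes> h \<oplus> a \<otimes> g" unfolding h(3) using ac hg by (simp add: A.r_distr)
        then have "a \<otimes> y \<in> ?W (k + m)" using Wadd[OF k Wmult[OF m h(2)]] by simp
        then show ?case by blast
      qed
      then show ?thesis using ab by blast
    qed
  qed
  then have W: "carrier A \<subseteq> (\<Union>n. ?W n)" using S(3) by simp
  have main: "\<exists>x \<in> T. x \<in> L" if L: "L \<in> poisson_spec A" "P \<subseteq> L" "L \<noteq> P" for L
  proof (rule ccontr)
    assume "\<not> ?thesis"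
    then have TL: "T \<subseteq> carrier A - L" using Tc by blast
    have Lp: "primeideal L A" and Lq: "poisson_ideal L A" using L(1) by (auto simp: poisson_spec_def)
    interpret L: primeideal L A by fact
    have Mavoid: "M \<subseteq> carrier A - L" using A.monomials_avoid_prime[OF Lp TL] by (simp add: M_def)
    have "f \<in> P" if "f \<in> ?W n" "f \<in> L" for f n
      using that
    proof (induction n arbitrary: f)
      case 0
      then show ?case by simp
    next
      case (Suc n)
      obtain h g where h: "h \<in> ?W n" "g \<in> G" "f = h \<oplus> g" using Suc.prems(1) by auto
      obtain u where u: "u \<in> M" "g \<in> central_over u" using h(2) by (auto simp: G_def)
      have c: "h \<in> carrier A" "g \<in> carrier A" "u \<in> carrier A" "f \<in> carrier A"
        using h u Wc Gc Mc by auto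
      have "u \<otimes> \<lbrace>f, x\<rbrace> \<ominus> f \<otimes> \<lbrace>u, x\<rbrace> \<in> P" if "x \<in> S" for x
      proof (cases "x \<in> P")
        case True
        have bP: "\<lbrace>f, x\<rbrace> \<in> P" "\<lbrace>u, x\<rbrace> \<in> P" using P_bracket(1) True c by auto
        show ?thesis by (rule P_diff[OF P.I_l_closed[OF bP(1) c(3)] P.I_l_closed[OF bP(2) c(4)]])
      next
        case False
        then have xT: "x \<in> T" using that by (simp add: T_def)
        have xc: "x \<in> carrier A" using Tc xT .
        let ?D = "\<lambda>a. u \<otimes> \<lbrace>a, x\<rbrace> \<ominus> a \<otimes> \<lbrace>u, x\<rbrace>"
        have ux: "\<lbrace>u, x\<rbrace> \<in> carrier A" using c xc bracket_closed by blast
        have Dadd: "?D (a \<oplus> b) = ?D a \<oplus> ?D b" if ab: "a \<in> carrier A" "b \<in> carrier A" for a b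
        proof -
          define p q r where "p = \<lbrace>a, x\<rbrace>" "q = \<lbrace>b, x\<rbrace>" "r = \<lbrace>u, x\<rbrace>"
          have "p \<in> carrier A" "q \<in> carrier A" "r \<in> carrier A"
            using ab xc ux bracket_closed by (auto simp: p_q_r_def)
          then have "u \<otimes> (p \<oplus> q) \<ominus> (a \<oplus> b) \<otimes> r = (u \<otimes> p \<ominus> a \<otimes> r) \<oplus> (u \<otimes> q \<ominus> b \<otimes> r)"
            using ab c(3) by algebra
          then show ?thesis using ab xc by (simp add: bracket_add_left p_q_r_def)
        qed
        have "?D h \<in> ?W n"
        proof (rule Wmap[OF Dadd _ _ h(1)])
          show "?D a \<in> P" if "a \<in> P" for a
            using P_diff[OF P.I_l_closed[OF P_bracket(2)[OF xc that] c(3)] P.I_r_closed[OF that ux]] .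
          show "?D a \<in> G" if "a \<in> G" for a using Gstep[OF u(1) xT that] .
        qed
        then have "?D h \<oplus> ?D g \<in> ?W (n + 0)"
          using Wadd PW[OF central_overD[OF u(2) xc]] by blast
        then have 1: "?D f \<in> ?W n" using Dadd[OF c(1,2)] h(3) by simp
        have "\<lbrace>f, x\<rbrace> \<in> L" using poisson_ideal_bracket(2)[OF Lq xc Suc.prems(2)] .
        then have "u \<otimes> \<lbrace>f, x\<rbrace> \<in> L" "f \<otimes> \<lbrace>u, x\<rbrace> \<in> L"
          using L.I_l_closed[OF _ c(3)] L.I_r_closed[OF Suc.prems(2) ux] by auto
        then have "?D f \<in> L" using L.a_closed L.a_inv_closed by (simp add: a_minus_def)
        then show ?thesis using Suc.IH[OF 1] by blast
      qed
      then have "f \<in> central_over u" using central_over_if_generators[OF S(3,2) c(4,3)] by blast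
      moreover have "u \<in> carrier A - P" "u \<notin> L" using u MP Mavoid by auto
      ultimately have "homog_algebraic f u" using rat unfolding rational_iff by blast
      then show "f \<in> P"
        using homog_algebraic_denominator[OF Lp L(2) Suc.prems(2) _ c(3) \<open>u \<notin> L\<close>] by blast
    qed
    then have "L \<subseteq> P" using W L.Icarr by blast
    then show False using L by blast
  qed
  obtain f where f: "f \<in> M" "\<And>L x. \<lbrakk>ideal L A; x \<in> T; x \<in> L\<rbrakk> \<Longrightarrow> f \<in> L"
    using A.exists_monomial_in_ideals[of T T] S(1) T(2) unfolding M_def T_def by blast
  have "f \<in> L" if "L \<in> poisson_spec A" "P \<subseteq> L" "L \<noteq> P" for L
    using main[OF that] f(2)[of L] that(1) by (auto simp: poisson_spec_def poisson_ideal_def)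
  then have "\<forall>L \<in> poisson_spec A. P \<subseteq> L \<and> L \<noteq> P \<longrightarrow> f \<in> L" by blast
  moreover have "f \<in> carrier A - P" using f(1) MP by blast
  moreover have "P \<in> poisson_spec A" using P.primeideal poisson_ideal by (simp add: poisson_spec_def)
  ultimately show ?thesis by (subst poisson_locally_closed_iff) (assumption, rule bexI)
qed

end

section \<open>The Poisson semi-centre\<close>

context poisson_algebra begin

lemma generated_subalgebra_closed:
  shows "\<one> \<in> generated_subalgebra K A S"
    and "\<lbrakk>a \<in> generated_subalgebra K A S; b \<in> generated_subalgebra K A S\<rbrakk> \<Longrightarrow> a \<oplus> b \<in> generated_subalgebra K A S"
    and "\<lbrakk>a \<in> generated_subalgebra K A S; b \<in> generated_subalgebra K A S\<rbrakk> \<Longrightarrow> a \<otimes> b \<in> generated_subalgebra K A S"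
    and "\<lbrakk>r \<in> carrier K; a \<in> generated_subalgebra K A S\<rbrakk> \<Longrightarrow> r \<odot> a \<in> generated_subalgebra K A S"
    and "S \<subseteq> generated_subalgebra K A S"
proof -
  show "\<one> \<in> generated_subalgebra K A S" unfolding generated_subalgebra_def
    using subringE(3)[where R = A] by auto
  show "\<lbrakk>a \<in> generated_subalgebra K A S; b \<in> generated_subalgebra K A S\<rbrakk> \<Longrightarrow> a \<oplus> b \<in> generated_subalgebra K A S"
    unfolding generated_subalgebra_def using subringE(7)[where R = A] by simp
  show "\<lbrakk>a \<in> generated_subalgebra K A S; b \<in> generated_subalgebra K A S\<rbrakk> \<Longrightarrow> a \<otimes> b \<in> generated_subalgebra K A S"
    unfolding generated_subalgebra_def using subringE(6)[where R = A] by simp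
  show "\<lbrakk>r \<in> carrier K; a \<in> generated_subalgebra K A S\<rbrakk> \<Longrightarrow> r \<odot> a \<in> generated_subalgebra K A S"
    unfolding generated_subalgebra_def using submodule.smult_closed[where M = A and R = K] by simp
  show "S \<subseteq> generated_subalgebra K A S" unfolding generated_subalgebra_def by blast
qed

lemma generated_subalgebra_carrier: "S \<subseteq> carrier A \<Longrightarrow> generated_subalgebra K A S \<subseteq> carrier A"
  by (rule generated_subalgebra_subset(3)) auto

lemma generated_subalgebra_mono: "S \<subseteq> T \<Longrightarrow> generated_subalgebra K A S \<subseteq> generated_subalgebra K A T"
  unfolding generated_subalgebra_def by blast

lemma subalgebra_poisson_algebra:
  assumes C: "subring C A" "submodule C K A"
    and br: "\<And>a b. \<lbrakk>a \<in> C; b \<in> C\<rbrakk> \<Longrightarrow> \<lbrace>a, b\<rbrace> \<in> C"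
  shows "poisson_algebra K (A\<lparr>carrier := C\<rparr>)"
proof -
  have sub: "a \<in> carrier A" if "a \<in> C" for a using subringE(1)[OF C(1)] that by blast
  have B: "cring (A\<lparr>carrier := C\<rparr>)"
    using A.subcring_iff[OF subringE(1)[OF C(1)]] A.subcringI'[OF C(1)] by blast
  have "algebra K (A\<lparr>carrier := C\<rparr>)"
  proof (rule algebraI[OF _ B])
    show "cring K" ..
  qed (use submodule.smult_closed[OF C(2)] sub in
      \<open>auto simp: smult_l_distr smult_r_distr smult_assoc1 smult_assoc2\<close>)
  then interpret B: algebra K "A\<lparr>carrier := C\<rparr>" .
  show ?thesis
    by unfold_locales
      (use br sub in \<open>auto simp: bracket_add_left bracket_add_right bracket_smult_left bracket_smult_right
        bracket_alternating bracket_jacobi bracket_leibniz_left bracket_leibniz_right\<close>)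
qed

lemma poisson_normalI:
  assumes "a \<in> carrier A" "\<And>b. b \<in> carrier A \<Longrightarrow> \<exists>c \<in> carrier A. \<lbrace>b, a\<rbrace> = c \<otimes> a"
  shows "poisson_normal A a"
  using assms by (auto simp: poisson_normal_def cgenideal_def)

lemma poisson_normalE:
  assumes "poisson_normal A a" "b \<in> carrier A"
  obtains c where "c \<in> carrier A" "\<lbrace>b, a\<rbrace> = c \<otimes> a"
  using assms by (auto simp: poisson_normal_def cgenideal_def)

lemma poisson_normal_weight:
  assumes dom: "domain A" and a: "poisson_normal A a" "a \<noteq> \<zero>"
  obtains f where "f \<in> weights K A" "\<And>b. b \<in> carrier A \<Longrightarrow> \<lbrace>b, a\<rbrace> = f b \<otimes> a" "f \<in> carrier A \<rightarrow> carrier A"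
proof -
  interpret D: domain A by fact
  have ac: "a \<in> carrier A" using a by (simp add: poisson_normal_def)
  define f where "f b = (SOME c. c \<in> carrier A \<and> \<lbrace>b, a\<rbrace> = c \<otimes> a)" for b
  have f: "f b \<in> carrier A" "\<lbrace>b, a\<rbrace> = f b \<otimes> a" if b: "b \<in> carrier A" for b
  proof -
    have "\<exists>c. c \<in> carrier A \<and> \<lbrace>b, a\<rbrace> = c \<otimes> a" using poisson_normalE[OF a(1) b] by metis
    from someI_ex[OF this] show "f b \<in> carrier A" "\<lbrace>b, a\<rbrace> = f b \<otimes> a" by (simp_all add: f_def)
  qed
  have uniq: "x = y" if "x \<otimes> a = y \<otimes> a" "x \<in> carrier A" "y \<in> carrier A" for x y
    using that D.m_rcancel[OF a(2) ac] by blast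
  have "f \<in> poisson_derivations K A"
    unfolding poisson_derivations_def
  proof (intro CollectI conjI ballI)
    show "f \<in> carrier A \<rightarrow> carrier A" using f by blast
  next
    fix b c assume bc: "b \<in> carrier A" "c \<in> carrier A"
    note fb = f[OF bc(1)] and fc = f[OF bc(2)]
    show "f (b \<oplus> c) = f b \<oplus> f c"
    proof (rule uniq)
      have "f (b \<oplus> c) \<otimes> a = f b \<otimes> a \<oplus> f c \<otimes> a"
        using f(2)[of "b \<oplus> c"] bc ac by (simp add: bracket_add_left fb(2) fc(2))
      also have "\<dots> = (f b \<oplus> f c) \<otimes> a" using fb(1) fc(1) ac by (simp add: A.l_distr)
      finally show "f (b \<oplus> c) \<otimes> a = (f b \<oplus> f c) \<otimes> a" .
    qed (use f bc in auto)
    show "f (b \<otimes> c) = b \<otimes> f c \<oplus> f b \<otimes> c"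
    proof (rule uniq)
      have "f (b \<otimes> c) \<otimes> a = b \<otimes> (f c \<otimes> a) \<oplus> (f b \<otimes> a) \<otimes> c"
        using f(2)[of "b \<otimes> c"] bc ac by (simp add: bracket_leibniz_left fb(2) fc(2))
      also have "\<dots> = (b \<otimes> f c \<oplus> f b \<otimes> c) \<otimes> a" using fb(1) fc(1) bc ac by algebra
      finally show "f (b \<otimes> c) \<otimes> a = (b \<otimes> f c \<oplus> f b \<otimes> c) \<otimes> a" .
    qed (use f bc in auto)
    show "f \<lbrace>b, c\<rbrace> = \<lbrace>f b, c\<rbrace> \<oplus> \<lbrace>b, f c\<rbrace>"
    proof (rule uniq)
      have bcc: "\<lbrace>b, c\<rbrace> \<in> carrier A" using bc bracket_closed by simp
      define p q where "p = \<lbrace>b, f c\<rbrace>" "q = \<lbrace>c, f b\<rbrace>"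
      have pq: "p \<in> carrier A" "q \<in> carrier A" using bc fb fc bracket_closed by (auto simp: p_q_def)
      have "\<lbrace>b, \<lbrace>c, a\<rbrace>\<rbrace> = f c \<otimes> (f b \<otimes> a) \<oplus> p \<otimes> a"
        using bc ac fc(1) by (simp add: fc(2) bracket_leibniz_right fb(2) p_q_def)
      moreover have "\<lbrace>c, \<lbrace>a, b\<rbrace>\<rbrace> = \<ominus> (f b \<otimes> (f c \<otimes> a) \<oplus> q \<otimes> a)"
        using bc ac fb(1) bracket_antisym[of a b]
        by (simp add: fb(2) bracket_minus_right bracket_leibniz_right fc(2) p_q_def)
      moreover have "\<lbrace>a, \<lbrace>b, c\<rbrace>\<rbrace> = \<ominus> (f \<lbrace>b, c\<rbrace> \<otimes> a)"
        using f[OF bcc] bracket_antisym[OF ac bcc] by simp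
      ultimately have J: "\<ominus> (f \<lbrace>b, c\<rbrace> \<otimes> a) \<oplus> (f c \<otimes> (f b \<otimes> a) \<oplus> p \<otimes> a) \<oplus> \<ominus> (f b \<otimes> (f c \<otimes> a) \<oplus> q \<otimes> a) = \<zero>"
        using bracket_jacobi[OF ac bc] by simp
      define w where "w = f \<lbrace>b, c\<rbrace>"
      have w: "w \<in> carrier A" using f(1)[OF bcc] by (simp add: w_def)
      have "w \<otimes> a = (\<ominus> (w \<otimes> a) \<oplus> (f c \<otimes> (f b \<otimes> a) \<oplus> p \<otimes> a) \<oplus> \<ominus> (f b \<otimes> (f c \<otimes> a) \<oplus> q \<otimes> a)) \<oplus> w \<otimes> a"
        unfolding J[folded w_def] using w ac by simp
      also have "\<dots> = (\<ominus> q \<oplus> p) \<otimes> a" using w ac pq fb(1) fc(1) by algebra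
      also have "\<ominus> q = \<lbrace>f b, c\<rbrace>" using bracket_antisym[of "f b" c] fb(1) bc by (simp add: p_q_def)
      finally show "f \<lbrace>b, c\<rbrace> \<otimes> a = (\<lbrace>f b, c\<rbrace> \<oplus> \<lbrace>b, f c\<rbrace>) \<otimes> a" by (simp add: w_def p_q_def)
    qed (use f bc bracket_closed in auto)
  next
    fix r b assume rb: "r \<in> carrier K" "b \<in> carrier A"
    show "f (r \<odot> b) = r \<odot> f b"
    proof (rule uniq)
      have "f (r \<odot> b) \<otimes> a = r \<odot> (f b \<otimes> a)"
        using f(2)[of "r \<odot> b"] rb ac by (simp add: bracket_smult_left f(2)[OF rb(2)])
      then show "f (r \<odot> b) \<otimes> a = (r \<odot> f b) \<otimes> a" using f(1)[OF rb(2)] rb ac by (simp add: smult_assoc2)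
    qed (use f rb in auto)
  qed
  moreover have "a \<in> weight_space A f" using f ac by (simp add: weight_space_def)
  ultimately have "f \<in> weights K A" using a(2) by (auto simp: weights_def)
  then show thesis using that f by blast
qed

lemma bracket_poisson_normal:
  assumes dom: "domain A" and ab: "abelian_weight_property K A"
    and x: "poisson_normal A x" and y: "poisson_normal A y"
  shows "poisson_normal A \<lbrace>x, y\<rbrace>"
    and "b \<in> carrier A \<Longrightarrow> (x \<otimes> y) \<otimes> \<lbrace>\<lbrace>x, y\<rbrace>, b\<rbrace> = \<lbrace>x, y\<rbrace> \<otimes> \<lbrace>x \<otimes> y, b\<rbrace>"
proof -
  interpret D: domain A by fact
  have c: "x \<in> carrier A" "y \<in> carrier A" using x y by (auto simp: poisson_normal_def)
  have zero: "poisson_normal A \<zero>" by (rule poisson_normalI) (auto intro!: bexI[of _ \<zero>])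
  have "poisson_normal A \<lbrace>x, y\<rbrace> \<and>
    (\<forall>b \<in> carrier A. (x \<otimes> y) \<otimes> \<lbrace>\<lbrace>x, y\<rbrace>, b\<rbrace> = \<lbrace>x, y\<rbrace> \<otimes> \<lbrace>x \<otimes> y, b\<rbrace>)"
  proof (cases "x = \<zero> \<or> y = \<zero>")
    case True
    then have "\<lbrace>x, y\<rbrace> = \<zero>" using c by auto
    then show ?thesis using zero True c bracket_closed by auto
  next
    case False
    obtain f where f: "f \<in> weights K A" "\<And>b. b \<in> carrier A \<Longrightarrow> \<lbrace>b, x\<rbrace> = f b \<otimes> x" "f \<in> carrier A \<rightarrow> carrier A"
      using poisson_normal_weight[OF dom x] False by blast
    obtain g where g: "g \<in> weights K A" "\<And>b. b \<in> carrier A \<Longrightarrow> \<lbrace>b, y\<rbrace> = g b \<otimes> y" "g \<in> carrier A \<rightarrow> carrier A"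
      using poisson_normal_weight[OF dom y] False by blast
    define u where "u = \<lbrace>x, y\<rbrace>"
    have u: "u \<in> carrier A" using c bracket_closed by (simp add: u_def)
    have fg: "f b \<in> carrier A" "g b \<in> carrier A" if "b \<in> carrier A" for b using f(3) g(3) that by auto
    have key: "\<lbrace>b, u\<rbrace> = (f b \<oplus> g b) \<otimes> u" if b: "b \<in> carrier A" for b
    proof -
      have "f (g b) \<ominus> g (f b) = \<zero>"
        using ab f(1) g(1) b unfolding abelian_weight_property_def commutator_def by blast
      then have com: "g (f b) = f (g b)" using fg b by (metis A.r_right_minus_eq)
      define p q w where "p = f b" "q = g b" "w = f (g b)"
      have cl: "p \<in> carrier A" "q \<in> carrier A" "w \<in> carrier A" using fg b by (auto simp: p_q_w_def)
      have 1: "\<lbrace>y, \<lbrace>b, x\<rbrace>\<rbrace> = \<ominus> (p \<otimes> u \<oplus> (w \<otimes> y) \<otimes> x)"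
      proof -
        have "\<lbrace>y, p \<otimes> x\<rbrace> = p \<otimes> \<lbrace>y, x\<rbrace> \<oplus> \<lbrace>y, p\<rbrace> \<otimes> x" using cl c by (simp add: bracket_leibniz_right)
        moreover have "\<lbrace>y, x\<rbrace> = \<ominus> u" using bracket_antisym[OF c(2,1)] by (simp add: u_def)
        moreover have "\<lbrace>y, p\<rbrace> = \<ominus> (w \<otimes> y)"
          using bracket_antisym[OF c(2) cl(1)] g(2)[OF cl(1)] com by (simp add: p_q_w_def)
        moreover have "p \<otimes> \<ominus> u \<oplus> \<ominus> (w \<otimes> y) \<otimes> x = \<ominus> (p \<otimes> u \<oplus> (w \<otimes> y) \<otimes> x)" using cl c u by algebra
        ultimately show ?thesis using f(2)[OF b] by (simp add: p_q_w_def(1)[symmetric])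
      qed
      have 2: "\<lbrace>x, \<lbrace>y, b\<rbrace>\<rbrace> = \<ominus> (q \<otimes> u \<oplus> \<ominus> (w \<otimes> x) \<otimes> y)"
      proof -
        have "\<lbrace>y, b\<rbrace> = \<ominus> (q \<otimes> y)" using bracket_antisym[OF c(2) b] g(2)[OF b] by (simp add: p_q_w_def)
        then have "\<lbrace>x, \<lbrace>y, b\<rbrace>\<rbrace> = \<ominus> (q \<otimes> \<lbrace>x, y\<rbrace> \<oplus> \<lbrace>x, q\<rbrace> \<otimes> y)"
          using cl c by (simp add: bracket_minus_right bracket_leibniz_right)
        moreover have "\<lbrace>x, q\<rbrace> = \<ominus> (w \<otimes> x)"
          using bracket_antisym[OF c(1) cl(2)] f(2)[OF cl(2)] by (simp add: p_q_w_def)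
        ultimately show ?thesis by (simp add: u_def)
      qed
      have bu: "\<lbrace>b, u\<rbrace> \<in> carrier A" using b u bracket_closed by simp
      have J: "\<lbrace>b, u\<rbrace> \<oplus> \<ominus> (q \<otimes> u \<oplus> \<ominus> (w \<otimes> x) \<otimes> y) \<oplus> \<ominus> (p \<otimes> u \<oplus> (w \<otimes> y) \<otimes> x) = \<zero>"
        using bracket_jacobi[OF b c] unfolding 1 2 u_def[symmetric] .
      define z where "z = \<lbrace>b, u\<rbrace>"
      have "z = (z \<oplus> \<ominus> (q \<otimes> u \<oplus> \<ominus> (w \<otimes> x) \<otimes> y) \<oplus> \<ominus> (p \<otimes> u \<oplus> (w \<otimes> y) \<otimes> x)) \<oplus> (p \<oplus> q) \<otimes> u"
        using bu[folded z_def] cl c u by algebra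
      then show ?thesis using J[folded z_def] cl u by (simp add: z_def p_q_w_def)
    qed
    have "poisson_normal A u" using key u fg by (intro poisson_normalI) (auto intro!: bexI[of _ "f b \<oplus> g b" for b])
    moreover have "(x \<otimes> y) \<otimes> \<lbrace>u, b\<rbrace> = u \<otimes> \<lbrace>x \<otimes> y, b\<rbrace>" if b: "b \<in> carrier A" for b
    proof -
      define p q where "p = f b" "q = g b"
      have cl: "p \<in> carrier A" "q \<in> carrier A" using fg b by (auto simp: p_q_def)
      have "\<lbrace>u, b\<rbrace> = \<ominus> ((p \<oplus> q) \<otimes> u)" using bracket_antisym[OF u b] key[OF b] by (simp add: p_q_def)
      moreover have "\<lbrace>x, b\<rbrace> = \<ominus> (p \<otimes> x)" "\<lbrace>y, b\<rbrace> = \<ominus> (q \<otimes> y)"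
        using bracket_antisym[OF c(1) b] bracket_antisym[OF c(2) b] f(2)[OF b] g(2)[OF b] by (simp_all add: p_q_def)
      then have "\<lbrace>x \<otimes> y, b\<rbrace> = x \<otimes> \<ominus> (q \<otimes> y) \<oplus> \<ominus> (p \<otimes> x) \<otimes> y"
        using c b by (simp add: bracket_leibniz_left)
      moreover have "(x \<otimes> y) \<otimes> \<ominus> ((p \<oplus> q) \<otimes> u) = u \<otimes> (x \<otimes> \<ominus> (q \<otimes> y) \<oplus> \<ominus> (p \<otimes> x) \<otimes> y)"
        using cl c u by algebra
      ultimately show ?thesis by simp
    qed
    ultimately show ?thesis by (simp add: u_def)
  qed
  then show "poisson_normal A \<lbrace>x, y\<rbrace>"
    and "b \<in> carrier A \<Longrightarrow> (x \<otimes> y) \<otimes> \<lbrace>\<lbrace>x, y\<rbrace>, b\<rbrace> = \<lbrace>x, y\<rbrace> \<otimes> \<lbrace>x \<otimes> y, b\<rbrace>" by auto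
qed

lemma generated_subalgebra_bracket:
  assumes N: "N \<subseteq> carrier A" and br: "\<And>x y. \<lbrakk>x \<in> N; y \<in> N\<rbrakk> \<Longrightarrow> \<lbrace>x, y\<rbrace> \<in> generated_subalgebra K A N"
    and "a \<in> generated_subalgebra K A N" "b \<in> generated_subalgebra K A N"
  shows "\<lbrace>a, b\<rbrace> \<in> generated_subalgebra K A N"
proof -
  let ?C = "generated_subalgebra K A N"
  note C = generated_subalgebra_closed[where S = N]
  have Cc: "?C \<subseteq> carrier A" using generated_subalgebra_carrier[OF N] .
  have step: "\<lbrace>x, b\<rbrace> \<in> ?C" if x: "x \<in> carrier A" "\<And>y. y \<in> N \<Longrightarrow> \<lbrace>x, y\<rbrace> \<in> ?C" and b: "b \<in> ?C" for x b
  proof -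
    have "?C \<subseteq> {b \<in> ?C. \<lbrace>x, b\<rbrace> \<in> ?C}"
    proof (rule generated_subalgebra_subset(3))
      show "{b \<in> ?C. \<lbrace>x, b\<rbrace> \<in> ?C} \<subseteq> carrier A" using Cc by blast
      show "N \<subseteq> {b \<in> ?C. \<lbrace>x, b\<rbrace> \<in> ?C}" using C(5) x(2) by blast
      have "\<zero> \<in> ?C" using C(4)[OF K.zero_closed C(1)] by simp
      then show "\<one> \<in> {b \<in> ?C. \<lbrace>x, b\<rbrace> \<in> ?C}" using C(1) bracket_one[OF x(1)] by simp
    next
      fix b d assume bd: "b \<in> {b \<in> ?C. \<lbrace>x, b\<rbrace> \<in> ?C}" "d \<in> {b \<in> ?C. \<lbrace>x, b\<rbrace> \<in> ?C}"
      then have c: "b \<in> carrier A" "d \<in> carrier A" using Cc by auto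
      show "b \<oplus> d \<in> {b \<in> ?C. \<lbrace>x, b\<rbrace> \<in> ?C}" "b \<otimes> d \<in> {b \<in> ?C. \<lbrace>x, b\<rbrace> \<in> ?C}"
        using bd C(2,3) by (simp_all add: bracket_add_right[OF x(1) c] bracket_leibniz_right[OF x(1) c])
    next
      fix r b assume rb: "r \<in> carrier K" "b \<in> {b \<in> ?C. \<lbrace>x, b\<rbrace> \<in> ?C}"
      then have c: "b \<in> carrier A" using Cc by auto
      show "r \<odot> b \<in> {b \<in> ?C. \<lbrace>x, b\<rbrace> \<in> ?C}"
        using rb C(4) by (simp add: bracket_smult_right[OF rb(1) x(1) c])
    qed
    then show ?thesis using b by blast
  qed
  have ac: "a \<in> carrier A" using assms(3) Cc by blast
  have "\<lbrace>a, y\<rbrace> \<in> ?C" if y: "y \<in> N" for y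
  proof -
    have yc: "y \<in> carrier A" using y N by blast
    have "(\<ominus>\<^bsub>K\<^esub> \<one>\<^bsub>K\<^esub>) \<odot> \<lbrace>y, a\<rbrace> \<in> ?C"
      by (rule C(4)[OF _ step[OF yc br[OF y] assms(3)]]) simp
    then show ?thesis
      using bracket_antisym[OF ac yc] bracket_closed[OF yc ac] by (simp add: smult_l_minus)
  qed
  from step[OF ac this assms(4)] show ?thesis .
qed

lemma semicentre_poisson_algebra:
  assumes "domain A" "abelian_weight_property K A"
  shows "poisson_algebra K (semicentre K A)"
proof -
  let ?N = "{a. poisson_normal A a}"
  have N: "?N \<subseteq> carrier A" by (auto simp: poisson_normal_def)
  note C = generated_subalgebra_closed[where S = ?N]
  have Cc: "generated_subalgebra K A ?N \<subseteq> carrier A" using generated_subalgebra_carrier[OF N] .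
  have br: "\<lbrace>x, y\<rbrace> \<in> generated_subalgebra K A ?N" if "x \<in> ?N" "y \<in> ?N" for x y
    using bracket_poisson_normal(1)[OF assms] that C(5) by blast
  show ?thesis
    unfolding semicentre_def
    by (intro subalgebra_poisson_algebra generated_subalgebra_subset(1,2)[OF Cc C(5,1)]
        generated_subalgebra_bracket[OF N br] C(2,3,4))
qed

text \<open>Each element of a finite generating set only involves finitely many elements of \<open>N\<close>.\<close>

lemma finite_generators_subset:
  assumes fg: "finitely_generated_algebra K A" and N: "N \<subseteq> carrier A"
    and gen: "carrier A \<subseteq> generated_subalgebra K A N"
  obtains S where "finite S" "S \<subseteq> N" "generated_subalgebra K A S = carrier A"
proof -
  obtain T where T: "finite T" "T \<subseteq> carrier A" "generated_subalgebra K A T = carrier A"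
    using fg unfolding finitely_generated_algebra_def by blast
  let ?G = "generated_subalgebra K A"
  let ?U = "\<Union>S \<in> {S. finite S \<and> S \<subseteq> N}. ?G S"
  have UI: "a \<in> ?U" if "finite S" "S \<subseteq> N" "a \<in> ?G S" for a S using that by blast
  have common: "\<exists>S. finite S \<and> S \<subseteq> N \<and> a \<in> ?G S \<and> b \<in> ?G S" if ab: "a \<in> ?U" "b \<in> ?U" for a b
  proof -
    obtain S S' where "finite S" "S \<subseteq> N" "a \<in> ?G S" "finite S'" "S' \<subseteq> N" "b \<in> ?G S'" using ab by blast
    then show ?thesis
      using generated_subalgebra_mono[of S "S \<union> S'"] generated_subalgebra_mono[of S' "S \<union> S'"]
      by (intro exI[of _ "S \<union> S'"]) auto
  qed
  have "?G N \<subseteq> ?U"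
  proof (rule generated_subalgebra_subset(3))
    show "?U \<subseteq> carrier A"
    proof
      fix x assume "x \<in> ?U"
      then obtain S where S: "S \<subseteq> N" "x \<in> ?G S" by blast
      show "x \<in> carrier A" using generated_subalgebra_carrier[OF order_trans[OF S(1) N]] S(2) by blast
    qed
    show "N \<subseteq> ?U"
    proof
      fix x assume "x \<in> N"
      then show "x \<in> ?U" using UI[of "{x}" x] generated_subalgebra_closed(5)[of "{x}"] by blast
    qed
    show "\<one> \<in> ?U" by (rule UI[OF finite.emptyI empty_subsetI generated_subalgebra_closed(1)])
  next
    fix a b assume "a \<in> ?U" "b \<in> ?U"
    from common[OF this] obtain S where S: "finite S" "S \<subseteq> N" "a \<in> ?G S" "b \<in> ?G S" by (elim exE conjE)
    show "a \<oplus> b \<in> ?U" by (rule UI[OF S(1,2) generated_subalgebra_closed(2)[OF S(3,4)]])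
    show "a \<otimes> b \<in> ?U" by (rule UI[OF S(1,2) generated_subalgebra_closed(3)[OF S(3,4)]])
  next
    fix r a assume r: "r \<in> carrier K" "a \<in> ?U"
    then obtain S where S: "finite S" "S \<subseteq> N" "a \<in> ?G S" by blast
    show "r \<odot> a \<in> ?U" by (rule UI[OF S(1,2) generated_subalgebra_closed(4)[OF r(1) S(3)]])
  qed
  then have U: "t \<in> ?U" if "t \<in> T" for t using that gen T(2) by blast
  have "\<exists>S. finite S \<and> S \<subseteq> N \<and> T' \<subseteq> ?G S" if "finite T'" "T' \<subseteq> T" for T'
    using that
  proof (induction T')
    case empty
    show ?case by (intro exI[of _ "{}"]) simp
  next
    case (insert t T')
    then obtain S where S: "finite S" "S \<subseteq> N" "T' \<subseteq> ?G S" by blast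
    have "t \<in> ?U" using U insert.prems by simp
    then obtain S' where S': "finite S'" "S' \<subseteq> N" "t \<in> ?G S'" by blast
    have "insert t T' \<subseteq> ?G (S \<union> S')"
      using S(3) S'(3) generated_subalgebra_mono[OF Un_upper1, of S S'] generated_subalgebra_mono[OF Un_upper2, of S' S]
      by blast
    then show ?case using S S' by (intro exI[of _ "S \<union> S'"]) simp
  qed
  then obtain S where S: "finite S" "S \<subseteq> N" "T \<subseteq> ?G S" using T(1) by blast
  have Sc: "?G S \<subseteq> carrier A" using generated_subalgebra_carrier S(2) N by blast
  have "?G T \<subseteq> ?G S"
    by (rule generated_subalgebra_subset(3)[OF Sc S(3) generated_subalgebra_closed(1-4)])
  then have "?G S = carrier A" using T(3) Sc by blast
  then show thesis by (rule that[OF S(1,2)])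
qed

lemma generated_subalgebra_restrict:
  assumes N: "N \<subseteq> carrier A" and B: "poisson_algebra K (A\<lparr>carrier := generated_subalgebra K A N\<rparr>)"
  shows "generated_subalgebra K A N \<subseteq> generated_subalgebra K (A\<lparr>carrier := generated_subalgebra K A N\<rparr>) N"
proof -
  let ?B = "A\<lparr>carrier := generated_subalgebra K A N\<rparr>"
  interpret B: poisson_algebra K ?B by fact
  have sub: "generated_subalgebra K ?B N \<subseteq> generated_subalgebra K A N"
    using B.generated_subalgebra_carrier[of N] generated_subalgebra_closed(5)[of N] by simp
  show ?thesis
    using B.generated_subalgebra_closed[where S = N] sub generated_subalgebra_carrier[OF N]
    by (intro generated_subalgebra_subset(3)) auto
qed

end

theorem theorem1p3:
  fixes K :: "('k, 'm) ring_scheme"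
    and A :: "('k, 'a, 'n) poisson_scheme"
  assumes "field K" and "char_zero K"
    and "poisson_algebra K A" and "domain A"
    and "abelian_weight_property K A"
    and "finitely_generated_algebra K (semicentre K A)"
  shows "\<forall>I \<in> poisson_spec (semicentre K A).
    (poisson_locally_closed (semicentre K A) I \<longleftrightarrow> poisson_primitive (semicentre K A) I) \<and>
    (poisson_primitive (semicentre K A) I \<longleftrightarrow> poisson_rational K (semicentre K A) I)"
proof
  let ?B = "semicentre K A" and ?N = "{a. poisson_normal A a}"
  fix I assume I: "I \<in> poisson_spec ?B"
  interpret A: poisson_algebra K A by fact
  have PB: "poisson_algebra K ?B" using A.semicentre_poisson_algebra assms(4,5) by blast
  interpret B: poisson_algebra K ?B by fact
  have "primeideal I ?B" "poisson_ideal I ?B" using I by (auto simp: poisson_spec_def)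
  then interpret R: poisson_residue K ?B I
    using PB by (intro poisson_residue.intro residue.intro poisson_residue_axioms.intro)
  have N: "?N \<subseteq> carrier A" by (auto simp: poisson_normal_def)
  have BC: "carrier ?B = generated_subalgebra K A ?N" by (simp add: semicentre_def)
  have Bc: "carrier ?B \<subseteq> carrier A" unfolding BC by (rule A.generated_subalgebra_carrier[OF N])
  have NB: "?N \<subseteq> carrier ?B" unfolding BC by (rule A.generated_subalgebra_closed(5))
  have ops: "mult ?B = mult A" "pbracket ?B = pbracket A" by (simp_all add: semicentre_def)
  have "carrier ?B \<subseteq> generated_subalgebra K ?B ?N"
    using A.generated_subalgebra_restrict[OF N] PB unfolding semicentre_def by simp
  then obtain S where S: "finite S" "S \<subseteq> ?N" "generated_subalgebra K ?B S = carrier ?B"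
    using B.finite_generators_subset[OF assms(6) NB] by blast
  have br: "\<lbrace>x, y\<rbrace>\<^bsub>?B\<^esub> \<in> R.central_over (x \<otimes>\<^bsub>?B\<^esub> y)" if xy: "x \<in> S" "y \<in> S" for x y
  proof -
    have xN: "poisson_normal A x" "poisson_normal A y" using xy S(2) by auto
    have c: "x \<in> carrier ?B" "y \<in> carrier ?B" using xN NB by auto
    have eq: "(x \<otimes>\<^bsub>?B\<^esub> y) \<otimes>\<^bsub>?B\<^esub> \<lbrace>\<lbrace>x, y\<rbrace>\<^bsub>?B\<^esub>, b\<rbrace>\<^bsub>?B\<^esub> = \<lbrace>x, y\<rbrace>\<^bsub>?B\<^esub> \<otimes>\<^bsub>?B\<^esub> \<lbrace>x \<otimes>\<^bsub>?B\<^esub> y, b\<rbrace>\<^bsub>?B\<^esub>"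
      if "b \<in> carrier ?B" for b
      using A.bracket_poisson_normal(2)[OF assms(4,5) xN] that Bc unfolding ops by blast
    have u: "\<lbrace>x, y\<rbrace>\<^bsub>?B\<^esub> \<in> carrier ?B" using c B.bracket_closed by blast
    have "(x \<otimes>\<^bsub>?B\<^esub> y) \<otimes>\<^bsub>?B\<^esub> \<lbrace>\<lbrace>x, y\<rbrace>\<^bsub>?B\<^esub>, b\<rbrace>\<^bsub>?B\<^esub> \<ominus>\<^bsub>?B\<^esub> \<lbrace>x, y\<rbrace>\<^bsub>?B\<^esub> \<otimes>\<^bsub>?B\<^esub> \<lbrace>x \<otimes>\<^bsub>?B\<^esub> y, b\<rbrace>\<^bsub>?B\<^esub> \<in> I"
      if b: "b \<in> carrier ?B" for b
    proof -
      have "\<lbrace>x, y\<rbrace>\<^bsub>?B\<^esub> \<otimes>\<^bsub>?B\<^esub> \<lbrace>x \<otimes>\<^bsub>?B\<^esub> y, b\<rbrace>\<^bsub>?B\<^esub> \<in> carrier ?B" using u c b B.bracket_closed by simp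
      then show ?thesis unfolding eq[OF b] using R.P.zero_closed by (simp add: a_minus_def B.A.M.r_neg)
    qed
    then show ?thesis unfolding R.central_over_def using u by blast
  qed
  have 1: "poisson_primitive ?B I" if "poisson_locally_closed ?B I"
    using B.locally_closed_imp_primitive[OF assms(2,6) I that] .
  have 2: "poisson_rational K ?B I" if "poisson_primitive ?B I"
    using R.primitive_imp_rational[OF assms(6) that] .
  have 3: "poisson_locally_closed ?B I" if "poisson_rational K ?B I"
    using R.rational_imp_locally_closed[OF S(1) _ S(3) br that] S(2) NB by blast
  show "(poisson_locally_closed ?B I \<longleftrightarrow> poisson_primitive ?B I) \<and>
    (poisson_primitive ?B I \<longleftrightarrow> poisson_rational K ?B I)"
    using 1 2 3 by blast
qed

end
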